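(* Let $A$ be a domain with fraction field $K$, and let $\delta\in\mathrm{EXP}_A(A^{[3]})$. Let $\delta_K\in\mathrm{EXP}_K(K^{[3]})$ be the extension of $\delta$ to $K^{[3]}=K\otimes_A A^{[3]}$. Suppose $\mathrm{rank}(\delta)=\mathrm{rank}(\delta_K)$. Then $\delta$ is rigid.
   Context: All rings are commutative with unity. For a domain $A$, $A^{[n]}$ denotes the polynomial ring in $n$ variables over $A$. Exponential map: for domains $A\subset B$, an exponential map on $B$ (over $A$) is an $A$-algebra homomorphism $\delta=\delta_t:B\to B[t]$ ($t$ an indeterminate) such that (1) composing $\delta_t$ with evaluation at $t=0$ gives the identity of $B$, and (2) $\delta_s\circ\delta_t=\delta_{s+t}$, where $\delta_s$ is extended to a homomorphism $B[t]\to B[s,t]$ by $\delta_s(t)=t$. $\mathrm{EXP}_A(B)$ is the set of all of these. The ring of invariants is $B^\delta=\{x\in B:\delta(x)=x\}$. Coordinate systems, rank: for $B=A^{[n]}$, a coordinate system of $B$ over $A$ is a system $\{X_1,\dots,X_n\}$ of elements of $B$ (listed in order) with $B=A[X_1,\dots,X_n]$; $\Gamma(B)$ is the set of all coordinate systems. For $\delta\in\mathrm{EXP}_A(B)$, $\mathrm{rank}(\delta)$ is the least integer $r\ge 0$ for which there is $\{X_1,\dots,X_n\}\in\Gamma(B)$ with $A[X_1,\dots,X_{n-r}]\subset B^\delta$. If $\mathrm{rank}(\delta)=r$, $\Gamma_\delta(B)$ is the set of $\{X_1,\dots,X_n\}\in\Gamma(B)$ with $A[X_1,\dots,X_{n-r}]\subset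 B^\delta$. Rigid: $\delta\in\mathrm{EXP}_A(A^{[n]})$ of rank $r$ is rigid if $A[X_1,\dots,X_{n-r}]=A[X_1',\dots,X_{n-r}']$ whenever $\{X_1,\dots,X_n\},\{X_1',\dots,X_n'\}\in\Gamma_\delta(B)$. $\delta_K$: with $S=A\setminus\{0\}$ and $B=A^{[n]}$, one has $S^{-1}B=K^{[n]}$, and $\delta_K\in\mathrm{EXP}_K(K^{[n]})$ is defined by $\delta_K(b/s)=\delta(b)/s$ for $b\in B$, $s\in S$. The rank of $\delta_K$ is taken with respect to coordinate systems of $K^{[n]}$ over $K$. *)

theory Defs
  imports "HOL-Computational_Algebra.Computational_Algebra"
begin

section \<open>Subalgebras, exponential maps, coordinate systems, rank, rigidity\<close>

text \<open>
  An algebra \<open>B\<close> over \<open>A\<close> is given by its structure map \<open>\<iota> :: 'a \<Rightarrow> 'b\<close>, here always an injective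
  ring homomorphism (see \<open>const3\<close> below).
\<close>

inductive_set adjoin :: "('a::comm_ring_1 \<Rightarrow> 'b::comm_ring_1) \<Rightarrow> 'b set \<Rightarrow> 'b set"
  for \<iota> :: "'a \<Rightarrow> 'b" and S :: "'b set"
where
  const: "\<iota> a \<in> adjoin \<iota> S"
| gen: "x \<in> S \<Longrightarrow> x \<in> adjoin \<iota> S"
| add: "x \<in> adjoin \<iota> S \<Longrightarrow> y \<in> adjoin \<iota> S \<Longrightarrow> x + y \<in> adjoin \<iota> S"
| mult: "x \<in> adjoin \<iota> S \<Longrightarrow> y \<in> adjoin \<iota> S \<Longrightarrow> x * y \<in> adjoin \<iota> S"

text \<open>
  \<open>B[t]\<close> is \<^typ>\<open>'b poly\<close>. The ring \<open>B[s,t] = B[s][t]\<close> is \<^typ>\<open>'b poly poly\<close>, with \<open>s\<close> the inner and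
  \<open>t\<close> the outer variable. Hence \<open>map_poly \<delta>\<close> is the extension of \<open>\<delta>\<^sub>s : B \<rightarrow> B[s]\<close> to \<open>B[t] \<rightarrow> B[s,t]\<close>
  that fixes \<open>t\<close>, and \<open>\<delta>\<^bsub>s+t\<^esub> b\<close> is \<open>\<delta> b\<close> evaluated at \<open>s + t\<close>.
\<close>

definition var_s :: "'b::comm_ring_1 poly poly" where
  "var_s = [:[:0, 1:]:]"

definition var_t :: "'b::comm_ring_1 poly poly" where
  "var_t = [:0, 1:]"

definition EXP :: "('a::idom \<Rightarrow> 'b::idom) \<Rightarrow> ('b \<Rightarrow> 'b poly) set" where
  "EXP \<iota> = {\<delta>.
     (\<forall>x y. \<delta> (x + y) = \<delta> x + \<delta> y) \<and>
     (\<forall>x y. \<delta> (x * y) = \<delta> x * \<delta> y) \<and>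
     (\<forall>a. \<delta> (\<iota> a) = [:\<iota> a:]) \<and>
     (\<forall>b. poly (\<delta> b) 0 = b) \<and>
     (\<forall>b. map_poly \<delta> (\<delta> b) = poly (map_poly (\<lambda>c. [:[:c:]:]) (\<delta> b)) (var_s + var_t))}"

definition invariants :: "('b::idom \<Rightarrow> 'b poly) \<Rightarrow> 'b set" where
  "invariants \<delta> = {x. \<delta> x = [:x:]}"

text \<open>
  In the following definitions \<open>\<iota>\<close> is meant to make \<open>B\<close> a polynomial ring in \<open>n\<close> variables over \<open>A\<close>.
  Coordinate systems are lists, since the rank refers to initial segments; the bound \<open>r \<le> n\<close> only
  guards the truncated subtraction \<open>n - r\<close>.
\<close>

definition coord_systems :: "('a::idom \<Rightarrow> 'b::idom) \<Rightarrow> nat \<Rightarrow> 'b list set" where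
  "coord_systems \<iota> n = {Xs. length Xs = n \<and> adjoin \<iota> (set Xs) = UNIV}"

definition exp_rank :: "('a::idom \<Rightarrow> 'b::idom) \<Rightarrow> nat \<Rightarrow> ('b \<Rightarrow> 'b poly) \<Rightarrow> nat" where
  "exp_rank \<iota> n \<delta> =
     (LEAST r. r \<le> n \<and>
        (\<exists>Xs\<in>coord_systems \<iota> n. adjoin \<iota> (set (take (n - r) Xs)) \<subseteq> invariants \<delta>))"

definition adapted_coord_systems ::
    "('a::idom \<Rightarrow> 'b::idom) \<Rightarrow> nat \<Rightarrow> ('b \<Rightarrow> 'b poly) \<Rightarrow> 'b list set" where
  "adapted_coord_systems \<iota> n \<delta> =
     {Xs \<in> coord_systems \<iota> n. adjoin \<iota> (set (take (n - exp_rank \<iota> n \<delta>) Xs)) \<subseteq> invariants \<delta>}"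

definition rigid :: "('a::idom \<Rightarrow> 'b::idom) \<Rightarrow> nat \<Rightarrow> ('b \<Rightarrow> 'b poly) \<Rightarrow> bool" where
  "rigid \<iota> n \<delta> \<longleftrightarrow>
     (\<forall>Xs\<in>adapted_coord_systems \<iota> n \<delta>. \<forall>Ys\<in>adapted_coord_systems \<iota> n \<delta>.
        adjoin \<iota> (set (take (n - exp_rank \<iota> n \<delta>) Xs)) =
        adjoin \<iota> (set (take (n - exp_rank \<iota> n \<delta>) Ys)))"


section \<open>Three variables and extension to the fraction field\<close>

type_synonym 'a poly3 = "'a poly poly poly"

definition const3 :: "'a::idom \<Rightarrow> 'a poly3" where
  "const3 a = [:[:[:a:]:]:]"

definition to_fract3 :: "'a::idom poly3 \<Rightarrow> 'a fract poly3" where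
  "to_fract3 = map_poly (map_poly (map_poly to_fract))"

text \<open>
  The element \<open>b/s\<close> of \<open>S\<inverse>A\<^bsup>[3]\<^esup> = K\<^bsup>[3]\<^esup>\<close>, for \<open>s\<close> nonzero, and likewise \<open>p/s\<close> in \<open>K\<^bsup>[3]\<^esup>[t]\<close> for
  \<open>p\<close> in \<open>A\<^bsup>[3]\<^esup>[t]\<close>.
\<close>

definition frac3 :: "'a::idom poly3 \<Rightarrow> 'a \<Rightarrow> 'a fract poly3" where
  "frac3 b s = const3 (Fract 1 s) * to_fract3 b"

definition frac3_poly :: "'a::idom poly3 poly \<Rightarrow> 'a \<Rightarrow> 'a fract poly3 poly" where
  "frac3_poly p s = map_poly (\<lambda>c. frac3 c s) p"

text \<open>
  \<open>\<delta>\<^sub>K(b/s) = \<delta>(b)/s\<close>. For \<open>\<delta>\<close> in \<^term>\<open>EXP const3\<close> the description below determines a unique value: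
  see \<open>ex_frac3\<close>, \<open>exp_ext_frac3\<close> and \<open>exp_ext_in_EXP\<close>.
\<close>

definition exp_ext :: "('a::idom poly3 \<Rightarrow> 'a poly3 poly) \<Rightarrow> 'a fract poly3 \<Rightarrow> 'a fract poly3 poly" where
  "exp_ext \<delta> f = (THE g. \<exists>b s. s \<noteq> 0 \<and> f = frac3 b s \<and> g = frac3_poly (\<delta> b) s)"

lemma map_poly_hom_add:
  fixes f :: "'a::comm_ring_1 \<Rightarrow> 'b::comm_ring_1"
  assumes "f 0 = 0" "\<And>x y. f (x + y) = f x + f y"
  shows "map_poly f (p + q) = map_poly f p + map_poly f q"
  by (rule poly_eqI) (simp add: coeff_map_poly assms)

lemma map_poly_hom_mult:
  fixes f :: "'a::comm_ring_1 \<Rightarrow> 'b::comm_ring_1"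
  assumes "f 0 = 0" "\<And>x y. f (x + y) = f x + f y" "\<And>x y. f (x * y) = f x * f y"
  shows "map_poly f (p * q) = map_poly f p * map_poly f q"
proof -
  have s: "f (sum g S) = (\<Sum>x\<in>S. f (g x))" for g :: "nat \<Rightarrow> 'a" and S
    by (induction S rule: infinite_finite_induct) (simp_all add: assms)
  show ?thesis
    by (rule poly_eqI) (simp add: coeff_map_poly coeff_mult assms s)
qed

lemma map_poly_hom_inj:
  assumes "f 0 = 0" "inj f"
  shows "inj (map_poly f)"
proof (rule injI)
  fix p q assume "map_poly f p = map_poly f q"
  then have "f (coeff p n) = f (coeff q n)" for n
    by (metis assms(1) coeff_map_poly)
  then show "p = q" using assms(2) by (intro poly_eqI) (auto dest: injD)
qed

lemma map_poly_hom_eval: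
  fixes f :: "'a::comm_ring_1 \<Rightarrow> 'b::comm_ring_1"
  assumes "f 0 = 0" "\<And>x y. f (x + y) = f x + f y" "\<And>x y. f (x * y) = f x * f y"
  shows "f (poly p x) = poly (map_poly f p) (f x)"
  by (induction p) (simp_all add: assms map_poly_pCons)

lemma to_fract3_0 [simp]: "to_fract3 0 = 0"
  by (simp add: to_fract3_def)

lemma to_fract3_add: "to_fract3 (x + y) = to_fract3 x + to_fract3 y"
  unfolding to_fract3_def by (simp add: map_poly_hom_add)

lemma to_fract3_mult: "to_fract3 (x * y) = to_fract3 x * to_fract3 y"
  unfolding to_fract3_def by (simp add: map_poly_hom_add map_poly_hom_mult)

lemma inj_to_fract3: "inj to_fract3"
  unfolding to_fract3_def by (intro map_poly_hom_inj) (auto intro: injI)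

lemma to_fract3_const3 [simp]: "to_fract3 (const3 a) = const3 (to_fract a)"
  by (simp add: to_fract3_def const3_def map_poly_pCons)

lemma const3_mult: "const3 (a * b) = const3 a * const3 b"
  by (simp add: const3_def)

lemma const3_1 [simp]: "const3 1 = 1"
  by (simp add: const3_def one_pCons)

lemma const3_0 [simp]: "const3 0 = 0"
  by (simp add: const3_def)

lemma const3_eq_0_iff [simp]: "const3 a = 0 \<longleftrightarrow> a = 0"
  by (simp add: const3_def)

lemma const3_Fract_cancel: "s \<noteq> 0 \<Longrightarrow> const3 (to_fract s) * const3 (Fract 1 s) = 1"
  by (simp add: const3_mult[symmetric] to_fract_def fract_collapse flip: const3_1)
     (simp add: One_fract_def eq_fract const3_def)

lemma frac3_0 [simp]: "frac3 0 s = 0"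
  by (simp add: frac3_def)

lemma frac3_cancel: "s \<noteq> 0 \<Longrightarrow> const3 (to_fract s) * frac3 b s = to_fract3 b"
  unfolding frac3_def by (metis const3_Fract_cancel mult.assoc mult_1)

lemma frac3_eqI:
  assumes "s \<noteq> 0" "const3 (to_fract s) * f = to_fract3 b"
  shows "f = frac3 b s"
proof -
  have "const3 (to_fract s) * f = const3 (to_fract s) * frac3 b s"
    using assms frac3_cancel by metis
  then show ?thesis using assms(1) by simp
qed

lemma frac3_eq_iff:
  assumes "s \<noteq> 0" "u \<noteq> 0"
  shows "frac3 b s = frac3 c u \<longleftrightarrow> const3 u * b = const3 s * c"
proof -
  let ?s = "const3 (to_fract s)" and ?u = "const3 (to_fract u)"
  have "?s * ?u \<noteq> 0" using assms by simp
  then have "frac3 b s = frac3 c u \<longleftrightarrow> ?s * ?u * frac3 b s = ?s * ?u * frac3 c u"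
    by (metis mult_left_cancel)
  also have "?s * ?u * frac3 b s = to_fract3 (const3 u * b)"
    using frac3_cancel[OF assms(1)] by (metis to_fract3_const3 to_fract3_mult mult.assoc mult.commute)
  also have "?s * ?u * frac3 c u = to_fract3 (const3 s * c)"
    using frac3_cancel[OF assms(2)] by (metis to_fract3_const3 to_fract3_mult mult.assoc)
  finally show ?thesis using inj_to_fract3 by (metis injD)
qed

lemma common_denominator_step:
  fixes f :: "'b::idom \<Rightarrow> 'c::idom" and c :: "'a::idom \<Rightarrow> 'b"
  assumes f: "f 0 = 0" "\<And>x y. f (x * y) = f x * f y"
    and c: "\<And>x y. c (x * y) = c x * c y"
    and den: "\<And>y. \<exists>x s. s \<noteq> 0 \<and> f (c s) * y = f x"
  shows "\<exists>q s. s \<noteq> 0 \<and> map_poly f [:c s:] * p = map_poly f q"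
proof (induction p)
  case 0
  show ?case by (rule exI[of _ 0], rule exI[of _ 1]) simp
next
  case (pCons a p)
  obtain q s where 1: "s \<noteq> 0" "map_poly f [:c s:] * p = map_poly f q" using pCons by blast
  obtain x u where 2: "u \<noteq> 0" "f (c u) * a = f x" using den by blast
  have sm: "map_poly f (smult k r) = smult (f k) (map_poly f r)" for k r
    by (rule poly_eqI) (simp add: coeff_map_poly f)
  have "map_poly f [:c (s * u):] * pCons a p = map_poly f (pCons (c s * x) (smult (c u) q))"
    using arg_cong[OF 1(2), of "smult (f (c u))"] 2(2)[symmetric]
    by (simp add: map_poly_pCons f c sm ac_simps)
  moreover have "s * u \<noteq> 0" using 1 2 by simp
  ultimately show ?case by blast
qed

lemma ex_frac3: "\<exists>b s. s \<noteq> 0 \<and> f = frac3 b s"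
proof -
  have 0: "\<exists>x s. s \<noteq> 0 \<and> to_fract s * y = to_fract x" for y :: "'a fract"
    by (cases y) (auto simp: to_fract_def eq_fract intro: mult.commute)
  have 1: "\<exists>q s. s \<noteq> 0 \<and> map_poly to_fract [:s:] * p = map_poly to_fract q" for p :: "'a fract poly"
    by (rule common_denominator_step[of to_fract "\<lambda>x. x"]) (auto simp: 0)
  have 2: "\<exists>q s. s \<noteq> 0 \<and> map_poly (map_poly to_fract) [:[:s:]:] * p = map_poly (map_poly to_fract) q"
    for p :: "'a fract poly poly"
    by (rule common_denominator_step[of "map_poly to_fract" "\<lambda>x. [:x:]"])
       (auto intro!: 1 map_poly_hom_mult)
  have "\<exists>q s. s \<noteq> 0 \<and> to_fract3 (const3 s) * f = to_fract3 q"
    unfolding to_fract3_def const3_def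
    by (rule common_denominator_step[of "map_poly (map_poly to_fract)" "\<lambda>x. [:[:x:]:]"])
       (auto intro!: 2 map_poly_hom_mult map_poly_hom_add)
  then show ?thesis using frac3_eqI by (metis to_fract3_const3)
qed

lemma exp_ext_frac3:
  assumes \<delta>: "\<delta> \<in> EXP const3" and s: "s \<noteq> 0"
  shows "exp_ext \<delta> (frac3 b s) = frac3_poly (\<delta> b) s"
  unfolding exp_ext_def
proof (rule the_equality)
  show "\<exists>b' s'. s' \<noteq> 0 \<and> frac3 b s = frac3 b' s' \<and> frac3_poly (\<delta> b) s = frac3_poly (\<delta> b') s'"
    using s by blast
next
  fix g assume "\<exists>c u. u \<noteq> 0 \<and> frac3 b s = frac3 c u \<and> g = frac3_poly (\<delta> c) u"
  then obtain c u where u: "u \<noteq> 0" "frac3 b s = frac3 c u" "g = frac3_poly (\<delta> c) u" by blast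
  have sm: "\<delta> (const3 a * x) = smult (const3 a) (\<delta> x)" for a x
    using \<delta> by (simp add: EXP_def)
  have "const3 u * b = const3 s * c" using u s frac3_eq_iff by blast
  then have "smult (const3 u) (\<delta> b) = smult (const3 s) (\<delta> c)" using sm by metis
  then have "const3 u * coeff (\<delta> b) n = const3 s * coeff (\<delta> c) n" for n
    by (metis coeff_smult)
  then have "frac3 (coeff (\<delta> b) n) s = frac3 (coeff (\<delta> c) n) u" for n
    using u s frac3_eq_iff by blast
  then show "g = frac3_poly (\<delta> b) s"
    unfolding u(3) frac3_poly_def by (intro poly_eqI) (simp add: coeff_map_poly)
qed

lemma exp_ext_in_EXP:
  assumes \<delta>: "\<delta> \<in> EXP const3"
  shows "exp_ext \<delta> \<in> EXP const3"
proof -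
  note D = \<delta>[unfolded EXP_def, simplified]
  note E = exp_ext_frac3[OF \<delta>]
  have sm: "\<delta> (const3 a * x) = smult (const3 a) (\<delta> x)" for a x
    using D by simp
  have fp: "frac3_poly p s = smult (const3 (Fract 1 s)) (map_poly to_fract3 p)" for p s
    unfolding frac3_poly_def by (rule poly_eqI) (simp add: coeff_map_poly frac3_def)
  note mp = map_poly_hom_add[of to_fract3] map_poly_hom_mult[of to_fract3]
  have F: "const3 (Fract 1 (s * u)) = const3 (Fract 1 s) * const3 (Fract 1 u)" for s u :: 'a
    by (simp add: const3_mult[symmetric])
  have f_add: "frac3 b s + frac3 c u = frac3 (const3 u * b + const3 s * c) (s * u)"
    if "s \<noteq> 0" "u \<noteq> 0" for b c and s u :: 'a
  proof (rule frac3_eqI)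
    show "s * u \<noteq> 0" using that by simp
    have "const3 (to_fract (s * u)) * (frac3 b s + frac3 c u) =
        const3 (to_fract u) * (const3 (to_fract s) * frac3 b s) +
        const3 (to_fract s) * (const3 (to_fract u) * frac3 c u)"
      by (simp add: const3_mult algebra_simps)
    then show "const3 (to_fract (s * u)) * (frac3 b s + frac3 c u) =
        to_fract3 (const3 u * b + const3 s * c)"
      using that by (simp add: frac3_cancel to_fract3_add to_fract3_mult)
  qed
  have f_mult: "frac3 b s * frac3 c u = frac3 (b * c) (s * u)" for b c and s u :: 'a
    by (simp add: frac3_def F to_fract3_mult ac_simps)
  have add: "exp_ext \<delta> (x + y) = exp_ext \<delta> x + exp_ext \<delta> y" for x y
  proof -
    obtain b s where 1: "s \<noteq> 0" "x = frac3 b s" using ex_frac3 by blast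
    obtain c u where 2: "u \<noteq> 0" "y = frac3 c u" using ex_frac3 by blast
    show ?thesis
      using 1 2 D
      by (simp add: f_add E sm)
         (intro poly_eqI, simp add: frac3_poly_def coeff_map_poly f_add)
  qed
  have mult: "exp_ext \<delta> (x * y) = exp_ext \<delta> x * exp_ext \<delta> y" for x y
  proof -
    obtain b s where 1: "s \<noteq> 0" "x = frac3 b s" using ex_frac3 by blast
    obtain c u where 2: "u \<noteq> 0" "y = frac3 c u" using ex_frac3 by blast
    show ?thesis
      using 1 2 D by (simp add: f_mult E fp F mp to_fract3_add to_fract3_mult ac_simps)
  qed
  have const: "exp_ext \<delta> (const3 a) = [:const3 a:]" for a
  proof -
    obtain b s where a: "a = Fract b s" "s \<noteq> 0" by (cases a)
    have "const3 a = frac3 (const3 b) s"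
      using a by (simp add: frac3_def to_fract_def flip: const3_mult)
    then show ?thesis using a D E[of s "const3 b"] by (simp add: frac3_poly_def map_poly_pCons)
  qed
  have eval0: "poly (exp_ext \<delta> x) 0 = x" for x
  proof -
    obtain b s where 1: "s \<noteq> 0" "x = frac3 b s" using ex_frac3 by blast
    have "coeff (\<delta> b) 0 = b" using D by (simp add: poly_0_coeff_0)
    then show ?thesis using 1 by (simp add: E poly_0_coeff_0 frac3_poly_def coeff_map_poly)
  qed
  have comp: "map_poly (exp_ext \<delta>) (exp_ext \<delta> x) =
      poly (map_poly (\<lambda>c. [:[:c:]:]) (exp_ext \<delta> x)) (var_s + var_t)" for x
  proof -
    obtain b s where 1: "s \<noteq> 0" "x = frac3 b s" using ex_frac3 by blast
    let ?k = "const3 (Fract 1 s)"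
    let ?M = "map_poly (map_poly to_fract3) :: 'a poly3 poly poly \<Rightarrow> _"
    have d0: "\<delta> 0 = 0" using sm[of 0 0] by simp
    have e0: "exp_ext \<delta> 0 = 0" using const[of 0] by simp
    have one3: "to_fract3 1 = (1 :: 'a fract poly3)"
      using to_fract3_const3[of "1 :: 'a"] by (simp only: const3_1 to_fract_1)
    have M: "?M 0 = 0" "?M (p + q) = ?M p + ?M q" "?M (p * q) = ?M p * ?M q" for p q
      by (auto intro!: map_poly_hom_add map_poly_hom_mult simp: to_fract3_add to_fract3_mult)
    have "map_poly (exp_ext \<delta>) (exp_ext \<delta> x) = smult [:?k:] (?M (map_poly \<delta> (\<delta> b)))"
    proof (rule poly_eqI)
      fix n
      have "coeff (map_poly (exp_ext \<delta>) (exp_ext \<delta> x)) n = exp_ext \<delta> (frac3 (coeff (\<delta> b) n) s)"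
        using 1 by (simp add: E frac3_poly_def coeff_map_poly e0)
      also have "\<dots> = smult ?k (map_poly to_fract3 (\<delta> (coeff (\<delta> b) n)))"
        using 1 by (simp add: E fp)
      finally show "coeff (map_poly (exp_ext \<delta>) (exp_ext \<delta> x)) n =
          coeff (smult [:?k:] (?M (map_poly \<delta> (\<delta> b)))) n"
        by (simp add: coeff_map_poly d0)
    qed
    also have "map_poly \<delta> (\<delta> b) = poly (map_poly (\<lambda>c. [:[:c:]:]) (\<delta> b)) (var_s + var_t)"
      using D by blast
    also have "?M \<dots> = poly (map_poly ?M (map_poly (\<lambda>c. [:[:c:]:]) (\<delta> b))) (?M (var_s + var_t))"
      using M by (rule map_poly_hom_eval)
    also have "?M (var_s + var_t) = var_s + var_t"
      using one3 by (simp add: M map_poly_1' var_s_def var_t_def map_poly_pCons)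
    also have "map_poly ?M (map_poly (\<lambda>c. [:[:c:]:]) (\<delta> b)) =
        map_poly (\<lambda>c. [:[:c:]:]) (map_poly to_fract3 (\<delta> b))"
      by (rule poly_eqI) (simp add: coeff_map_poly map_poly_pCons)
    also have "smult [:?k:] (poly (map_poly (\<lambda>c. [:[:c:]:]) (map_poly to_fract3 (\<delta> b))) (var_s + var_t)) =
        poly (smult [:[:?k:]:] (map_poly (\<lambda>c. [:[:c:]:]) (map_poly to_fract3 (\<delta> b)))) (var_s + var_t)"
      by simp
    also have "smult [:[:?k:]:] (map_poly (\<lambda>c. [:[:c:]:]) (map_poly to_fract3 (\<delta> b))) =
        map_poly (\<lambda>c. [:[:c:]:]) (exp_ext \<delta> x)"
      by (rule poly_eqI) (simp add: 1 E fp coeff_map_poly)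
    finally show ?thesis .
  qed
  show ?thesis
    unfolding EXP_def using add mult const eval0 comp by simp
qed

end

theory Submission
  imports "HOL-Algebra.Algebraic_Closure_Type" Defs
begin

text \<open>
  Ranks 0 and 3 are trivial, and in rank 1 the ring \<open>A[X\<^sub>1,X\<^sub>2]\<close> is the ring of invariants. In rank 2 assume that
  \<open>x\<close> and \<open>x'\<close> are invariant first coordinates over \<open>K\<close> with \<open>K[x] \<noteq> K[x']\<close>. The invariants have the form
  \<open>K[x][P]\<close> by factoriality and a transcendence degree count. Over the algebraic closure of \<open>K(x)\<close> every \<open>P - \<theta>\<close> is
  prime, which gives a slice \<open>s\<close> such that each \<open>b\<close> satisfies \<open>c b \<in> K[x][P][s]\<close> for some nonzero \<open>c \<in> K[x]\<close>;
  likewise there is a slice \<open>s'\<close> with denominators in \<open>K[x']\<close>. As \<open>K[x]\<close> and \<open>K[x']\<close> meet only in \<open>K\<close>, comparing the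
  two slices modulo a prime of \<open>K[x]\<close> removes all denominators. So \<open>K[x,P,s]\<close> is the whole ring and the rank over
  \<open>K\<close> is at most 1, a contradiction. Hence \<open>K[x] = K[x']\<close>, and this descends to \<open>A\<close> because coordinates are
  algebraically independent.
\<close>

section \<open>Ring homomorphisms and adjunction\<close>

text \<open>The characteristic is arbitrary, so a slice of degree one need not exist even locally: a
  slice here is a non-invariant \<open>s\<close> such that every element, after multiplication by a
  denominator, is a polynomial in \<open>s\<close> with invariant coefficients. The algebraic
  closure of \<open>K(x)\<close> is needed because a denominator in \<open>P\<close> must split into
  linear factors \<open>P - \<theta>\<close>. The way back is a linear functional instead of a norm,
  so inseparable elements cause no trouble. A slice obtained from \<open>x\<close> alone may have
  genuine denominators in \<open>K[x]\<close>; these are what a second, independent invariant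
  coordinate removes. The type \<open>'k poly3\<close> is read in two ways: as three variables over
  \<open>K\<close> and, the innermost variable being \<open>x\<close>, as two variables
  \<open>Y\<close>, \<open>Z\<close> over \<open>K[x]\<close>. Any other invariant first coordinate
  is moved to the position of \<open>x\<close> by conjugation. Coordinate systems are only required
  to generate, so their algebraic independence has to be proved; this is done over \<open>K\<close>,
  through linear parts at the origin.\<close>

definition rhom :: "('a::comm_ring_1 \<Rightarrow> 'b::comm_ring_1) \<Rightarrow> bool" where
  "rhom f \<longleftrightarrow> f 1 = 1 \<and> (\<forall>x y. f (x + y) = f x + f y) \<and> (\<forall>x y. f (x * y) = f x * f y)"

lemma rhomI:
  assumes "f 1 = 1" "\<And>x y. f (x + y) = f x + f y" "\<And>x y. f (x * y) = f x * f y"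
  shows "rhom f"
  using assms by (simp add: rhom_def)

lemma rhom_1: "rhom f \<Longrightarrow> f 1 = 1"
  and rhom_add: "rhom f \<Longrightarrow> f (x + y) = f x + f y"
  and rhom_mult: "rhom f \<Longrightarrow> f (x * y) = f x * f y"
  by (simp_all add: rhom_def)

lemma rhom_0: "rhom f \<Longrightarrow> f 0 = 0"
  using rhom_add[of f 0 0] by simp

lemma rhom_minus: "rhom f \<Longrightarrow> f (- x) = - f x"
  using rhom_add[of f "- x" x] rhom_0[of f] by (simp add: eq_neg_iff_add_eq_0)

lemma rhom_diff: "rhom f \<Longrightarrow> f (x - y) = f x - f y"
  using rhom_add[of f x "- y"] rhom_minus[of f] by simp

lemma rhom_power: "rhom f \<Longrightarrow> f (x ^ n) = f x ^ n"
  by (induction n) (simp_all add: rhom_1 rhom_mult)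

lemma rhom_sum: "rhom f \<Longrightarrow> f (sum g S) = (\<Sum>x\<in>S. f (g x))"
  by (induction S rule: infinite_finite_induct) (simp_all add: rhom_0 rhom_add)

lemmas rhom_simps = rhom_0 rhom_1 rhom_add rhom_mult rhom_minus rhom_diff rhom_power rhom_sum

lemma rhom_comp: "rhom f \<Longrightarrow> rhom g \<Longrightarrow> rhom (\<lambda>x. f (g x))"
  by (simp add: rhom_def)

lemma rhom_id [simp]: "rhom (\<lambda>x. x)"
  by (simp add: rhom_def)

lemma rhom_const_poly [simp]: "rhom (\<lambda>c. [:c:])"
  by (simp add: rhom_def one_pCons)

lemma rhom_poly [simp]: "rhom (\<lambda>p. poly p x)"
  by (simp add: rhom_def)

lemma rhom_to_fract [simp]: "rhom to_fract"
  by (simp add: rhom_def)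

lemma rhom_to_ac [simp]: "rhom to_ac"
  by (simp add: rhom_def)

lemma rhom_inv:
  assumes "rhom f" "bij f"
  shows "rhom (inv_into UNIV f)"
proof -
  have i: "inv_into UNIV f (f x) = x" for x using assms by (simp add: bij_is_inj)
  have s: "f (inv_into UNIV f x) = x" for x using assms by (simp add: bij_is_surj surj_f_inv_f)
  show ?thesis
  proof (rule rhomI)
    show "inv_into UNIV f 1 = 1" using i[of 1] assms(1) by (simp add: rhom_1)
    show "inv_into UNIV f (x + y) = inv_into UNIV f x + inv_into UNIV f y" for x y
      using i[of "inv_into UNIV f x + inv_into UNIV f y"] by (simp only: rhom_add[OF assms(1)] s)
    show "inv_into UNIV f (x * y) = inv_into UNIV f x * inv_into UNIV f y" for x y
      using i[of "inv_into UNIV f x * inv_into UNIV f y"] by (simp only: rhom_mult[OF assms(1)] s)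
  qed
qed

lemma rhom_map_poly: "rhom f \<Longrightarrow> rhom (map_poly f)"
  by (rule rhomI) (simp_all add: rhom_simps map_poly_1' map_poly_hom_add map_poly_hom_mult)

lemma rhom_dvd: "rhom f \<Longrightarrow> x dvd y \<Longrightarrow> f x dvd f y"
  by (auto simp: rhom_mult elim!: dvdE)

text \<open>The structure map of \<open>R[Y,Z]\<close> over \<open>R\<close>. With
  \<open>R = K[x]\<close> the type coincides with \<open>'k poly3\<close>, which makes the two
  readings of that ring possible without any conversion.\<close>

definition const2 :: "'a::comm_ring_1 \<Rightarrow> 'a poly poly" where
  "const2 a = [:[:a:]:]"

lemma rhom_const2 [simp]: "rhom const2"
  by (simp add: rhom_def const2_def one_pCons)

lemma rhom_const3 [simp]: "rhom const3"
  by (simp add: rhom_def const3_def one_pCons)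

lemma const2_eq_iff [simp]: "const2 a = const2 b \<longleftrightarrow> a = b"
  by (simp add: const2_def)

lemma const2_eq_0_iff [simp]: "const2 a = 0 \<longleftrightarrow> a = 0"
  by (simp add: const2_def)

text \<open>Evaluation with the coefficients moved by \<open>j\<close>. Iterated, the leftmost point
  belongs to the innermost variable: \<open>ev3 j u v w\<close> substitutes \<open>u\<close>,
  \<open>v\<close>, \<open>w\<close> for \<open>X\<close>, \<open>Y\<close>,
  \<open>Z\<close>.\<close>

definition ev1 :: "('a::comm_ring_1 \<Rightarrow> 'b::comm_ring_1) \<Rightarrow> 'b \<Rightarrow> 'a poly \<Rightarrow> 'b" where
  "ev1 j u p = poly (map_poly j p) u"

abbreviation "ev2 j u v \<equiv> ev1 (ev1 j u) v"
abbreviation "ev3 j u v w \<equiv> ev1 (ev2 j u v) w"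

lemma rhom_ev1: "rhom j \<Longrightarrow> rhom (ev1 j u)"
  unfolding ev1_def by (rule rhom_comp[OF rhom_poly rhom_map_poly])

lemma ev1_pCons: "rhom j \<Longrightarrow> ev1 j u (pCons a p) = j a + u * ev1 j u p"
  by (simp add: ev1_def map_poly_pCons rhom_0)

lemma ev1_const [simp]: "rhom j \<Longrightarrow> ev1 j u [:a:] = j a"
  by (simp add: ev1_def map_poly_pCons rhom_0)

lemma ev1_X [simp]: "rhom j \<Longrightarrow> ev1 j u [:0, 1:] = u"
  by (simp add: ev1_def map_poly_pCons rhom_simps)

lemma rhom_ext_poly:
  assumes "rhom f" "rhom g" "\<And>a. f [:a:] = g [:a:]" "f [:0, 1:] = g [:0, 1:]"
  shows "f = g"
proof
  fix p show "f p = g p"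
  proof (induction p)
    case 0
    show ?case using assms by (simp add: rhom_0)
  next
    case (pCons a p)
    have e: "pCons a p = [:a:] + [:0, 1:] * p" by simp
    show ?case
      unfolding e rhom_add[OF assms(1)] rhom_add[OF assms(2)] rhom_mult[OF assms(1)] rhom_mult[OF assms(2)]
      using assms pCons.IH by simp
  qed
qed

lemma rhom_ext_poly2:
  assumes "rhom f" "rhom g" "\<And>a. f (const2 a) = g (const2 a)"
    "f [:[:0, 1:]:] = g [:[:0, 1:]:]" "f [:0, 1:] = g [:0, 1:]"
  shows "f = g"
proof (rule rhom_ext_poly[OF assms(1,2) _ assms(5)])
  fix p
  have "(\<lambda>p. f [:p:]) = (\<lambda>p. g [:p:])"
    by (rule rhom_ext_poly[OF rhom_comp[OF assms(1) rhom_const_poly] rhom_comp[OF assms(2) rhom_const_poly]])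
       (use assms(3,4) in \<open>simp_all add: const2_def\<close>)
  then show "f [:p:] = g [:p:]" by (rule fun_cong)
qed

lemma rhom_ext_poly3:
  assumes "rhom f" "rhom g" "\<And>a. f (const3 a) = g (const3 a)"
    "f [:[:[:0, 1:]:]:] = g [:[:[:0, 1:]:]:]" "f [:[:0, 1:]:] = g [:[:0, 1:]:]"
    "f [:0, 1:] = g [:0, 1:]"
  shows "f = g"
proof (rule rhom_ext_poly[OF assms(1,2) _ assms(6)])
  fix p
  have "(\<lambda>p. f [:p:]) = (\<lambda>p. g [:p:])"
    by (rule rhom_ext_poly2[OF rhom_comp[OF assms(1) rhom_const_poly] rhom_comp[OF assms(2) rhom_const_poly]])
       (use assms(3-5) in \<open>simp_all add: const2_def const3_def\<close>)
  then show "f [:p:] = g [:p:]" by (rule fun_cong)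
qed

lemma rhom_ev1_comp:
  assumes "rhom f" "rhom j"
  shows "f (ev1 j u p) = ev1 (\<lambda>a. f (j a)) (f u) p"
  using assms(1) rhom_comp[OF assms]
  by (induction p) (simp_all add: rhom_simps ev1_pCons assms(2) rhom_0[OF rhom_ev1])

lemma rhom_ev2_comp:
  assumes "rhom f" "rhom j"
  shows "f (ev2 j u v p) = ev2 (\<lambda>a. f (j a)) (f u) (f v) p"
  unfolding rhom_ev1_comp[OF assms(1) rhom_ev1[OF assms(2)]] rhom_ev1_comp[OF assms] ..

lemma rhom_ev3_comp:
  assumes "rhom f" "rhom j"
  shows "f (ev3 j u v w p) = ev3 (\<lambda>a. f (j a)) (f u) (f v) (f w) p"
  unfolding rhom_ev1_comp[OF assms(1) rhom_ev1[OF rhom_ev1[OF assms(2)]]] rhom_ev2_comp[OF assms] ..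

lemma ev1_mem_adjoin:
  assumes "rhom j" "\<And>a. j a \<in> adjoin \<iota> S" "u \<in> adjoin \<iota> S" "rhom \<iota>"
  shows "ev1 j u p \<in> adjoin \<iota> S"
proof (induction p)
  case 0
  show ?case using assms adjoin.const[of \<iota> 0 S] by (simp add: ev1_def rhom_0)
next
  case (pCons a p)
  then show ?case using assms by (auto simp: ev1_pCons intro!: adjoin.add adjoin.mult)
qed

lemma adjoin_subset:
  assumes "rhom f" "\<And>a. \<iota> a \<in> range f" "S \<subseteq> range f"
  shows "adjoin \<iota> S \<subseteq> range f"
proof
  fix x assume "x \<in> adjoin \<iota> S"
  then show "x \<in> range f"
  proof induction
    case (add x y)
    then obtain a b where "x = f a" "y = f b" by blast
    then have "x + y = f (a + b)" using assms by (simp add: rhom_add)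
    then show ?case by blast
  next
    case (mult x y)
    then obtain a b where "x = f a" "y = f b" by blast
    then have "x * y = f (a * b)" using assms by (simp add: rhom_mult)
    then show ?case by blast
  qed (use assms in auto)
qed

lemma adjoin_mono:
  assumes "S \<subseteq> adjoin \<iota> T"
  shows "adjoin \<iota> S \<subseteq> adjoin \<iota> T"
proof
  fix x assume "x \<in> adjoin \<iota> S"
  then show "x \<in> adjoin \<iota> T"
    by induction (use assms in \<open>auto intro: adjoin.intros\<close>)
qed

lemma adjoin1:
  assumes "rhom \<iota>"
  shows "adjoin \<iota> {u} = range (ev1 \<iota> u)"
proof
  have "\<iota> a \<in> range (ev1 \<iota> u)" "u \<in> range (ev1 \<iota> u)" for a
    using rangeI[of "ev1 \<iota> u" "[:a:]"] rangeI[of "ev1 \<iota> u" "[:0, 1:]"] assms by simp_all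
  then show "adjoin \<iota> {u} \<subseteq> range (ev1 \<iota> u)"
    using assms by (intro adjoin_subset rhom_ev1) simp_all
  show "range (ev1 \<iota> u) \<subseteq> adjoin \<iota> {u}"
    using assms by (intro image_subsetI ev1_mem_adjoin) (auto intro: adjoin.const adjoin.gen)
qed

lemma adjoin2:
  assumes "rhom \<iota>"
  shows "adjoin \<iota> {u, v} = range (ev2 \<iota> u v)"
proof
  let ?e = "ev2 \<iota> u v"
  have "\<iota> a \<in> range ?e" "u \<in> range ?e" "v \<in> range ?e" for a
    using rangeI[of ?e "[:[:a:]:]"] rangeI[of ?e "[:[:0, 1:]:]"] rangeI[of ?e "[:0, 1:]"] assms
    by (simp_all add: rhom_ev1)
  then show "adjoin \<iota> {u, v} \<subseteq> range (ev2 \<iota> u v)"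
    using assms by (intro adjoin_subset rhom_ev1) simp_all
  show "range (ev2 \<iota> u v) \<subseteq> adjoin \<iota> {u, v}"
    using assms by (intro image_subsetI ev1_mem_adjoin rhom_ev1) (auto intro: adjoin.const adjoin.gen)
qed

lemma adjoin3:
  assumes "rhom \<iota>"
  shows "adjoin \<iota> {u, v, w} = range (ev3 \<iota> u v w)"
proof
  let ?e = "ev3 \<iota> u v w"
  have "\<iota> a \<in> range ?e" "u \<in> range ?e" "v \<in> range ?e" "w \<in> range ?e" for a
    using rangeI[of ?e "[:[:[:a:]:]:]"] rangeI[of ?e "[:[:[:0, 1:]:]:]"]
      rangeI[of ?e "[:[:0, 1:]:]"] rangeI[of ?e "[:0, 1:]"] assms
    by (simp_all add: rhom_ev1)
  then show "adjoin \<iota> {u, v, w} \<subseteq> range (ev3 \<iota> u v w)"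
    using assms by (intro adjoin_subset rhom_ev1) simp_all
  show "range (ev3 \<iota> u v w) \<subseteq> adjoin \<iota> {u, v, w}"
    using assms by (intro image_subsetI ev1_mem_adjoin rhom_ev1) (auto intro: adjoin.const adjoin.gen)
qed

text \<open>Linearity over \<open>R\<close> for two algebras given by their structure maps. The
  instances that matter are functionals from the algebraic closure to the fraction field of
  \<open>R\<close>, which are not multiplicative.\<close>

definition semilin ::
  "('r::comm_ring_1 \<Rightarrow> 'a::comm_ring_1) \<Rightarrow> ('r \<Rightarrow> 'b::comm_ring_1) \<Rightarrow> ('a \<Rightarrow> 'b) \<Rightarrow> bool" where
  "semilin j1 j2 \<tau> \<longleftrightarrow> (\<forall>x y. \<tau> (x + y) = \<tau> x + \<tau> y) \<and> (\<forall>r x. \<tau> (j1 r * x) = j2 r * \<tau> x)"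

lemma semilin_add: "semilin j1 j2 \<tau> \<Longrightarrow> \<tau> (x + y) = \<tau> x + \<tau> y"
  and semilin_mult: "semilin j1 j2 \<tau> \<Longrightarrow> \<tau> (j1 r * x) = j2 r * \<tau> x"
  by (simp_all add: semilin_def)

lemma semilin_0: "semilin j1 j2 \<tau> \<Longrightarrow> \<tau> 0 = 0"
  by (metis add_cancel_right_right semilin_add)

lemma semilin_diff: "semilin j1 j2 \<tau> \<Longrightarrow> \<tau> (x - y) = \<tau> x - \<tau> y"
  by (metis add_diff_cancel_right' diff_add_cancel semilin_add)

lemma semilin_sum:
  assumes "semilin j1 j2 \<tau>"
  shows "\<tau> (sum g S) = (\<Sum>x\<in>S. \<tau> (g x))"
  by (induction S rule: infinite_finite_induct)
     (simp_all add: semilin_0[OF assms] semilin_add[OF assms])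

text \<open>Each coefficient of the product is a sum of terms \<open>j1 r * x\<close>, so additivity
  and linearity suffice. Iterating the lemma adds one variable at a time.\<close>

lemma semilin_map_poly:
  assumes "semilin j1 j2 \<tau>" "rhom j1" "rhom j2"
  shows "semilin (map_poly j1) (map_poly j2) (map_poly \<tau>)"
proof -
  note c = coeff_map_poly[of \<tau>, OF semilin_0[OF assms(1)]] coeff_map_poly[of j1, OF rhom_0[OF assms(2)]]
    coeff_map_poly[of j2, OF rhom_0[OF assms(3)]]
  have "map_poly \<tau> (x + y) = map_poly \<tau> x + map_poly \<tau> y" for x y
    by (rule poly_eqI) (simp only: c coeff_add semilin_add[OF assms(1)])
  moreover have "map_poly \<tau> (map_poly j1 r * x) = map_poly j2 r * map_poly \<tau> x" for r x
    by (rule poly_eqI)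
       (simp only: c coeff_mult semilin_sum[OF assms(1)] semilin_mult[OF assms(1)])
  ultimately show ?thesis unfolding semilin_def by blast
qed

text \<open>
  Fields of fractions become trivial Euclidean rings, so that the class instances making polynomial rings
  factorial apply to \<open>K[x][y][z]\<close>.
\<close>

instantiation fract :: (idom)
  "{unique_euclidean_ring, normalization_euclidean_semiring, normalization_semidom_multiplicative}"
begin

definition [simp]: "normalize_fract = (normalize_field :: 'a fract \<Rightarrow> _)"
definition [simp]: "unit_factor_fract = (unit_factor_field :: 'a fract \<Rightarrow> _)"
definition [simp]: "modulo_fract = (mod_field :: 'a fract \<Rightarrow> _)"
definition [simp]: "euclidean_size_fract = (euclidean_size_field :: 'a fract \<Rightarrow> _)"
definition [simp]: "division_segment (x :: 'a fract) = 1"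

instance
  by standard (simp_all add: dvd_field_iff field_split_simps split: if_splits)

end

instantiation fract :: (idom) euclidean_ring_gcd
begin

definition gcd_fract :: "'a fract \<Rightarrow> 'a fract \<Rightarrow> 'a fract" where
  "gcd_fract = Euclidean_Algorithm.gcd"
definition lcm_fract :: "'a fract \<Rightarrow> 'a fract \<Rightarrow> 'a fract" where
  "lcm_fract = Euclidean_Algorithm.lcm"
definition Gcd_fract :: "'a fract set \<Rightarrow> 'a fract" where
 "Gcd_fract = Euclidean_Algorithm.Gcd"
definition Lcm_fract :: "'a fract set \<Rightarrow> 'a fract" where
 "Lcm_fract = Euclidean_Algorithm.Lcm"

instance
  by standard (simp_all add: gcd_fract_def lcm_fract_def Gcd_fract_def Lcm_fract_def)

end

instance fract :: (idom) field_gcd ..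
instance alg_closure :: (field) field_gcd ..

section \<open>Exponential maps\<close>

lemma coeff_linear_power':
  "coeff ([:a, 1:] ^ n) i = of_nat (n choose i) * (a::'a::comm_ring_1) ^ (n - i)"
proof (cases "i \<le> n")
  case False
  then show ?thesis by (simp add: coeff_eq_0 degree_linear_power binomial_eq_0)
qed (simp add: coeff_linear_poly_power)

text \<open>The assumption says that \<open>(1 + T)^d = 1 + T^d\<close>. Hence
  \<open>(1 + T)^(q d + r) = (1 + T^d)^q (1 + T)^r\<close>, and since \<open>r < d\<close> the
  coefficient of \<open>T^r\<close> is that of the last factor, namely 1.\<close>

lemma of_nat_choose_eq_1:
  assumes "\<And>i. 0 < i \<Longrightarrow> i < d \<Longrightarrow> of_nat (d choose i) = (0::'a::comm_ring_1)" "r < d"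
  shows "of_nat ((q * d + r) choose (q * d)) = (1::'a)"
proof -
  have d: "[:1, 1:] ^ d = 1 + monom (1::'a) d"
  proof (rule poly_eqI)
    fix i
    have "i = 0 \<or> i = d \<or> (0 < i \<and> i < d) \<or> i > d" by linarith
    then show "coeff ([:1, 1:] ^ d) i = coeff (1 + monom (1::'a) d) i"
      using assms by (auto simp: coeff_linear_power' binomial_eq_0)
  qed
  have "coeff ((1 + monom 1 d) ^ q * f) r = coeff f r" for f :: "'a poly"
  proof (induction q)
    case (Suc q)
    have "(1 + monom 1 d) ^ Suc q * f = (1 + monom 1 d) ^ q * f + monom 1 d * ((1 + monom 1 d) ^ q * f)"
      by (simp add: algebra_simps)
    then show ?case using Suc assms(2) by (simp add: coeff_monom_mult)
  qed simp
  from this[of "[:1, 1:] ^ r"] have "coeff ([:1, 1:] ^ (q * d + r)) r = (1::'a)"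
    by (simp add: power_add power_mult mult.commute[of q d] d coeff_linear_power')
  then have "of_nat ((q * d + r) choose r) = (1::'a)"
    by (simp add: coeff_linear_power')
  then show ?thesis
    using binomial_symmetric[of r "q * d + r"] by simp
qed

text \<open>The exponential axioms without a base ring. A base enters only through the invariance of
  its elements, so the same results serve over \<open>K\<close> and over
  \<open>K[x]\<close>.\<close>

locale expmap =
  fixes \<delta> :: "'b::idom \<Rightarrow> 'b poly"
  assumes hom: "rhom \<delta>"
    and eval0: "poly (\<delta> b) 0 = b"
    and comp: "map_poly \<delta> (\<delta> b) = poly (map_poly (\<lambda>c. [:[:c:]:]) (\<delta> b)) (var_s + var_t)"
begin

lemma coeff_0: "coeff (\<delta> b) 0 = b"
  using eval0 by (simp add: poly_0_coeff_0)

text \<open>The composition law read off at \<open>t^i s^j\<close>. Writing \<open>D_i b\<close> for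
  the coefficient of \<open>t^i\<close> in \<open>\<delta> b\<close>, the maps \<open>D_i\<close>
  form an iterative higher derivation, the substitute for \<open>D^i / i!\<close> in arbitrary
  characteristic.\<close>

lemma coeff_coeff:
  "coeff (\<delta> (coeff (\<delta> b) i)) j = of_nat ((i + j) choose i) * coeff (\<delta> b) (i + j)"
proof -
  let ?q = "\<delta> b"
  have x_power: "[:0, 1:] ^ m = (monom 1 m :: 'b poly)" for m
    by (metis monom_altdef smult_1_left)
  have v: "var_s + var_t = [:[:0, 1:], 1:: 'b poly:]"
    by (simp add: var_s_def var_t_def)
  have "coeff (\<delta> (coeff ?q i)) j = coeff (coeff (map_poly \<delta> ?q) i) j"
    by (simp add: coeff_map_poly rhom_0[OF hom])
  also have "\<dots> = coeff (coeff (poly (map_poly (\<lambda>c. [:[:c:]:]) ?q) [:[:0, 1:], 1:]) i) j"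
    by (simp only: comp v)
  also have "poly (map_poly (\<lambda>c. [:[:c:]:]) ?q) [:[:0, 1:], 1:] =
      (\<Sum>n\<le>degree ?q. [:[:coeff ?q n:]:] * [:[:0, 1:], 1:] ^ n)"
    by (simp add: poly_altdef coeff_map_poly degree_map_poly)
  also have "coeff (coeff \<dots> i) j =
      (\<Sum>n\<le>degree ?q. coeff ?q n * (of_nat (n choose i) * (if n - i = j then 1 else 0)))"
    by (simp add: coeff_sum coeff_linear_power' of_nat_poly x_power mult_ac)
  also have "\<dots> = (\<Sum>n\<le>degree ?q. if n = i + j then of_nat ((i + j) choose i) * coeff ?q (i + j) else 0)"
  proof (rule sum.cong[OF refl])
    fix n
    show "coeff ?q n * (of_nat (n choose i) * (if n - i = j then 1 else 0)) =
      (if n = i + j then of_nat ((i + j) choose i) * coeff ?q (i + j) else 0)"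
      by (cases "i \<le> n") (auto simp: binomial_eq_0)
  qed
  also have "\<dots> = of_nat ((i + j) choose i) * coeff ?q (i + j)"
    by (auto simp: coeff_eq_0)
  finally show ?thesis .
qed

lemma inv_iff: "x \<in> invariants \<delta> \<longleftrightarrow> degree (\<delta> x) = 0"
proof
  assume "degree (\<delta> x) = 0"
  then have "\<delta> x = [:coeff (\<delta> x) 0:]" by (metis degree_eq_zeroE coeff_pCons_0)
  then show "x \<in> invariants \<delta>" by (simp add: invariants_def coeff_0)
qed (simp add: invariants_def)

lemma invD: "x \<in> invariants \<delta> \<Longrightarrow> \<delta> x = [:x:]"
  by (simp add: invariants_def)

lemma inv_add: "x \<in> invariants \<delta> \<Longrightarrow> y \<in> invariants \<delta> \<Longrightarrow> x + y \<in> invariants \<delta>"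
  and inv_diff: "x \<in> invariants \<delta> \<Longrightarrow> y \<in> invariants \<delta> \<Longrightarrow> x - y \<in> invariants \<delta>"
  and inv_mult: "x \<in> invariants \<delta> \<Longrightarrow> y \<in> invariants \<delta> \<Longrightarrow> x * y \<in> invariants \<delta>"
  and inv_0: "0 \<in> invariants \<delta>"
  and inv_1: "1 \<in> invariants \<delta>"
  by (simp_all add: invariants_def rhom_add[OF hom] rhom_diff[OF hom] rhom_mult[OF hom]
      rhom_0[OF hom] rhom_1[OF hom] one_pCons)

lemma inv_power: "x \<in> invariants \<delta> \<Longrightarrow> x ^ n \<in> invariants \<delta>"
  by (induction n) (simp_all add: inv_1 inv_mult)

lemma inv_sum: "(\<And>i. i \<in> S \<Longrightarrow> f i \<in> invariants \<delta>) \<Longrightarrow> sum f S \<in> invariants \<delta>"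
  by (induction S rule: infinite_finite_induct) (simp_all add: inv_0 inv_add)

lemma inv_poly_mult:
  assumes "\<And>i. coeff F i \<in> invariants \<delta>" "\<And>i. coeff G i \<in> invariants \<delta>"
  shows "coeff (F * G) i \<in> invariants \<delta>"
  unfolding coeff_mult using assms by (intro inv_sum inv_mult)

lemma delta_eq_0_iff [simp]: "\<delta> x = 0 \<longleftrightarrow> x = 0"
  using coeff_0[of x] rhom_0[OF hom] by auto

text \<open>Degrees in \<open>t\<close> add up over a domain: the invariants are factorially
  closed.\<close>

lemma inv_factor:
  assumes "x * y \<in> invariants \<delta>" "x * y \<noteq> 0"
  shows "x \<in> invariants \<delta>"
  using assms degree_mult_eq[of "\<delta> x" "\<delta> y"] by (simp add: inv_iff rhom_mult[OF hom])

lemma delta_poly: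
  assumes "\<And>i. coeff F i \<in> invariants \<delta>"
  shows "\<delta> (poly F s) = pcompose F (\<delta> s)"
proof -
  have "map_poly \<delta> F = map_poly (\<lambda>c. [:c:]) F"
    by (rule poly_eqI) (use assms in \<open>simp add: coeff_map_poly rhom_0[OF hom] invD\<close>)
  then show ?thesis
    using map_poly_hom_eval[of \<delta> F s] rhom_0[OF hom] rhom_add[OF hom] rhom_mult[OF hom]
    by (simp add: pcompose_altdef)
qed

text \<open>A non-invariant element is transcendental over the invariants: applying
  \<open>\<delta>\<close> replaces \<open>s\<close> by \<open>\<delta> s\<close>, which has positive
  degree in \<open>t\<close>, and composition with such a polynomial is injective.\<close>

lemma invariant_poly_root:
  assumes "s \<notin> invariants \<delta>" "\<And>i. coeff F i \<in> invariants \<delta>" "poly F s = 0"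
  shows "F = 0"
proof (rule pcompose_eq_0)
  show "pcompose F (\<delta> s) = 0"
    using delta_poly[of F s] assms by (simp add: rhom_0[OF hom])
  show "degree (\<delta> s) > 0" using assms(1) by (simp add: inv_iff)
qed

lemma lead_coeff_inv: "lead_coeff (\<delta> b) \<in> invariants \<delta>"
proof -
  have "coeff (\<delta> (lead_coeff (\<delta> b))) j = 0" if "j > 0" for j
    using that by (simp add: coeff_coeff coeff_eq_0)
  then have "degree (\<delta> (lead_coeff (\<delta> b))) \<le> 0"
    by (intro degree_le) auto
  then show ?thesis by (simp add: inv_iff)
qed

lemma degree_coeff_le: "degree (\<delta> (coeff (\<delta> b) i)) \<le> degree (\<delta> b) - i"
  by (rule degree_le) (auto simp: coeff_coeff coeff_eq_0)

section \<open>Local slices\<close>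

definition local_slice :: "'b \<Rightarrow> bool" where
  "local_slice s \<longleftrightarrow> s \<notin> invariants \<delta> \<and> (\<forall>b. b \<notin> invariants \<delta> \<longrightarrow> degree (\<delta> s) \<le> degree (\<delta> b))"

lemma ex_local_slice:
  assumes "invariants \<delta> \<noteq> UNIV"
  shows "\<exists>s. local_slice s"
proof -
  obtain b where "b \<notin> invariants \<delta>" using assms by blast
  from exists_least_iff[of "\<lambda>n. \<exists>b. b \<notin> invariants \<delta> \<and> degree (\<delta> b) = n"] this
  show ?thesis unfolding local_slice_def by (metis not_le)
qed

text \<open>In positive characteristic the degree of a local slice may be a power of \<open>p\<close>.\<close>

lemma local_slice_degree_dvd:
  assumes s: "local_slice s"
  shows "degree (\<delta> s) dvd degree (\<delta> b)"
proof (rule ccontr)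
  define d where "d = degree (\<delta> s)"
  have d: "d > 0" using s by (auto simp: d_def local_slice_def inv_iff)
  have small: "x \<in> invariants \<delta>" if "degree (\<delta> x) < d" for x
    using s that by (auto simp: d_def local_slice_def not_le[symmetric])
  assume n: "\<not> degree (\<delta> s) dvd degree (\<delta> b)"
  define q r where "q = degree (\<delta> b) div d" and "r = degree (\<delta> b) mod d"
  have r: "0 < r" "r < d" and qr: "degree (\<delta> b) = q * d + r"
    using n d by (auto simp: q_def r_def d_def[symmetric] mod_greater_zero_iff_not_dvd)
  \<comment> \<open>By minimality of \<open>d\<close> the inner coefficients of
    \<open>\<delta> s\<close> are invariant, so the iteration rule forces the binomial multiple of
    its leading coefficient to vanish.\<close>
  have "of_nat (d choose i) = (0::'b)" if i: "0 < i" "i < d" for i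
  proof -
    have "coeff (\<delta> s) i \<in> invariants \<delta>"
      using degree_coeff_le[of s i] i d by (intro small) (simp add: d_def)
    then have "coeff (\<delta> (coeff (\<delta> s) i)) (d - i) = 0"
      using i by (intro coeff_eq_0) (simp add: inv_iff)
    then have "of_nat (d choose i) * lead_coeff (\<delta> s) = 0"
      using i by (simp add: coeff_coeff d_def)
    then show ?thesis using d by (auto simp: d_def rhom_0[OF hom])
  qed
  then have c: "of_nat ((q * d + r) choose (q * d)) = (1::'b)"
    using r by (intro of_nat_choose_eq_1)
  \<comment> \<open>This coefficient has degree at most \<open>r < d\<close>, hence is invariant.
    Its own coefficient at \<open>r\<close> is therefore zero, yet it equals the leading coefficient
    of \<open>\<delta> b\<close>, the binomial factor being 1.\<close>
  let ?x = "coeff (\<delta> b) (q * d)"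
  have "degree (\<delta> ?x) < d"
    using degree_coeff_le[of b "q * d"] qr r by simp
  then have "coeff (\<delta> ?x) r = 0"
    using r by (intro coeff_eq_0) (use small[of ?x] in \<open>simp add: inv_iff\<close>)
  then have "lead_coeff (\<delta> b) = 0" by (simp add: coeff_coeff c qr)
  then have "degree (\<delta> b) = 0" by (metis degree_0 leading_coeff_0_iff)
  then show False using qr r by simp
qed

text \<open>Division by the powers of \<open>s\<close>: since the degree of \<open>s\<close> divides
  that of \<open>b\<close>, a suitable power of \<open>s\<close> has the same degree as
  \<open>b\<close>, and cross-multiplying with the two leading coefficients, which are invariant,
  lowers the degree.\<close>

lemma local_slice_generates:
  assumes s: "local_slice s"
  shows "\<exists>m F. (\<forall>i. coeff F i \<in> invariants \<delta>) \<and> lead_coeff (\<delta> s) ^ m * b = poly F s"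
proof (induction "degree (\<delta> b)" arbitrary: b rule: less_induct)
  case less
  let ?g = "lead_coeff (\<delta> s)"
  show ?case
  proof (cases "b \<in> invariants \<delta>")
    case True
    then have "(\<forall>i. coeff [:b:] i \<in> invariants \<delta>) \<and> ?g ^ 0 * b = poly [:b:] s"
      by (simp add: coeff_pCons inv_0 split: nat.split)
    then show ?thesis by blast
  next
    case False
    then have n: "degree (\<delta> b) > 0" by (simp add: inv_iff)
    obtain q where q: "degree (\<delta> b) = degree (\<delta> s) * q"
      using local_slice_degree_dvd[OF s, of b] by blast
    let ?\<beta> = "lead_coeff (\<delta> b)"
    define b' where "b' = ?g ^ q * b - ?\<beta> * s ^ q"
    have \<delta>b': "\<delta> b' = smult (?g ^ q) (\<delta> b) - smult ?\<beta> (\<delta> s ^ q)"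
      using invD[OF lead_coeff_inv, of s] invD[OF lead_coeff_inv, of b]
      by (simp add: b'_def rhom_diff[OF hom] rhom_mult[OF hom] rhom_power[OF hom] poly_const_pow)
    have dq: "degree (\<delta> s ^ q) = degree (\<delta> b)"
      using s by (subst degree_power_eq) (auto simp: q local_slice_def inv_iff rhom_0[OF hom])
    have "degree (\<delta> b') \<le> degree (\<delta> b)"
      unfolding \<delta>b' using dq by (intro degree_diff_le) (simp_all add: degree_smult_le order_trans[OF degree_smult_le])
    moreover have "coeff (\<delta> b') (degree (\<delta> b)) = 0"
      using dq lead_coeff_power[of "\<delta> s" q] by (simp add: \<delta>b')
    ultimately have "degree (\<delta> b') < degree (\<delta> b)"
      using n by (metis degree_0 le_neq_implies_less leading_coeff_0_iff)
    from less[OF this] obtain m F where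
      F: "\<forall>i. coeff F i \<in> invariants \<delta>" "?g ^ m * b' = poly F s" by blast
    have "coeff (F + monom (?g ^ m * ?\<beta>) q) i \<in> invariants \<delta>" for i
      using F by (simp add: inv_add inv_mult inv_power lead_coeff_inv inv_0)
    moreover have "?g ^ (m + q) * b = poly (F + monom (?g ^ m * ?\<beta>) q) s"
      using F(2) by (simp add: b'_def poly_monom algebra_simps power_add)
    ultimately show ?thesis by blast
  qed
qed

end

lemma EXP_iff:
  assumes "rhom \<iota>"
  shows "\<delta> \<in> EXP \<iota> \<longleftrightarrow> expmap \<delta> \<and> (\<forall>a. \<delta> (\<iota> a) = [:\<iota> a:])"
proof
  assume "\<delta> \<in> EXP \<iota>"
  moreover then have "\<delta> 1 = 1"
    using rhom_1[OF assms] by (auto simp: EXP_def one_pCons dest: spec[of _ 1])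
  ultimately show "expmap \<delta> \<and> (\<forall>a. \<delta> (\<iota> a) = [:\<iota> a:])"
    by (simp add: EXP_def expmap_def rhom_def)
qed (simp add: EXP_def expmap_def rhom_def)

section \<open>Algebraic dependence\<close>

lemma ev1_monom: "rhom j \<Longrightarrow> ev1 j u (monom a n) = j a * u ^ n"
  by (simp add: ev1_def map_poly_monom rhom_0 poly_monom)

text \<open>Fraction-free elimination: a pivot \<open>v p k\<close> clears equation \<open>k\<close>
  from the other unknowns, and the unknown \<open>p\<close> is determined at the end, after the
  others have been scaled by the pivot.\<close>

lemma linear_dependence:
  fixes v :: "'i \<Rightarrow> 'j \<Rightarrow> 'a::idom"
  assumes "finite J" "finite I" "card J < card I"
  shows "\<exists>c. (\<exists>i\<in>I. c i \<noteq> 0) \<and> (\<forall>j\<in>J. (\<Sum>i\<in>I. c i * v i j) = 0)"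
  using assms
proof (induction J arbitrary: I v rule: finite_induct)
  case empty
  then have "I \<noteq> {}" by auto
  then show ?case by (intro exI[of _ "\<lambda>_. 1"]) auto
next
  case (insert k J)
  show ?case
  proof (cases "\<forall>i\<in>I. v i k = 0")
    case True
    have "card J < card I" using insert by simp
    from insert.IH[OF insert.prems(1) this, of v] obtain c where
      c: "\<exists>i\<in>I. c i \<noteq> 0" "\<forall>j\<in>J. (\<Sum>i\<in>I. c i * v i j) = 0" by blast
    have "(\<Sum>i\<in>I. c i * v i k) = 0" using True by (intro sum.neutral) simp
    then show ?thesis using c by blast
  next
    case False
    then obtain p where p: "p \<in> I" "v p k \<noteq> 0" by blast
    have "card J < card (I - {p})" using insert p by simp
    from insert.IH[OF _ this, of "\<lambda>i j. v p k * v i j - v i k * v p j"] insert.prems(1)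
    obtain c where c: "\<exists>i\<in>I - {p}. c i \<noteq> 0"
      "\<forall>j\<in>J. (\<Sum>i\<in>I - {p}. c i * (v p k * v i j - v i k * v p j)) = 0" by auto
    define c' where "c' i = (if i = p then - (\<Sum>i\<in>I - {p}. c i * v i k) else v p k * c i)" for i
    have "(\<Sum>i\<in>I. c' i * v i j) = (\<Sum>i\<in>I - {p}. c i * (v p k * v i j - v i k * v p j))" for j
    proof -
      have "(\<Sum>i\<in>I. c' i * v i j) = c' p * v p j + (\<Sum>i\<in>I - {p}. c' i * v i j)"
        using p insert.prems(1) by (simp add: sum.remove)
      also have "(\<Sum>i\<in>I - {p}. c' i * v i j) = (\<Sum>i\<in>I - {p}. v p k * c i * v i j)"
        by (rule sum.cong) (auto simp: c'_def)
      also have "c' p = - (\<Sum>i\<in>I - {p}. c i * v i k)" by (simp add: c'_def)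
      finally show ?thesis
        by (simp add: right_diff_distrib sum_subtractf sum_distrib_left sum_distrib_right mult_ac)
    qed
    moreover have "(\<Sum>i\<in>I - {p}. c i * (v p k * v i k - v i k * v p k)) = 0"
      by (simp add: mult.commute)
    moreover have "\<exists>i\<in>I. c' i \<noteq> 0" using c(1) p by (auto simp: c'_def)
    ultimately show ?thesis using c(2) by (intro exI[of _ c']) auto
  qed
qed

definition bidegree_le :: "nat \<Rightarrow> 'a::zero poly poly \<Rightarrow> bool" where
  "bidegree_le m f \<longleftrightarrow> (\<forall>i j. coeff (coeff f i) j \<noteq> 0 \<longrightarrow> i \<le> m \<and> j \<le> m)"

lemma ex_bidegree_le: "\<exists>m. bidegree_le m f"
proof -
  let ?m = "degree f + (\<Sum>i\<le>degree f. degree (coeff f i))"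
  have "i \<le> ?m \<and> j \<le> ?m" if "coeff (coeff f i) j \<noteq> 0" for i j
  proof -
    have i: "i \<le> degree f" using that by (metis coeff_0 le_degree)
    then have "degree (coeff f i) \<le> (\<Sum>i\<le>degree f. degree (coeff f i))"
      by (intro member_le_sum) auto
    with that i le_degree[of "coeff f i" j] show ?thesis by linarith
  qed
  then show ?thesis unfolding bidegree_le_def by blast
qed

lemma bidegree_le_mono: "bidegree_le m f \<Longrightarrow> m \<le> n \<Longrightarrow> bidegree_le n f"
  unfolding bidegree_le_def by (meson order_trans)

lemma bidegree_le_mult:
  fixes f g :: "'a::comm_ring_1 poly poly"
  assumes "bidegree_le m f" "bidegree_le n g"
  shows "bidegree_le (m + n) (f * g)"
  unfolding bidegree_le_def
proof (intro allI impI)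
  fix i j assume "coeff (coeff (f * g) i) j \<noteq> 0"
  then have "(\<Sum>k\<le>i. \<Sum>l\<le>j. coeff (coeff f k) l * coeff (coeff g (i - k)) (j - l)) \<noteq> 0"
    by (simp add: coeff_mult coeff_sum)
  then obtain k where "k \<le> i" "(\<Sum>l\<le>j. coeff (coeff f k) l * coeff (coeff g (i - k)) (j - l)) \<noteq> 0"
    by (meson atMost_iff sum.not_neutral_contains_not_neutral)
  then obtain l where "l \<le> j" "coeff (coeff f k) l * coeff (coeff g (i - k)) (j - l) \<noteq> 0"
    by (meson atMost_iff sum.not_neutral_contains_not_neutral)
  then have "coeff (coeff f k) l \<noteq> 0" "coeff (coeff g (i - k)) (j - l) \<noteq> 0" by auto
  then have "k \<le> m" "l \<le> m" "i - k \<le> n" "j - l \<le> n"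
    using assms unfolding bidegree_le_def by blast+
  then show "i \<le> m + n \<and> j \<le> m + n" by linarith
qed

lemma bidegree_le_power:
  fixes f :: "'a::comm_ring_1 poly poly"
  shows "bidegree_le m f \<Longrightarrow> bidegree_le (k * m) (f ^ k)"
proof (induction k)
  case 0
  show ?case by (simp add: bidegree_le_def one_pCons coeff_pCons split: nat.split)
next
  case (Suc k)
  then show ?case using bidegree_le_mult[of m f "k * m" "f ^ k"] by simp
qed

text \<open>A dimension count: the products \<open>a^i b^j w^l\<close> with exponents below
  \<open>N\<close> are cubically many, while their bidegrees stay in a square whose area grows only
  quadratically in \<open>N\<close>.\<close>

lemma three_elements_dependent:
  fixes a b w :: "'a::idom poly poly"
  shows "\<exists>F :: 'a poly3. F \<noteq> 0 \<and> ev3 const2 a b w F = 0"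
proof -
  obtain ma where ma: "bidegree_le ma a" using ex_bidegree_le by blast
  obtain mb where mb: "bidegree_le mb b" using ex_bidegree_le by blast
  obtain mw where mw: "bidegree_le mw w" using ex_bidegree_le by blast
  define m where "m = ma + mb + mw"
  have m: "bidegree_le m a" "bidegree_le m b" "bidegree_le m w"
    using bidegree_le_mono[OF ma, of m] bidegree_le_mono[OF mb, of m] bidegree_le_mono[OF mw, of m]
    by (simp_all add: m_def)
  \<comment> \<open>With this choice
    \<open>(3 m N + 1)^2 \<le> (3 m + 1)^2 N^2 < N^3\<close>.\<close>
  define N where "N = (3 * m + 1)\<^sup>2 + 1"
  define I where "I = {..<N} \<times> {..<N} \<times> {..<N}"
  define J where "J = {..3 * m * N} \<times> {..3 * m * N}"
  have "3 * m * N + 1 \<le> (3 * m + 1) * N" by (simp add: N_def)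
  then have "card J \<le> ((3 * m + 1) * N) * ((3 * m + 1) * N)"
    unfolding J_def card_cartesian_product by (intro mult_mono) auto
  also have "\<dots> = (3 * m + 1)\<^sup>2 * (N * N)" by (simp only: power2_eq_square mult_ac)
  also have "\<dots> < N * (N * N)" by (rule mult_strict_right_mono) (simp_all add: N_def)
  also have "\<dots> = card I" by (simp add: I_def)
  finally have less: "card J < card I" .
  define v where "v = (\<lambda>(i, j, l) (p, q). coeff (coeff (a ^ i * b ^ j * w ^ l) p) q)"
  obtain c where c: "\<exists>i\<in>I. c i \<noteq> 0" "\<forall>j\<in>J. (\<Sum>i\<in>I. c i * v i j) = 0"
    using linear_dependence[OF _ _ less, of v] by (auto simp: I_def J_def)
  define F :: "'a poly3" where "F = (\<Sum>(i, j, l)\<in>I. monom (monom (monom (c (i, j, l)) i) j) l)"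
  have "ev3 const2 a b w F = (\<Sum>(i, j, l)\<in>I. const2 (c (i, j, l)) * (a ^ i * b ^ j * w ^ l))"
    unfolding F_def by (auto simp: rhom_sum rhom_ev1 ev1_monom mult.assoc intro!: sum.cong)
  also have "\<dots> = 0"
  proof (intro poly_eqI)
    fix p q
    have e: "coeff (coeff (\<Sum>(i, j, l)\<in>I. const2 (c (i, j, l)) * (a ^ i * b ^ j * w ^ l)) p) q =
        (\<Sum>i\<in>I. c i * v i (p, q))"
      by (auto simp: coeff_sum const2_def v_def intro!: sum.cong)
    show "coeff (coeff (\<Sum>(i, j, l)\<in>I. const2 (c (i, j, l)) * (a ^ i * b ^ j * w ^ l)) p) q =
      coeff (coeff 0 p) q"
    proof (cases "(p, q) \<in> J")
      case False
      have "v x (p, q) = 0" if xI: "x \<in> I" for x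
      proof -
        obtain i j l where x: "x = (i, j, l)" "i < N" "j < N" "l < N"
          using xI by (cases x) (auto simp: I_def)
        have "bidegree_le (i * m + j * m + l * m) (a ^ i * b ^ j * w ^ l)"
          using m by (intro bidegree_le_mult bidegree_le_power)
        moreover have "(i + j + l) * m \<le> (3 * N) * m"
          using x by (intro mult_le_mono1) simp
        moreover have "(i + j + l) * m = i * m + j * m + l * m" "(3 * N) * m = 3 * m * N"
          by (simp_all add: distrib_right)
        ultimately have "bidegree_le (3 * m * N) (a ^ i * b ^ j * w ^ l)"
          by (metis bidegree_le_mono)
        then show ?thesis using False x by (auto simp: v_def J_def bidegree_le_def)
      qed
      then show ?thesis by (simp add: e)
    qed (use c e in simp)
  qed
  finally have F0: "ev3 const2 a b w F = 0" .
  obtain i j l where i: "(i, j, l) \<in> I" "c (i, j, l) \<noteq> 0" using c(1) by auto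
  have "coeff (coeff (coeff F l) j) i = (\<Sum>x\<in>I. if x = (i, j, l) then c x else 0)"
    unfolding F_def coeff_sum by (auto intro!: sum.cong)
  also have "\<dots> = c (i, j, l)" using i by (simp add: I_def)
  finally have "F \<noteq> 0" using i by auto
  then show ?thesis using F0 by blast
qed

section \<open>Two variables over a base ring\<close>

abbreviation "map_poly2 f \<equiv> map_poly (map_poly f)"
abbreviation "map_poly3 f \<equiv> map_poly (map_poly (map_poly f))"

abbreviation varY :: "'a::comm_ring_1 poly poly" where "varY \<equiv> [:[:0, 1:]:]"
abbreviation varZ :: "'a::comm_ring_1 poly poly" where "varZ \<equiv> [:0, 1:]"

lemma ev1_map_poly:
  assumes "rhom f" "rhom j"
  shows "ev1 f u (map_poly j p) = ev1 (\<lambda>a. f (j a)) u p"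
  unfolding ev1_def using map_poly_map_poly[of f j p] assms by (simp add: rhom_0 o_def)

lemma map_poly2_const2 [simp]: "f 0 = 0 \<Longrightarrow> map_poly2 f (const2 a) = const2 (f a)"
  by (simp add: const2_def map_poly_pCons)

lemma map_poly3_const3 [simp]: "f 0 = 0 \<Longrightarrow> map_poly3 f (const3 a) = const3 (f a)"
  by (simp add: const3_def map_poly_pCons)

lemma map_poly2_var [simp]:
  "f 0 = 0 \<Longrightarrow> f 1 = 1 \<Longrightarrow> map_poly2 f varY = varY"
  "f 0 = 0 \<Longrightarrow> f 1 = 1 \<Longrightarrow> map_poly2 f varZ = varZ"
  by (simp_all add: map_poly_pCons)

lemma map_poly_ident [simp]: "map_poly (\<lambda>x. x) = (\<lambda>x. x)"
  by (rule ext) simp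

lemma map_poly_eq_0D:
  assumes "f 0 = 0" "\<And>x. f x = 0 \<Longrightarrow> x = 0" "map_poly f p = 0"
  shows "p = 0"
  using assms by (metis coeff_0 coeff_map_poly leading_coeff_0_iff)

lemma const3_eq: "const3 a = [:const2 a:]"
  by (simp add: const3_def const2_def)

text \<open>
  \<open>hext j u v\<close> is the homomorphism \<open>k[Y,Z] \<rightarrow> k[Y,Z][t]\<close> with \<open>Y \<mapsto> u\<close>, \<open>Z \<mapsto> v\<close>. For \<open>u = \<delta> Y\<close> and
  \<open>v = \<delta> Z\<close> it is the base change of \<open>\<delta>\<close> along \<open>j\<close>.
\<close>

definition hext ::
  "('r::idom \<Rightarrow> 'k::idom) \<Rightarrow> 'r poly3 \<Rightarrow> 'r poly3 \<Rightarrow> 'k poly poly \<Rightarrow> 'k poly3" where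
  "hext j u v = ev2 const3 (map_poly3 j u) (map_poly3 j v)"

lemma rhom_hext: "rhom (hext j u v)"
  unfolding hext_def by (simp add: rhom_ev1)

lemma hext_simps [simp]:
  "hext j u v (const2 a) = const3 a"
  "hext j u v varY = map_poly3 j u"
  "hext j u v varZ = map_poly3 j v"
  unfolding hext_def const2_def by (simp_all add: rhom_ev1)

text \<open>\<open>T\<close> is linear only over the image of \<open>I1\<close>, so a factor
  \<open>I1 f\<close> is carried along. The conclusion then has the shape of the assumption
  \<open>Tc\<close> for the next variable, and the lemma can be iterated.\<close>

lemma ev1_semilin:
  assumes T: "semilin I1 I2 T" and \<tau>: "\<tau> 0 = 0" and c: "rhom c1" "rhom c2"
    and I: "rhom I1"
    and Tc: "\<And>a f. T (c1 a * I1 f) = c2 (\<tau> a) * I2 f"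
  shows "T (ev1 c1 (I1 u) q * I1 f) = ev1 c2 (I2 u) (map_poly \<tau> q) * I2 f"
proof (induction q)
  case 0
  show ?case using c by (simp add: ev1_def semilin_0[OF T])
next
  case (pCons a q)
  have e: "ev1 c1 (I1 u) (pCons a q) * I1 f = c1 a * I1 f + I1 u * (ev1 c1 (I1 u) q * I1 f)"
    by (simp add: ev1_pCons[OF c(1)] algebra_simps)
  show ?case
    by (simp only: e semilin_add[OF T] semilin_mult[OF T] Tc pCons.IH map_poly_pCons[of \<tau>, OF \<tau>] ev1_pCons[OF c(2)])
       (simp add: algebra_simps)
qed

text \<open>The images of \<open>Y\<close> and \<open>Z\<close> have coefficients in the base, so
  base changes of \<open>\<delta>\<close> commute with coefficientwise linear maps, not merely with
  homomorphisms.\<close>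

lemma hext_semilin:
  assumes \<tau>: "semilin j1 j2 \<tau>" and j: "rhom j1" "rhom j2"
  shows "map_poly3 \<tau> (hext j1 u v f) = hext j2 u v (map_poly2 \<tau> f)"
proof -
  note t1 = semilin_map_poly[OF \<tau> j]
  note t2 = semilin_map_poly[OF t1 rhom_map_poly[OF j(1)] rhom_map_poly[OF j(2)]]
  note I1 = rhom_map_poly[OF rhom_map_poly[OF rhom_map_poly[OF j(1)]]]
  note I2 = rhom_map_poly[OF rhom_map_poly[OF rhom_map_poly[OF j(2)]]]
  note t3 = semilin_map_poly[OF t2 rhom_map_poly[OF rhom_map_poly[OF j(1)]] rhom_map_poly[OF rhom_map_poly[OF j(2)]]]
  have 0: "map_poly3 \<tau> (const3 a * map_poly3 j1 f) = const3 (\<tau> a) * map_poly3 j2 f" for a f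
    using semilin_mult[OF t3, of f "const3 a"] semilin_0[OF \<tau>] by (simp add: mult.commute)
  have 1: "map_poly3 \<tau> (ev1 const3 (map_poly3 j1 u) p * map_poly3 j1 f) = ev1 const3 (map_poly3 j2 u) (map_poly \<tau> p) * map_poly3 j2 f"
    for p f
    using ev1_semilin[OF t3 semilin_0[OF \<tau>] rhom_const3 rhom_const3 I1 0] .
  have 2: "map_poly3 \<tau> (ev2 const3 (map_poly3 j1 u) (map_poly3 j1 v) p * map_poly3 j1 f) =
      ev2 const3 (map_poly3 j2 u) (map_poly3 j2 v) (map_poly2 \<tau> p) * map_poly3 j2 f" for p f
    using ev1_semilin[OF t3 semilin_0[OF t1] rhom_ev1[OF rhom_const3] rhom_ev1[OF rhom_const3] I1 1] .
  show ?thesis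
    using 2[of f 1] by (simp add: hext_def rhom_1[OF I1] rhom_1[OF I2])
qed

lemma hext_map2:
  assumes "rhom j"
  shows "hext j u v (map_poly2 j f) = map_poly3 j (hext (\<lambda>x. x) u v f)"
proof -
  have "semilin (\<lambda>x. x) j j" using assms by (simp add: semilin_def rhom_add rhom_mult)
  from hext_semilin[OF this rhom_id assms] show ?thesis by simp
qed

text \<open>\<open>hgr f = f(TY, TZ)\<close>, so that \<open>tdeg\<close> is the total degree in \<open>Y\<close> and \<open>Z\<close>.\<close>

definition hgr :: "'a::idom poly poly \<Rightarrow> 'a poly3" where
  "hgr = hext (\<lambda>x. x) [:0, varY:] [:0, varZ:]"

definition tdeg :: "'a::idom poly poly \<Rightarrow> nat" where
  "tdeg f = degree (hgr f)"

definition at0 :: "'a::comm_ring_1 poly poly \<Rightarrow> 'a" where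
  "at0 f = poly (poly f 0) 0"

lemma rhom_hgr: "rhom hgr"
  unfolding hgr_def by (rule rhom_hext)

lemma rhom_at0: "rhom at0"
  unfolding at0_def by (rule rhom_comp) simp_all

lemma at0_const2 [simp]: "at0 (const2 a) = a"
  by (simp add: at0_def const2_def)

lemma hgr_const2 [simp]: "hgr (const2 a) = const3 a"
  by (simp add: hgr_def)

lemma at0_var [simp]: "at0 varY = 0" "at0 varZ = 0"
  by (simp_all add: at0_def)

lemma hext_hgr: "rhom j \<Longrightarrow> hext j [:0, varY:] [:0, varZ:] = hgr"
  unfolding hgr_def hext_def by (simp add: map_poly_pCons rhom_0 rhom_1)

lemma hgr_semilin:
  fixes j1 :: "'r::idom \<Rightarrow> 'a::idom" and j2 :: "'r \<Rightarrow> 'b::idom"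
  assumes \<tau>: "semilin j1 j2 \<tau>" and j: "rhom j1" "rhom j2"
  shows "hgr (map_poly2 \<tau> f) = map_poly3 \<tau> (hgr f)"
  using hext_semilin[OF \<tau> j, of "[:0, varY:]" "[:0, varZ:]" f]
  by (simp only: hext_hgr[OF j(1)] hext_hgr[OF j(2)])

lemma hgr_map2: "rhom j \<Longrightarrow> hgr (map_poly2 j f) = map_poly3 j (hgr f)"
  by (rule hgr_semilin[of "\<lambda>x. x" j]) (simp_all add: semilin_def rhom_add rhom_mult)

lemma poly_hgr_1: "poly (hgr f) 1 = f"
proof -
  have "(\<lambda>f. poly (hgr f) 1) = (\<lambda>f. f)"
    by (rule rhom_ext_poly2[OF rhom_comp[OF rhom_poly rhom_hgr] rhom_id])
       (simp_all add: hgr_def const3_eq)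
  then show ?thesis by (rule fun_cong)
qed

lemma poly_hgr_0: "poly (hgr f) 0 = const2 (at0 f)"
proof -
  have "(\<lambda>f. poly (hgr f) 0) = (\<lambda>f. const2 (at0 f))"
    by (rule rhom_ext_poly2[OF rhom_comp[OF rhom_poly rhom_hgr] rhom_comp[OF rhom_const2 rhom_at0]])
       (simp_all add: hgr_def const3_eq rhom_0[OF rhom_const2])
  then show ?thesis by (rule fun_cong)
qed

lemma hgr_eq_0_iff [simp]: "hgr f = 0 \<longleftrightarrow> f = 0"
  using poly_hgr_1[of f] rhom_0[OF rhom_hgr] by auto

lemma tdeg_mult: "f \<noteq> 0 \<Longrightarrow> g \<noteq> 0 \<Longrightarrow> tdeg (f * g) = tdeg f + tdeg g"
  by (simp add: tdeg_def rhom_mult[OF rhom_hgr] degree_mult_eq)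

lemma tdeg_const2 [simp]: "tdeg (const2 a) = 0"
  by (simp add: tdeg_def const3_eq)

lemma tdeg_0 [simp]: "tdeg 0 = 0"
  by (simp add: tdeg_def rhom_0[OF rhom_hgr])

text \<open>A polynomial of degree 0 in \<open>T\<close> has the same value at 1, which is
  \<open>f\<close>, and at 0, which is the value of \<open>f\<close> at the origin.\<close>

lemma tdeg_eq_0D: "tdeg f = 0 \<Longrightarrow> f = const2 (at0 f)"
proof -
  assume "tdeg f = 0"
  then obtain c where "hgr f = [:c:]" by (auto simp: tdeg_def elim: degree_eq_zeroE)
  then show ?thesis using poly_hgr_0[of f] poly_hgr_1[of f] by simp
qed

lemma degree_diff_eq_left: "degree q < degree p \<Longrightarrow> degree (p - q) = degree (p :: 'a::ab_group_add poly)"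
  using degree_add_eq_left[of "- q" p] by simp

lemma tdeg_diff_const2: "tdeg (f - const2 a) = tdeg f"
proof (cases "tdeg f = 0")
  case True
  then have "f - const2 a = const2 (at0 f - a)"
    using tdeg_eq_0D[of f] by (simp add: rhom_diff[OF rhom_const2])
  then show ?thesis using True by simp
next
  case False
  then show ?thesis
    using degree_diff_eq_left[of "const3 a" "hgr f"]
    by (simp add: tdeg_def rhom_diff[OF rhom_hgr] const3_eq)
qed

lemma tdeg_map2:
  assumes "rhom j" "\<And>x. j x = 0 \<Longrightarrow> x = 0"
  shows "tdeg (map_poly2 j f) = tdeg f"
proof -
  have "map_poly2 j x \<noteq> 0" if "x \<noteq> 0" for x
    using that map_poly_eq_0D[of "map_poly j" x] map_poly_eq_0D[of j] assms by (auto simp: rhom_0)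
  then show ?thesis unfolding tdeg_def hgr_map2[OF assms(1)] by (rule degree_map_poly)
qed

text \<open>Homogenising \<open>C(P)\<close> amounts to composing \<open>C\<close> with
  \<open>hgr P\<close>, and degrees multiply under composition.\<close>

lemma tdeg_ev1:
  assumes "C \<noteq> 0"
  shows "tdeg (ev1 const2 P C) = degree C * tdeg P"
proof -
  have "hgr (ev1 const2 P C) = pcompose (map_poly const2 C) (hgr P)"
    unfolding rhom_ev1_comp[OF rhom_hgr rhom_const2] pcompose_altdef
    by (simp add: ev1_def map_poly_map_poly o_def const3_eq)
  then show ?thesis by (simp add: tdeg_def degree_pcompose degree_map_poly)
qed

text \<open>The same composition shows that \<open>P\<close> is transcendental over the
  base.\<close>

lemma ev1_const2_eq_0:
  assumes "tdeg P > 0" "ev1 const2 P C = 0"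
  shows "C = 0"
proof -
  have "pcompose (map_poly const2 C) (hgr P) = hgr (ev1 const2 P C)"
    unfolding rhom_ev1_comp[OF rhom_hgr rhom_const2] pcompose_altdef
    by (simp add: ev1_def map_poly_map_poly o_def const3_eq)
  also have "\<dots> = 0" using assms by simp
  finally have "pcompose (map_poly const2 C) (hgr P) = 0" .
  then have "map_poly const2 C = 0"
    by (rule pcompose_eq_0) (use assms(1) in \<open>simp add: tdeg_def\<close>)
  then show ?thesis by (rule map_poly_eq_0D[rotated 2]) (simp_all add: const2_def)
qed

text \<open>The kernel of a homomorphism into a domain is a prime ideal, so it contains a prime
  factor of each of its nonzero elements.\<close>

lemma ex_prime_divisor_root:
  fixes x :: "'a::{factorial_semiring,idom}" and h :: "'a \<Rightarrow> 'b::idom"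
  assumes "rhom h" "x \<noteq> 0" "h x = 0"
  shows "\<exists>p. prime_elem p \<and> p dvd x \<and> h p = 0"
  using assms(2,3)
proof (induction x rule: prime_divisors_induct)
  case (unit x)
  then have "h x dvd h 1" using rhom_dvd[OF assms(1)] by blast
  then show ?case using unit by (simp add: rhom_1[OF assms(1)])
next
  case (factor p x)
  have "h p = 0 \<or> h x = 0" using factor by (simp add: rhom_mult[OF assms(1)])
  then show ?case
  proof
    assume "h x = 0"
    then show ?thesis using factor by (auto intro: dvd_mult)
  qed (use factor in \<open>auto intro!: exI[of _ p]\<close>)
qed simp

lemma ev2_dvd_diff:
  assumes "rhom c"
  shows "u dvd ev2 c u v G - ev1 c v (map_poly (\<lambda>p. coeff p 0) G)"
proof (induction G)
  case 0
  show ?case by (simp add: ev1_def)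
next
  case (pCons g G)
  have g: "u dvd ev1 c u g - c (coeff g 0)"
    by (cases g) (simp add: ev1_pCons[OF assms])
  have "ev2 c u v (pCons g G) - ev1 c v (map_poly (\<lambda>p. coeff p 0) (pCons g G)) =
      (ev1 c u g - c (coeff g 0)) + v * (ev2 c u v G - ev1 c v (map_poly (\<lambda>p. coeff p 0) G))"
    by (simp add: map_poly_pCons ev1_pCons[OF assms] ev1_pCons[OF rhom_ev1[OF assms]] algebra_simps)
  then show ?case using g pCons.IH by (simp only: dvd_add dvd_mult)
qed

text \<open>At the origin \<open>\<pi>\<close> and \<open>f\<close> vanish, which kills the constant
  term of \<open>H\<close>. A factor \<open>f\<close> splits off, and either \<open>\<pi>\<close>
  divides it or the argument repeats with a shorter \<open>H\<close>.\<close>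

lemma prime_dvd_ev1_root:
  assumes "prime_elem \<pi>" "\<pi> dvd ev1 const2 f H" "H \<noteq> 0" "at0 f = 0" "at0 \<pi> = 0"
  shows "\<pi> dvd f"
  using assms(2,3)
proof (induction H)
  case (pCons a H)
  have e: "ev1 const2 f (pCons a H) = const2 a + f * ev1 const2 f H"
    by (simp add: ev1_pCons)
  have d: "\<pi> dvd const2 a + f * ev1 const2 f H"
    using pCons.prems(1) unfolding e .
  have "at0 \<pi> dvd at0 (const2 a + f * ev1 const2 f H)"
    using d by (rule rhom_dvd[OF rhom_at0])
  then have "a = 0" using assms by (simp add: rhom_add[OF rhom_at0] rhom_mult[OF rhom_at0])
  then have "\<pi> dvd f * ev1 const2 f H" "H \<noteq> 0"
    using d pCons.prems(2) by (simp_all add: rhom_0[OF rhom_const2])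
  then show ?case using assms(1) pCons.IH by (auto simp: prime_elem_dvd_mult_iff)
qed simp

text \<open>Powers of the variable standing for \<open>u\<close> are cancelled until the relation
  survives setting that variable to 0.\<close>

lemma reduce_relation:
  fixes u v :: "'a::idom poly poly"
  assumes "G \<noteq> 0" "ev2 const2 u v G = 0" "u \<noteq> 0"
  shows "\<exists>G. map_poly (\<lambda>p. coeff p 0) G \<noteq> 0 \<and> ev2 const2 u v G = 0"
  using assms(1,2)
proof (induction "degree (lead_coeff G)" arbitrary: G rule: less_induct)
  case less
  show ?case
  proof (cases "map_poly (\<lambda>p. coeff p 0) G = 0")
    case True
    then have "coeff (coeff G i) 0 = 0" for i
      using coeff_map_poly[of "\<lambda>p. coeff p 0" G i] by simp
    then have "[:0, 1:] dvd coeff G i" for i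
      using poly_eq_0_iff_dvd[of "coeff G i" 0] by (simp add: poly_0_coeff_0)
    then have "[:[:0, 1:]:] dvd G" by (simp add: const_poly_dvd_iff)
    then obtain G1 where G1: "G = [:[:0, 1:]:] * G1" by (auto elim: dvdE)
    have "G1 \<noteq> 0" using less.prems G1 by auto
    moreover have "ev2 const2 u v G1 = 0"
      using less.prems(2) assms(3) by (simp only: G1 rhom_mult[OF rhom_ev1[OF rhom_ev1[OF rhom_const2]]])
        (simp add: rhom_ev1)
    moreover have "degree (lead_coeff G1) < degree (lead_coeff G)"
      using \<open>G1 \<noteq> 0\<close> by (simp add: G1 lead_coeff_mult)
    ultimately show ?thesis using less.hyps by blast
  qed (use less in blast)
qed

text \<open>One prime invariant divides all invariants that vanish at the origin. Subtracting the
  value at the origin and dividing lowers the total degree and stays inside the invariants, so every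
  invariant is a polynomial in that prime.\<close>

theorem invariants_two_variables:
  fixes \<delta> :: "'r::{factorial_ring_gcd,semiring_gcd_mult_normalize} poly poly \<Rightarrow> 'r poly3"
  assumes \<delta>: "\<delta> \<in> EXP const2" and nt: "invariants \<delta> \<noteq> UNIV"
    and nc: "\<exists>f\<in>invariants \<delta>. tdeg f > 0"
  shows "\<exists>P\<in>invariants \<delta>. tdeg P > 0 \<and> (\<forall>f\<in>invariants \<delta>. tdeg f > 0 \<longrightarrow> tdeg P \<le> tdeg f) \<and>
    invariants \<delta> = range (ev1 const2 P)"
proof -
  interpret expmap \<delta> using \<delta> by (simp add: EXP_iff)
  have c: "const2 a \<in> invariants \<delta>" for a using \<delta> by (simp add: EXP_iff invariants_def)
  obtain P0 where P0: "P0 \<in> invariants \<delta>" "tdeg P0 > 0"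
    "\<And>f. f \<in> invariants \<delta> \<Longrightarrow> tdeg f > 0 \<Longrightarrow> tdeg P0 \<le> tdeg f"
    using nc ex_has_least_nat[of "\<lambda>f. f \<in> invariants \<delta> \<and> tdeg f > 0" _ tdeg] by blast
  define P1 where "P1 = P0 - const2 (at0 P0)"
  have P1: "P1 \<in> invariants \<delta>" "tdeg P1 = tdeg P0" "at0 P1 = 0" "P1 \<noteq> 0"
    using P0 c tdeg_diff_const2[of P0 "at0 P0"]
    by (auto simp: P1_def inv_diff rhom_diff[OF rhom_at0])
  \<comment> \<open>As a factor of an invariant \<open>\<pi>\<close> is invariant, and being
    nonconstant it inherits the minimal total degree of \<open>P0\<close>.\<close>
  obtain \<pi> where \<pi>: "prime_elem \<pi>" "\<pi> dvd P1" "at0 \<pi> = 0"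
    using ex_prime_divisor_root[OF rhom_at0 P1(4,3)] by blast
  have \<pi>0: "\<pi> \<noteq> 0" using \<pi> by auto
  obtain v where v: "P1 = \<pi> * v" using \<pi>(2) by (auto elim: dvdE)
  have \<pi>inv: "\<pi> \<in> invariants \<delta>" using inv_factor[of \<pi> v] P1 v by simp
  have \<pi>deg: "tdeg \<pi> > 0" using tdeg_eq_0D[of \<pi>] \<pi>(3) \<pi>0 by (auto simp: rhom_0[OF rhom_const2])
  have "tdeg \<pi> \<le> tdeg P0" using tdeg_mult[of \<pi> v] P1 v by auto
  then have min: "tdeg \<pi> \<le> tdeg f" if "f \<in> invariants \<delta>" "tdeg f > 0" for f
    using P0(3)[OF that] by simp
  obtain s where s: "s \<notin> invariants \<delta>" using nt by blast
  have dvd: "\<pi> dvd f" if f: "f \<in> invariants \<delta>" "at0 f = 0" for f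
  proof -
    \<comment> \<open>Since \<open>s\<close> is transcendental over the invariants, every
      coefficient of this relation in \<open>s\<close> is itself a relation between
      \<open>\<pi>\<close> and \<open>f\<close>.\<close>
    obtain F :: "'r poly3" where F: "F \<noteq> 0" "ev3 const2 \<pi> f s F = 0"
      using three_elements_dependent by blast
    have in_inv: "ev2 const2 \<pi> f G \<in> invariants \<delta>" for G
    proof -
      have "ev1 const2 \<pi> g \<in> invariants \<delta>" for g
        by (induction g) (simp_all add: ev1_pCons inv_add inv_mult c \<pi>inv rhom_0[OF rhom_ev1] inv_0)
      then show ?thesis
        by (induction G)
          (simp_all add: ev1_pCons[OF rhom_ev1] inv_add inv_mult f rhom_0[OF rhom_ev1[OF rhom_ev1]] inv_0)
    qed
    have r0: "ev2 const2 \<pi> f 0 = 0" by (rule rhom_0) (simp add: rhom_ev1)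
    have "map_poly (ev2 const2 \<pi> f) F = 0"
      using s in_inv F(2) by (intro invariant_poly_root[of s]) (simp_all add: coeff_map_poly[of "ev2 const2 \<pi> f", OF r0] ev1_def[of "ev2 const2 \<pi> f"])
    then have "ev2 const2 \<pi> f (coeff F i) = 0" for i
      using coeff_map_poly[of "ev2 const2 \<pi> f", OF r0, of F i] by simp
    moreover obtain i where "coeff F i \<noteq> 0" using F(1) by (auto simp: poly_eq_iff)
    ultimately obtain G where G: "map_poly (\<lambda>p. coeff p 0) G \<noteq> 0" "ev2 const2 \<pi> f G = 0"
      using reduce_relation \<pi>0 by blast
    have "\<pi> dvd ev1 const2 f (map_poly (\<lambda>p. coeff p 0) G)"
      using ev2_dvd_diff[OF rhom_const2, of \<pi> f G] G(2) by simp
    from prime_dvd_ev1_root[OF \<pi>(1) this G(1) f(2) \<pi>(3)] show ?thesis .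
  qed
  have "f \<in> range (ev1 const2 \<pi>)" if "f \<in> invariants \<delta>" for f
    using that
  proof (induction "tdeg f" arbitrary: f rule: less_induct)
    case less
    define f' where "f' = f - const2 (at0 f)"
    have f': "f' \<in> invariants \<delta>" "at0 f' = 0"
      using less.prems c by (simp_all add: f'_def inv_diff rhom_diff[OF rhom_at0])
    obtain f1 where "f' = \<pi> * f1" using dvd[OF f'] by (rule dvdE)
    then have f1: "f' = f1 * \<pi>" by (simp only: mult.commute)
    have "\<exists>C. f1 = ev1 const2 \<pi> C"
    proof (cases "f1 = 0")
      case True
      then show ?thesis by (intro exI[of _ 0]) (simp add: rhom_0[OF rhom_ev1])
    next
      case False
      then have "tdeg f = tdeg f1 + tdeg \<pi>"
        using tdeg_diff_const2[of f "at0 f"] \<pi>0 by (simp add: f'_def[symmetric] f1 tdeg_mult)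
      then have "tdeg f1 < tdeg f" using \<pi>deg by simp
      moreover have "f1 \<in> invariants \<delta>" using inv_factor[of f1 \<pi>] f' f1 False \<pi>0 by simp
      ultimately show ?thesis using less.hyps by blast
    qed
    then obtain C where "f1 = ev1 const2 \<pi> C" by blast
    then have "f = ev1 const2 \<pi> (pCons (at0 f) C)"
      using f1 by (simp add: ev1_pCons f'_def algebra_simps)
    then show ?case by blast
  qed
  moreover have "ev1 const2 \<pi> C \<in> invariants \<delta>" for C
    by (induction C) (simp_all add: ev1_pCons inv_add inv_mult c \<pi>inv rhom_0[OF rhom_ev1] inv_0)
  ultimately have "invariants \<delta> = range (ev1 const2 \<pi>)" by blast
  then show ?thesis using \<pi>inv \<pi>deg min by blast
qed

section \<open>Slices over the generic point of the base\<close>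

lemma ev2_const2: "rhom c \<Longrightarrow> ev2 c u v (const2 a) = c a"
  by (simp add: const2_def rhom_ev1)

text \<open>The vector \<open>e\<close> is extended to a basis of the closure over the field. Such
  functionals bring linear identities back down to the field in every characteristic.\<close>

lemma ex_functional:
  fixes e :: "'k::field alg_closure"
  assumes "e \<noteq> 0"
  shows "\<exists>\<tau>. (\<forall>x y. \<tau> (x + y) = \<tau> x + \<tau> y) \<and> (\<forall>c x. \<tau> (to_ac c * x) = c * \<tau> x) \<and> \<tau> e = (1::'k)"
proof -
  interpret vs: vector_space_pair "\<lambda>(c::'k) x. to_ac c * x" "\<lambda>(c::'k) x. c * x"
    by unfold_locales (simp_all add: algebra_simps)
  have "vs.vs1.independent {e}" using assms by simp
  from vs.linear_independent_extend[OF this, of "\<lambda>_. 1"] obtain g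
    where g: "Vector_Spaces.linear (\<lambda>(c::'k) x. to_ac c * x) (\<lambda>(c::'k) x. c * x) g" "g e = 1" by auto
  show ?thesis
    using vs.linear_add[OF g(1)] vs.linear_scale[OF g(1)] g(2) by blast
qed

lemma ex_functional_semilin:
  fixes e :: "'r::idom fract alg_closure"
  assumes "e \<noteq> 0"
  obtains \<tau> where "semilin (\<lambda>x. to_ac (to_fract x)) to_fract \<tau>" "\<tau> e = 1"
  using ex_functional[OF assms] unfolding semilin_def by blast

lemma rhom_closure [simp]: "rhom (\<lambda>x. to_ac (to_fract x))"
  by (rule rhom_comp) simp_all

lemma clear_denominators:
  fixes p :: "'r::idom fract poly"
  shows "\<exists>q s. s \<noteq> 0 \<and> map_poly to_fract q = smult (to_fract s) p"
proof -
  have 0: "\<exists>x s. s \<noteq> 0 \<and> to_fract s * y = to_fract x" for y :: "'r fract"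
    by (cases y) (auto simp: to_fract_def eq_fract intro: mult.commute)
  have "\<exists>q s. s \<noteq> 0 \<and> map_poly to_fract [:s:] * p = map_poly to_fract q"
    by (rule common_denominator_step[of to_fract "\<lambda>x. x"]) (auto simp: 0)
  then show ?thesis by (auto simp: map_poly_pCons eq_commute)
qed

lemma clear_denominators2:
  fixes p :: "'r::idom fract poly poly"
  shows "\<exists>q s. s \<noteq> 0 \<and> map_poly2 to_fract q = const2 (to_fract s) * p"
proof -
  have 1: "\<exists>q s. s \<noteq> 0 \<and> map_poly to_fract [:s:] * p = map_poly to_fract q" for p :: "'r fract poly"
    using clear_denominators[of p] by (auto simp: map_poly_pCons eq_commute)
  have "\<exists>q s. s \<noteq> 0 \<and> map_poly2 to_fract [:[:s:]:] * p = map_poly2 to_fract q"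
    by (rule common_denominator_step[of "map_poly to_fract" "\<lambda>x. [:x:]"])
       (auto intro!: 1 map_poly_hom_mult)
  then obtain q s where "s \<noteq> 0" "map_poly2 to_fract [:[:s:]:] * p = map_poly2 to_fract q" by blast
  then have "s \<noteq> 0 \<and> map_poly2 to_fract q = const2 (to_fract s) * p"
    by (simp add: map_poly_pCons const2_def)
  then show ?thesis by blast
qed

lemma inj_map_poly2_to_fract: "inj (map_poly2 to_fract)"
  by (intro map_poly_hom_inj) (auto intro: injI)

lemma ev1_dvd_diff: "u - const2 \<theta> dvd ev1 const2 u C - const2 (poly C \<theta>)"
proof (induction C)
  case 0
  show ?case by (simp add: ev1_def rhom_0[OF rhom_const2])
next
  case (pCons a C)
  have "ev1 const2 u (pCons a C) - const2 (poly (pCons a C) \<theta>) =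
      u * (ev1 const2 u C - const2 (poly C \<theta>)) + (u - const2 \<theta>) * const2 (poly C \<theta>)"
    by (simp add: ev1_pCons rhom_add[OF rhom_const2] rhom_mult[OF rhom_const2] algebra_simps)
  then show ?case using pCons.IH by simp
qed

lemma ev2_dvd_diff_eval:
  "u - const2 \<theta> dvd ev2 const2 u v G - ev1 const2 v (map_poly (\<lambda>p. poly p \<theta>) G)"
proof (induction G)
  case 0
  show ?case by (simp add: ev1_def)
next
  case (pCons g G)
  have "ev2 const2 u v (pCons g G) - ev1 const2 v (map_poly (\<lambda>p. poly p \<theta>) (pCons g G)) =
      (ev1 const2 u g - const2 (poly g \<theta>)) + v * (ev2 const2 u v G - ev1 const2 v (map_poly (\<lambda>p. poly p \<theta>) G))"
    by (simp add: map_poly_pCons ev1_pCons ev1_pCons[OF rhom_ev1] algebra_simps)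
  then show ?case using ev1_dvd_diff[of u \<theta> g] pCons.IH by (simp only: dvd_add dvd_mult)
qed

text \<open>Over an algebraically closed field \<open>\<Phi>(s)\<close> is a constant times a
  product of factors \<open>s - \<mu>\<close>.\<close>

lemma prime_dvd_ev1_split:
  fixes s :: "'k::alg_closed_field poly poly"
  assumes "prime_elem \<pi>" "\<Phi> \<noteq> 0" "\<pi> dvd ev1 const2 s \<Phi>"
  shows "\<exists>\<mu>. \<pi> dvd s - const2 \<mu>"
  using assms(2,3)
proof (induction "degree \<Phi>" arbitrary: \<Phi> rule: less_induct)
  case less
  show ?case
  proof (cases "degree \<Phi> = 0")
    case True
    then obtain c where c: "\<Phi> = [:c:]" by (rule degree_eq_zeroE)
    then have "const2 c * const2 (inverse c) = 1"
      using less.prems(1) by (simp add: rhom_mult[OF rhom_const2, symmetric] rhom_1[OF rhom_const2])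
    then have "is_unit (const2 c)" by (rule dvdI[OF sym])
    then have "is_unit \<pi>" using less.prems(2) c by (simp add: dvd_trans)
    then show ?thesis using assms(1) by (simp add: prime_elem_not_unit)
  next
    case False
    then obtain \<mu> where "poly \<Phi> \<mu> = 0" using alg_closed_imp_poly_has_root[of \<Phi>] by blast
    then obtain \<Phi>1 where \<Phi>1: "\<Phi> = [:- \<mu>, 1:] * \<Phi>1" by (auto simp: poly_eq_0_iff_dvd elim: dvdE)
    have 0: "\<Phi>1 \<noteq> 0" using less.prems \<Phi>1 by auto
    have "ev1 const2 s [:- \<mu>, 1:] = s - const2 \<mu>"
      by (simp add: ev1_pCons rhom_simps[OF rhom_const2] rhom_0[OF rhom_ev1])
    then have "\<pi> dvd (s - const2 \<mu>) * ev1 const2 s \<Phi>1"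
      using less.prems(2) by (simp only: \<Phi>1 rhom_mult[OF rhom_ev1[OF rhom_const2]])
    then have "\<pi> dvd s - const2 \<mu> \<or> \<pi> dvd ev1 const2 s \<Phi>1"
      using assms(1) by (simp add: prime_elem_dvd_mult_iff)
    moreover have "degree \<Phi>1 < degree \<Phi>"
      using 0 by (simp only: \<Phi>1) (subst degree_mult_eq; simp)
    ultimately show ?thesis using less.hyps[of \<Phi>1] 0 by blast
  qed
qed

lemma ex_map_poly_preimage:
  assumes "f 0 = 0" "\<And>i. coeff F i \<in> range f"
  shows "\<exists>G. map_poly f G = F"
  using assms(2)
proof (induction F)
  case 0
  show ?case by (rule exI[of _ 0]) simp
next
  case (pCons a F)
  have "coeff F i \<in> range f" for i using pCons.prems[of "Suc i"] by simp
  then obtain G where "map_poly f G = F" using pCons.IH by blast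
  moreover obtain b where "a = f b" using pCons.prems[of 0] by auto
  ultimately have "map_poly f (pCons b G) = pCons a F" using assms(1) by (simp add: map_poly_pCons)
  then show ?case by blast
qed

context
  fixes \<delta> :: "'r::idom poly poly \<Rightarrow> 'r poly3" and P :: "'r poly poly"
  assumes \<delta>: "\<delta> \<in> EXP const2"
    and P: "P \<in> invariants \<delta>" "tdeg P > 0"
    and P_min: "\<And>f. f \<in> invariants \<delta> \<Longrightarrow> tdeg f > 0 \<Longrightarrow> tdeg P \<le> tdeg f"
begin

private abbreviation "j \<equiv> (\<lambda>x::'r. to_ac (to_fract x))"
private abbreviation "\<delta>' \<equiv> hext j (\<delta> varY) (\<delta> varZ)"

interpretation expmap \<delta>
  using \<delta> by (simp add: EXP_iff)

lemma const2_inv: "const2 a \<in> invariants \<delta>"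
  using \<delta> by (simp add: EXP_iff invariants_def)

lemma delta_hext: "\<delta> f = hext (\<lambda>x. x) (\<delta> varY) (\<delta> varZ) f"
proof -
  have "\<delta> = hext (\<lambda>x. x) (\<delta> varY) (\<delta> varZ)"
    by (rule rhom_ext_poly2[OF hom rhom_hext]) (simp_all add: const3_eq invD[OF const2_inv])
  then show ?thesis by (rule fun_cong)
qed

lemma delta'_map: "\<delta>' (map_poly2 j f) = map_poly3 j (\<delta> f)"
  by (subst hext_map2[OF rhom_closure]) (simp add: delta_hext[symmetric])

lemma delta'_coeff_0: "coeff (\<delta>' u) 0 = u"
proof -
  have j0: "map_poly2 j 0 = 0" by simp
  have "poly (\<delta>' u) 0 = u"
  proof (rule fun_cong[of "\<lambda>u. poly (\<delta>' u) 0" "\<lambda>u. u"],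
      rule rhom_ext_poly2[OF rhom_comp[OF rhom_poly rhom_hext] rhom_id])
    show "poly (\<delta>' (const2 a)) 0 = const2 a" for a by (simp add: const3_eq)
    show "poly (\<delta>' varY) 0 = varY" "poly (\<delta>' varZ) 0 = varZ"
      by (simp_all add: poly_0_coeff_0 coeff_map_poly[of "map_poly2 j", OF j0] coeff_0)
  qed
  then show ?thesis by (simp add: poly_0_coeff_0)
qed

text \<open>A functional that is 1 on some coefficient of the top homogeneous part of
  \<open>u\<close> preserves the total degree. Since \<open>\<delta>'\<close> is defined over the
  base, the image of \<open>u\<close> is still invariant, and clearing denominators moves it into
  the base.\<close>

lemma invariant_descends:
  assumes u: "\<delta>' u = [:u:]" "tdeg u > 0"
  shows "\<exists>w\<in>invariants \<delta>. tdeg w = tdeg u"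
proof -
  have "u \<noteq> 0" using u(2) by auto
  then have "coeff (hgr u) (tdeg u) \<noteq> 0" by (simp add: tdeg_def)
  then obtain i k where e: "coeff (coeff (coeff (hgr u) (tdeg u)) i) k \<noteq> 0"
    by (auto simp: poly_eq_iff)
  obtain \<tau> where \<tau>: "semilin j to_fract \<tau>" "\<tau> (coeff (coeff (coeff (hgr u) (tdeg u)) i) k) = 1"
    by (rule ex_functional_semilin[OF e])
  note \<tau>0 = semilin_0[OF \<tau>(1)]
  define v where "v = map_poly2 \<tau> u"
  have hv: "hgr v = map_poly3 \<tau> (hgr u)"
    unfolding v_def by (rule hgr_semilin[OF \<tau>(1)]) simp_all
  have "coeff (coeff (coeff (hgr v) (tdeg u)) i) k = 1"
    using \<tau>(2) \<tau>0 by (simp add: hv coeff_map_poly)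
  then have "coeff (hgr v) (tdeg u) \<noteq> 0" by auto
  then have "tdeg u \<le> tdeg v" unfolding tdeg_def by (rule le_degree)
  moreover have "tdeg v \<le> tdeg u" unfolding tdeg_def hv by (rule map_poly_degree_leq)
  ultimately have tv: "tdeg v = tdeg u" by simp
  have \<delta>v: "hext to_fract (\<delta> varY) (\<delta> varZ) v = [:v:]"
    using hext_semilin[OF \<tau>(1), of "\<delta> varY" "\<delta> varZ" u] u(1) by (simp add: v_def map_poly_pCons \<tau>0)
  obtain w r where w: "r \<noteq> 0" "map_poly2 to_fract w = const2 (to_fract r) * v"
    using clear_denominators2 by blast
  have "map_poly3 to_fract (\<delta> w) = hext to_fract (\<delta> varY) (\<delta> varZ) (map_poly2 to_fract w)"
    by (subst hext_map2) (simp_all add: delta_hext[symmetric])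
  also have "\<dots> = map_poly3 to_fract [:w:]"
    by (simp add: w(2) rhom_mult[OF rhom_hext] \<delta>v const3_eq map_poly_pCons)
  finally have "\<delta> w = [:w:]"
    using map_poly_hom_inj[OF _ inj_map_poly2_to_fract] by (auto dest: injD)
  moreover have "tdeg w = tdeg u"
  proof -
    have "v \<noteq> 0" using tv u(2) by auto
    then have "tdeg (map_poly2 to_fract w) = tdeg v"
      using w by (simp add: tdeg_mult)
    then show ?thesis using tdeg_map2[of to_fract w] tv by simp
  qed
  ultimately show ?thesis by (auto simp: invariants_def)
qed

text \<open>A factor of \<open>P - \<theta>\<close> is invariant because degrees in \<open>t\<close>
  add up, so it descends to an invariant over the base of the same total degree. Minimality of
  \<open>tdeg P\<close> leaves a constant for one of the two factors, and nonzero constants are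
  units over the closure.\<close>

lemma prime_fibre: "prime_elem (map_poly2 j P - const2 \<theta>)"
proof -
  let ?Q = "map_poly2 j P - const2 \<theta>"
  have tQ: "tdeg ?Q = tdeg P"
    using tdeg_map2[OF rhom_closure, of P] by (simp add: tdeg_diff_const2)
  have \<delta>Q: "\<delta>' ?Q = [:?Q:]"
    by (simp add: rhom_diff[OF rhom_hext] delta'_map invD[OF P(1)] map_poly_pCons const3_eq)
  have unit: "is_unit w" if "tdeg w = 0" "w \<noteq> 0" for w :: "'r fract alg_closure poly poly"
  proof -
    have w: "w = const2 (at0 w)" using tdeg_eq_0D that by blast
    then have "at0 w \<noteq> 0" using that(2) by (metis const2_eq_0_iff)
    then have "const2 (at0 w) * const2 (inverse (at0 w)) = 1"
      by (simp add: rhom_mult[OF rhom_const2, symmetric] rhom_1[OF rhom_const2])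
    then show ?thesis using w by (metis dvd_triv_left)
  qed
  have "irreducible ?Q"
  proof (rule irreducibleI)
    show Q0: "?Q \<noteq> 0" using tQ P(2) by (metis less_irrefl tdeg_0)
    show "\<not> is_unit ?Q"
    proof
      assume "is_unit ?Q"
      then obtain v where v: "1 = ?Q * v" by (rule dvdE)
      then have "v \<noteq> 0" by auto
      then have "tdeg (1 :: 'r fract alg_closure poly poly) = tdeg ?Q + tdeg v"
        using tdeg_mult[OF Q0, of v] v by simp
      then show False using tQ P(2) tdeg_const2[of "1 :: 'r fract alg_closure"] by (simp add: rhom_1[OF rhom_const2])
    qed
    fix u v assume uv: "?Q = u * v"
    have nz: "u \<noteq> 0" "v \<noteq> 0" using Q0 uv by auto
    have "\<delta>' u * \<delta>' v = [:?Q:]" using \<delta>Q by (simp add: uv rhom_mult[OF rhom_hext])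
    then have "degree (\<delta>' u * \<delta>' v) = 0" by simp
    moreover have "\<delta>' u \<noteq> 0" using delta'_coeff_0[of u] nz by auto
    moreover have "\<delta>' v \<noteq> 0" using delta'_coeff_0[of v] nz by auto
    ultimately have d: "degree (\<delta>' u) = 0" by (simp add: degree_mult_eq)
    have \<delta>u: "\<delta>' u = [:u:]"
      using d delta'_coeff_0[of u] by (metis degree_eq_zeroE coeff_pCons_0)
    have t: "tdeg P = tdeg u + tdeg v" using tQ tdeg_mult[OF nz] uv by simp
    show "is_unit u \<or> is_unit v"
    proof (cases "tdeg u = 0")
      case False
      then obtain w where "w \<in> invariants \<delta>" "tdeg w = tdeg u" using invariant_descends[OF \<delta>u] by auto
      then have "tdeg P \<le> tdeg u" using P_min[of w] False by simp
      then have "tdeg v = 0" using t by simp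
      then show ?thesis using unit nz by blast
    qed (use unit nz in blast)
  qed
  then show ?thesis by (rule irreducible_imp_prime_elem)
qed

text \<open>
  Minimality of the leading coefficient of \<open>s\<close> is what rules out denominators involving \<open>P\<close>: at a root \<open>\<theta>\<close> of
  such a denominator, \<open>s\<close> is congruent to a constant \<open>\<mu>\<close> modulo the prime \<open>P - \<theta>\<close>, and applying a linear
  functional to \<open>(s - \<mu>) / (P - \<theta>)\<close> yields a slice over the base with smaller leading coefficient.
\<close>

lemma ex_base_multiple:
  assumes nt: "invariants \<delta> \<noteq> UNIV" and gen: "invariants \<delta> = range (ev1 const2 P)"
  shows "\<exists>s. s \<notin> invariants \<delta> \<and>
    (\<forall>b. \<exists>c F. c \<noteq> 0 \<and> (\<forall>i. coeff F i \<in> invariants \<delta>) \<and> const2 c * b = poly F s)"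
proof -
  obtain s0 where "local_slice s0" using ex_local_slice[OF nt] by blast
  then obtain s where s: "local_slice s"
    and s_min: "\<And>s'. local_slice s' \<Longrightarrow> tdeg (lead_coeff (\<delta> s)) \<le> tdeg (lead_coeff (\<delta> s'))"
    using ex_has_least_nat[of local_slice s0 "\<lambda>s. tdeg (lead_coeff (\<delta> s))"] by blast
  let ?g = "lead_coeff (\<delta> s)"
  have s_inv: "s \<notin> invariants \<delta>" using s by (simp add: local_slice_def)
  have d: "degree (\<delta> s) > 0" using s_inv by (simp add: inv_iff)
  have g0: "?g \<noteq> 0" using d by (auto simp: rhom_0[OF hom])
  have "\<exists>c F. c \<noteq> 0 \<and> (\<forall>i. coeff F i \<in> invariants \<delta>) \<and> const2 c * b = poly F s" for b
  proof -
    \<comment> \<open>\<open>C\<close> ranges over the denominators of \<open>b\<close> that are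
      polynomials in \<open>P\<close>. One of least degree is taken; degree 0 means that it lies in
      the base ring.\<close>
    define good where "good C \<longleftrightarrow> C \<noteq> 0 \<and> (\<exists>F. ev1 const2 P C * b = ev2 const2 P s F)" for C
    obtain m F0 where F0: "\<forall>i. coeff F0 i \<in> invariants \<delta>" "?g ^ m * b = poly F0 s"
      using local_slice_generates[OF s, of b] by blast
    have pre: "\<exists>G. map_poly (ev1 const2 P) G = F" if "\<forall>i. coeff F i \<in> invariants \<delta>" for F
      using that gen by (intro ex_map_poly_preimage) (auto simp: rhom_0[OF rhom_ev1])
    have "?g ^ m \<in> range (ev1 const2 P)" using gen lead_coeff_inv[of s] inv_power by blast
    then obtain C0 where C0: "?g ^ m = ev1 const2 P C0" by blast
    have "C0 \<noteq> 0" using g0 C0 by (auto simp: rhom_0[OF rhom_ev1])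
    moreover obtain G0 where "map_poly (ev1 const2 P) G0 = F0" using pre F0(1) by blast
    ultimately have "good C0" using F0(2) C0 unfolding good_def ev1_def[of "ev1 const2 P"] by metis
    then obtain C where C: "good C" and C_min: "\<And>C'. good C' \<Longrightarrow> degree C \<le> degree C'"
      using ex_has_least_nat[of good C0 degree] by blast
    obtain F where F: "ev1 const2 P C * b = ev2 const2 P s F" using C by (auto simp: good_def)
    have C0': "C \<noteq> 0" using C by (simp add: good_def)
    have "degree C = 0"
    proof (rule ccontr)
      assume "degree C \<noteq> 0"
      let ?\<iota> = "map_poly2 j" and ?\<kappa> = "map_poly2 to_fract :: 'r poly poly \<Rightarrow> _"
      let ?P = "?\<iota> P" and ?s = "?\<iota> s"
      let ?C = "map_poly j C"
      have rj: "rhom j" and rt: "rhom (to_fract :: 'r \<Rightarrow> _)" by simp_all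
      note ri = rhom_map_poly[OF rhom_map_poly[OF rj]]
      note rk = rhom_map_poly[OF rhom_map_poly[OF rt]]
      have dC: "degree ?C = degree C" by (rule degree_map_poly) simp
      then obtain \<theta> where \<theta>: "poly ?C \<theta> = 0"
        using alg_closed_imp_poly_has_root[of ?C] \<open>degree C \<noteq> 0\<close> by auto
      then obtain q where q: "?C = [:- \<theta>, 1:] * q" by (auto simp: poly_eq_0_iff_dvd elim: dvdE)
      have C1: "?C \<noteq> 0" using \<open>degree C \<noteq> 0\<close> dC by (metis degree_0)
      then have q0: "q \<noteq> 0" using q by auto
      have dq: "degree C = Suc (degree q)" "lead_coeff q = j (lead_coeff C)"
      proof -
        have "degree ?C = degree [:- \<theta>, 1:] + degree q" unfolding q by (rule degree_mult_eq) (use q0 in auto)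
        then show "degree C = Suc (degree q)" using dC by simp
        have "lead_coeff ?C = lead_coeff q" unfolding q by (simp only: lead_coeff_mult) simp
        then show "lead_coeff q = j (lead_coeff C)" using dC by (simp add: coeff_map_poly)
      qed
      let ?Q = "?P - const2 \<theta>"
      have iev1: "?\<iota> (ev1 const2 P p) = ev1 const2 ?P (map_poly j p)" for p
        unfolding rhom_ev1_comp[OF ri rhom_const2] ev1_map_poly[OF rhom_const2 rj] by simp
      have kev1: "?\<kappa> (ev1 const2 P p) = ev1 const2 (?\<kappa> P) (map_poly to_fract p)" for p
        unfolding rhom_ev1_comp[OF rk rhom_const2] ev1_map_poly[OF rhom_const2 rt] by simp
      have iev2: "?\<iota> (ev2 const2 P s p) = ev2 const2 ?P ?s (map_poly2 j p)" for p
        unfolding rhom_ev1_comp[OF ri rhom_ev1[OF rhom_const2]]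
          ev1_map_poly[OF rhom_ev1[OF rhom_const2] rhom_map_poly[OF rj]] iev1 ..
      have kev2: "?\<kappa> (ev2 const2 P s p) = ev2 const2 (?\<kappa> P) (?\<kappa> s) (map_poly2 to_fract p)" for p
        unfolding rhom_ev1_comp[OF rk rhom_ev1[OF rhom_const2]]
          ev1_map_poly[OF rhom_ev1[OF rhom_const2] rhom_map_poly[OF rt]] kev1 ..
      have evQ: "ev1 const2 ?P [:- \<theta>, 1:] = ?Q"
        by (simp add: ev1_pCons rhom_simps[OF rhom_const2] rhom_0[OF rhom_ev1])
      have evC: "?\<iota> (ev1 const2 P C) = ?Q * ev1 const2 ?P q"
        by (simp only: iev1 q rhom_mult[OF rhom_ev1[OF rhom_const2]] evQ)
      have Q: "prime_elem ?Q" by (rule prime_fibre)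
      then have Q0: "?Q \<noteq> 0" by (rule prime_elem_not_zeroI)
      define F' where "F' = map_poly2 j F"
      have eF: "?Q * (ev1 const2 ?P q * ?\<iota> b) = ev2 const2 ?P ?s F'"
        using arg_cong[OF F, of ?\<iota>] by (simp only: rhom_mult[OF ri] evC iev2 F'_def mult.assoc)
      define \<Phi> where "\<Phi> = map_poly (\<lambda>p. poly p \<theta>) F'"
      \<comment> \<open>The leading coefficient of \<open>q\<close> is that of \<open>C\<close> and
        so comes from the base; with \<open>\<tau> 1 = 1\<close> the functional cannot annihilate
        \<open>q\<close>.\<close>
      obtain \<tau> where \<tau>: "semilin j to_fract \<tau>" "\<tau> 1 = 1"
        by (rule ex_functional_semilin[OF one_neq_zero])
      note \<tau>0 = semilin_0[OF \<tau>(1)]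
      note \<tau>1 = semilin_map_poly[OF \<tau>(1) rj rt]
      note \<tau>2 = semilin_map_poly[OF \<tau>1 rhom_map_poly[OF rj] rhom_map_poly[OF rt]]
      have t0: "map_poly2 \<tau> (const2 a * ?\<iota> f) = const2 (\<tau> a) * ?\<kappa> f" for a f
        using semilin_mult[OF \<tau>2, of f "const2 a"] \<tau>0 by (simp add: mult.commute)
      have t1: "map_poly2 \<tau> (ev1 const2 ?P p * ?\<iota> f) = ev1 const2 (?\<kappa> P) (map_poly \<tau> p) * ?\<kappa> f" for p f
        using ev1_semilin[OF \<tau>2 \<tau>0 rhom_const2 rhom_const2 ri t0] .
      have t2: "map_poly2 \<tau> (ev2 const2 ?P ?s p * ?\<iota> f) =
          ev2 const2 (?\<kappa> P) (?\<kappa> s) (map_poly2 \<tau> p) * ?\<kappa> f" for p f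
        using ev1_semilin[OF \<tau>2 semilin_0[OF \<tau>1] rhom_ev1[OF rhom_const2] rhom_ev1[OF rhom_const2] ri t1] .
      have \<tau>q: "coeff (map_poly \<tau> q) (degree q) \<noteq> 0"
        using semilin_mult[OF \<tau>(1), of "lead_coeff C" 1] \<tau>(2) dq(2) C0' by (simp add: coeff_map_poly \<tau>0)
      have sm: "ev1 const2 u (smult c p) = const2 c * ev1 const2 u p" for u p and c :: "'r fract"
        using rhom_mult[OF rhom_ev1[OF rhom_const2], of u "[:c:]" p] by simp
      have sm2: "ev2 const2 u v (const2 c * p) = const2 c * ev2 const2 u v p" for u v p and c :: "'r fract"
        by (simp only: rhom_mult[OF rhom_ev1[OF rhom_ev1[OF rhom_const2]]] ev2_const2[OF rhom_const2])
      show False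
      proof (cases "\<Phi> = 0")
        case True
        \<comment> \<open>Every coefficient vanishes at \<open>P = \<theta>\<close>, so
          \<open>P - \<theta>\<close> cancels. After \<open>\<tau>\<close> and clearing denominators
          this produces a denominator of smaller degree than \<open>C\<close>.\<close>
        have "[:- \<theta>, 1:] dvd coeff F' i" for i
          using True coeff_map_poly[of "\<lambda>p. poly p \<theta>" F' i] by (simp add: \<Phi>_def poly_eq_0_iff_dvd)
        then have "[:[:- \<theta>, 1:]:] dvd F'" by (simp add: const_poly_dvd_iff)
        then obtain F1 where F1: "F' = [:[:- \<theta>, 1:]:] * F1" by (rule dvdE)
        have "ev2 const2 ?P ?s F' = ?Q * ev2 const2 ?P ?s F1"
          by (simp only: F1 rhom_mult[OF rhom_ev1[OF rhom_ev1[OF rhom_const2]]] ev1_const[OF rhom_ev1[OF rhom_const2]] evQ)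
        then have "ev1 const2 ?P q * ?\<iota> b = ev2 const2 ?P ?s F1 * ?\<iota> 1"
          using eF by (simp only: mult_left_cancel[OF Q0] rhom_1[OF ri] mult_1_right)
        then have e: "ev1 const2 (?\<kappa> P) (map_poly \<tau> q) * ?\<kappa> b = ev2 const2 (?\<kappa> P) (?\<kappa> s) (map_poly2 \<tau> F1)"
          using t1[of q b] t2[of F1 1] by (simp only: rhom_1[OF rk] mult_1_right)
        obtain r1 q' where q': "r1 \<noteq> 0" "map_poly to_fract q' = smult (to_fract r1) (map_poly \<tau> q)"
          using clear_denominators by blast
        obtain r2 F2 where F2: "r2 \<noteq> 0" "map_poly2 to_fract F2 = const2 (to_fract r2) * map_poly2 \<tau> F1"
          using clear_denominators2 by blast
        have "?\<kappa> (ev1 const2 P (smult r2 q') * b) =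
            const2 (to_fract r1) * const2 (to_fract r2) * (ev1 const2 (?\<kappa> P) (map_poly \<tau> q) * ?\<kappa> b)"
          by (simp add: rhom_mult[OF rk] kev1 map_poly_smult q'(2) sm rhom_mult[OF rhom_const2] mult_ac)
        also have "\<dots> = ?\<kappa> (ev2 const2 P s (const2 r1 * F2))"
          unfolding e by (simp add: kev2 rhom_mult[OF rk] F2(2) sm2 mult_ac)
        finally have "?\<kappa> (ev1 const2 P (smult r2 q') * b) = ?\<kappa> (ev2 const2 P s (const2 r1 * F2))" .
        then have e: "ev1 const2 P (smult r2 q') * b = ev2 const2 P s (const2 r1 * F2)"
          using inj_map_poly2_to_fract by (auto dest: injD)
        have "coeff (map_poly to_fract q') (degree q) \<noteq> 0" using \<tau>q q' by simp
        then have "q' \<noteq> 0" by auto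
        then have "good (smult r2 q')" unfolding good_def using e F2(1) by auto
        from C_min[OF this] have "degree C \<le> degree q'" using F2(1) by simp
        also have "\<dots> = degree (map_poly to_fract q')" by (rule degree_map_poly[symmetric]) simp
        also have "\<dots> \<le> degree q" using q' map_poly_degree_leq[of \<tau> q] by simp
        finally show False using dq by simp
      next
        case False
        have "?Q dvd ev1 const2 ?s \<Phi>"
          using ev2_dvd_diff_eval[of ?P \<theta> ?s F'] dvd_triv_left[of ?Q "ev1 const2 ?P q * ?\<iota> b"]
          unfolding eF \<Phi>_def by (metis dvd_diff_right_iff dvd_diff_commute)
        then obtain \<mu> where "?Q dvd ?s - const2 \<mu>" using prime_dvd_ev1_split[OF Q False] by blast
        then obtain s1 where s1: "?s - const2 \<mu> = ?Q * s1" by (rule dvdE)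
        \<comment> \<open>Multiplication by \<open>q(P)\<close> turns the factor
          \<open>P - \<theta>\<close> into \<open>C(P)\<close>, which is defined over the base. Only
          in this form can the functional be pulled past it.\<close>
        have "ev1 const2 ?P q * ?\<iota> s - ev1 const2 ?P (smult \<mu> q) * ?\<iota> 1 = ?\<iota> (ev1 const2 P C) * s1"
        proof -
          have "ev1 const2 ?P (smult \<mu> q) = const2 \<mu> * ev1 const2 ?P q"
            using rhom_mult[OF rhom_ev1[OF rhom_const2], of ?P "[:\<mu>:]" q] by simp
          then have "ev1 const2 ?P q * ?\<iota> s - ev1 const2 ?P (smult \<mu> q) * ?\<iota> 1 = ev1 const2 ?P q * (?s - const2 \<mu>)"
            by (simp only: rhom_1[OF ri]) (simp add: algebra_simps)
          then show ?thesis by (simp only: s1 evC mult_ac)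
        qed
        from arg_cong[OF this, of "map_poly2 \<tau>"]
        have e: "ev1 const2 (?\<kappa> P) (map_poly \<tau> q) * ?\<kappa> s - ev1 const2 (?\<kappa> P) (map_poly \<tau> (smult \<mu> q)) =
            ?\<kappa> (ev1 const2 P C) * map_poly2 \<tau> s1"
          by (simp only: semilin_diff[OF \<tau>2] t1 semilin_mult[OF \<tau>2] rhom_1[OF rk] mult_1_right)
        obtain r1 q' where q': "r1 \<noteq> 0" "map_poly to_fract q' = smult (to_fract r1) (map_poly \<tau> q)"
          using clear_denominators by blast
        obtain r2 a' where a': "r2 \<noteq> 0" "map_poly to_fract a' = smult (to_fract r2) (map_poly \<tau> (smult \<mu> q))"
          using clear_denominators by blast
        obtain r3 s2 where s2: "r3 \<noteq> 0" "?\<kappa> s2 = const2 (to_fract r3) * map_poly2 \<tau> s1"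
          using clear_denominators2 by blast
        define q2 where "q2 = smult (r2 * r3) q'"
        define a2 where "a2 = smult (r1 * r3) a'"
        define s3 where "s3 = const2 (r1 * r2) * s2"
        have "?\<kappa> (ev1 const2 P q2 * s - ev1 const2 P a2) = ?\<kappa> (ev1 const2 P C * s3)"
          using arg_cong[OF e, of "\<lambda>x. const2 (to_fract (r1 * r2 * r3)) * x"]
          by (simp add: q2_def a2_def s3_def rhom_mult[OF rk] rhom_diff[OF rk] kev1 map_poly_smult q'(2) a'(2) s2(2)
              sm rhom_mult[OF rhom_const2] algebra_simps)
        then have e2: "ev1 const2 P q2 * s - ev1 const2 P a2 = ev1 const2 P C * s3"
          using inj_map_poly2_to_fract by (auto dest: injD)
        have "coeff (map_poly to_fract q') (degree q) \<noteq> 0" using \<tau>q q' by simp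
        then have "q' \<noteq> 0" by auto
        then have q20: "q2 \<noteq> 0" using a'(1) s2(1) by (simp add: q2_def)
        have "degree q2 = degree (map_poly to_fract q')"
          using a'(1) s2(1) degree_map_poly[of to_fract q'] by (simp add: q2_def)
        also have "\<dots> \<le> degree q" using q' map_poly_degree_leq[of \<tau> q] by simp
        finally have dq2: "degree q2 < degree C" using dq by simp
        have inv: "ev1 const2 P p \<in> invariants \<delta>" for p using gen by blast
        have nz: "ev1 const2 P C \<noteq> 0" "ev1 const2 P q2 \<noteq> 0"
          using ev1_const2_eq_0[OF P(2)] C0' q20 by blast+
        have e3: "smult (ev1 const2 P q2) (\<delta> s) - [:ev1 const2 P a2:] = smult (ev1 const2 P C) (\<delta> s3)"
          using arg_cong[OF e2, of \<delta>] by (simp add: rhom_diff[OF hom] rhom_mult[OF hom] invD[OF inv])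
        have ds: "degree (\<delta> s3) = degree (\<delta> s)"
        proof -
          have "degree (\<delta> s3) = degree (smult (ev1 const2 P q2) (\<delta> s) - [:ev1 const2 P a2:])"
            using nz by (simp add: e3)
          also have "\<dots> = degree (smult (ev1 const2 P q2) (\<delta> s))"
            using nz d by (intro degree_diff_eq_left) simp
          finally show ?thesis using nz by simp
        qed
        have "local_slice s3"
          using s d ds by (simp add: local_slice_def inv_iff)
        note m = s_min[OF this]
        \<comment> \<open>The constant correction does not reach the top coefficient in
          \<open>t\<close>. As \<open>q2\<close> has smaller degree than \<open>C\<close>, the
          leading coefficient for \<open>s3\<close> must have smaller total degree than the one for
          \<open>s\<close>.\<close>
        have "ev1 const2 P q2 * ?g = ev1 const2 P C * lead_coeff (\<delta> s3)"
          using arg_cong[OF e3, of "\<lambda>p. coeff p (degree (\<delta> s))"] d ds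
          by (simp add: coeff_pCons split: nat.splits)
        moreover have "lead_coeff (\<delta> s3) \<noteq> 0" using d ds by (metis degree_0 leading_coeff_0_iff less_irrefl)
        ultimately have "degree q2 * tdeg P + tdeg ?g = degree C * tdeg P + tdeg (lead_coeff (\<delta> s3))"
          using tdeg_mult[OF nz(2) g0] tdeg_mult[OF nz(1), of "lead_coeff (\<delta> s3)"] C0' q20
          by (simp add: tdeg_ev1)
        moreover have "degree q2 * tdeg P < degree C * tdeg P" using dq2 P(2) by simp
        ultimately show False using m by linarith
      qed
    qed
    then obtain c where c: "C = [:c:]" by (rule degree_eq_zeroE)
    have "c \<noteq> 0" using C0' c by auto
    moreover have "const2 c * b = poly (map_poly (ev1 const2 P) F) s"
      using F c by (simp add: ev1_def[of "ev1 const2 P"])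
    moreover have "coeff (map_poly (ev1 const2 P) F) i \<in> invariants \<delta>" for i
      using gen by (simp add: coeff_map_poly rhom_0[OF rhom_ev1])
    ultimately show ?thesis by blast
  qed
  then show ?thesis using s_inv by blast
qed

end

section \<open>Two invariant variables\<close>

abbreviation varX :: "'a::comm_ring_1 poly3" where "varX \<equiv> [:[:[:0, 1:]:]:]"

text \<open>Identifies the subring \<open>K[x]\<close> with the base ring of the two-variable
  view.\<close>

lemma ev1_const3_varX: "ev1 const3 varX = const2"
  by (rule rhom_ext_poly) (simp_all add: rhom_ev1 const3_def const2_def)

lemma const2_dvd_iff:
  fixes r :: "'a::idom"
  shows "const2 r dvd b \<longleftrightarrow> (\<forall>i k. r dvd coeff (coeff b i) k)"
  unfolding const2_def const_poly_dvd_iff ..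

text \<open>Evaluation at a root of \<open>r\<close> in the algebraic closure. A Bezout identity
  shows that its kernel is generated by \<open>r\<close> and that nonzero values have inverses in
  the image, so the image is the residue field \<open>k[x]/(r)\<close>.\<close>

lemma residue_map:
  fixes r :: "'k::field_gcd poly"
  assumes r: "prime_elem r"
  obtains e :: "'k poly \<Rightarrow> 'k alg_closure"
  where "rhom e" "\<And>p. e p = 0 \<longleftrightarrow> r dvd p" "\<And>p. e p \<noteq> 0 \<Longrightarrow> \<exists>u. e u * e p = 1"
proof -
  have r0: "r \<noteq> 0" "\<not> is_unit r" using r by (auto simp: prime_elem_def)
  then have "degree r > 0" by (simp add: is_unit_iff_degree)
  moreover have "degree (map_poly to_ac r) = degree r" by (rule degree_map_poly) simp
  ultimately obtain \<alpha> where \<alpha>: "poly (map_poly to_ac r) \<alpha> = 0"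
    using alg_closed_imp_poly_has_root[of "map_poly to_ac r"] by auto
  define e where "e = ev1 to_ac \<alpha>"
  have e: "rhom e" unfolding e_def by (rule rhom_ev1) simp
  have er: "e r = 0" using \<alpha> by (simp add: e_def ev1_def)
  have bez: "\<exists>u. e u * e p = 1" if "\<not> r dvd p" for p
  proof -
    have "coprime r p" using prime_elem_imp_coprime[OF r that] .
    then have "fst (bezout_coefficients r p) * r + snd (bezout_coefficients r p) * p = 1"
      by (simp add: bezout_coefficients_fst_snd coprime_iff_gcd_eq_1)
    from arg_cong[OF this, of e] have "e (snd (bezout_coefficients r p)) * e p = 1"
      by (simp add: rhom_add[OF e] rhom_mult[OF e] rhom_1[OF e] er)
    then show ?thesis by blast
  qed
  have dvd: "e p = 0" if "r dvd p" for p
    using that er by (auto simp: rhom_mult[OF e] elim!: dvdE)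
  have iff: "e p = 0 \<longleftrightarrow> r dvd p" for p
    using dvd[of p] bez[of p] by fastforce
  show ?thesis
    by (rule that[OF e]) (use iff bez in blast)+
qed

lemma map_poly2_eq_0_iff_dvd:
  fixes r :: "'a::idom"
  assumes "rhom e" "\<And>p. e p = 0 \<longleftrightarrow> r dvd p"
  shows "map_poly2 e b = 0 \<longleftrightarrow> const2 r dvd b"
proof -
  have "map_poly e 0 = 0" by simp
  then have "map_poly2 e b = 0 \<longleftrightarrow> (\<forall>i k. e (coeff (coeff b i) k) = 0)"
    using rhom_0[OF assms(1)] by (simp add: poly_eq_iff coeff_map_poly)
  then show ?thesis using assms(2) by (simp add: const2_dvd_iff)
qed

lemma ev1_map_hom2:
  assumes "rhom e"
  shows "map_poly2 e (ev1 const2 u p) = ev1 const2 (map_poly2 e u) (map_poly e p)"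
  using rhom_ev1_comp[OF rhom_map_poly[OF rhom_map_poly[OF assms]] rhom_const2, of u p]
    ev1_map_poly[OF rhom_const2 assms] rhom_0[OF assms] by simp

text \<open>Long division of \<open>D\<close> by \<open>C\<close> over the residue field. The total
  degree shows \<open>deg C \<le> deg D\<close> at each stage, because the quotient \<open>s\<close>
  is a polynomial, and the leading coefficient of \<open>C\<close> has an inverse that lifts to the
  base.\<close>

lemma residue_division:
  fixes P :: "'k::field_gcd poly poly poly"
  assumes r: "prime_elem r" and e: "rhom e" "\<And>p. e p = 0 \<longleftrightarrow> r dvd p"
      "\<And>p. e p \<noteq> (0::'e::idom) \<Longrightarrow> \<exists>u. e u * e p = 1"
    and P: "tdeg (map_poly2 e P) > 0" and C: "map_poly e C \<noteq> 0"
    and eq: "map_poly2 e (ev1 const2 P C * s) = map_poly2 e (ev1 const2 P D)"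
  shows "\<exists>a. map_poly2 e s = map_poly2 e (ev1 const2 P a)"
proof -
  note e0 = rhom_0[OF e(1)]
  note he = rhom_map_poly[OF e(1)]
  note h = rhom_map_poly[OF he]
  let ?P = "map_poly2 e P" and ?C = "map_poly e C"
  have ev0: "ev1 const2 ?P F \<noteq> 0" if "F \<noteq> 0" for F
    using ev1_const2_eq_0[OF P] that by blast
  define m where "m = degree ?C"
  have "coeff ?C m \<noteq> 0" using C unfolding m_def by (simp only: leading_coeff_0_iff not_False_eq_True)
  then have "e (coeff C m) \<noteq> 0" by (simp add: coeff_map_poly e0)
  then obtain u where u: "e u * e (coeff C m) = 1" using e(3) by blast
  show ?thesis
    using eq
  \<comment> \<open>The zero remainder must count as smaller than a nonzero constant, although both
    have degree 0.\<close>
  proof (induction "if map_poly e D = 0 then 0 else Suc (degree (map_poly e D))" arbitrary: D s rule: less_induct)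
    case less
    let ?D = "map_poly e D"
    have eq: "ev1 const2 ?P ?C * map_poly2 e s = ev1 const2 ?P ?D"
      using less.prems by (simp only: rhom_mult[OF h] ev1_map_hom2[OF e(1)])
    show ?case
    proof (cases "?D = 0")
      case True
      then have "map_poly2 e s = 0" using eq ev0[OF C] by (simp add: rhom_0[OF rhom_ev1])
      then show ?thesis by (intro exI[of _ 0]) (simp add: rhom_0[OF rhom_ev1])
    next
      case False
      define n where "n = degree ?D"
      have s0: "map_poly2 e s \<noteq> 0" using eq ev0[OF False] by auto
      have "m * tdeg ?P + tdeg (map_poly2 e s) = n * tdeg ?P"
        using arg_cong[OF eq, of tdeg] tdeg_mult[OF ev0[OF C] s0] tdeg_ev1[OF C, of ?P] tdeg_ev1[OF False, of ?P]
        by (simp add: m_def n_def)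
      then have "m * tdeg ?P \<le> n * tdeg ?P" by linarith
      then have mn: "m \<le> n" using P by simp
      define q where "q = monom (u * coeff D n) (n - m)"
      define D1 where "D1 = D - C * q"
      have D1: "map_poly e D1 = ?D - ?C * monom (e u * e (coeff D n)) (n - m)"
        by (simp add: D1_def q_def rhom_diff[OF he] rhom_mult[OF he] map_poly_monom e0 rhom_mult[OF e(1)])
      have "degree (map_poly e D1) \<le> n"
        unfolding D1
      proof (rule degree_diff_le)
        show "degree (?C * monom (e u * e (coeff D n)) (n - m)) \<le> n"
          using degree_mult_le[of ?C "monom (e u * e (coeff D n)) (n - m)"]
            degree_monom_le[of "e u * e (coeff D n)" "n - m"] mn by (simp add: m_def)
      qed (simp add: n_def)
      moreover have "coeff (map_poly e D1) n = 0"
      proof -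
        have "coeff (?C * monom (e u * e (coeff D n)) (n - m)) n = e u * e (coeff D n) * e (coeff C m)"
          using mn e0 by (simp add: mult.commute[of ?C] coeff_monom_mult coeff_map_poly)
        also have "\<dots> = e (coeff D n)" using u by (metis mult.commute mult.left_commute mult_1)
        finally show ?thesis using e0 by (simp add: D1 coeff_map_poly)
      qed
      ultimately have "map_poly e D1 = 0 \<or> degree (map_poly e D1) < n"
        by (metis le_neq_implies_less leading_coeff_0_iff)
      then have "(if map_poly e D1 = 0 then 0 else Suc (degree (map_poly e D1))) <
          (if ?D = 0 then 0 else Suc (degree ?D))"
        using False by (auto simp: n_def)
      moreover have "map_poly2 e (ev1 const2 P C * (s - ev1 const2 P q)) = map_poly2 e (ev1 const2 P D1)"
        using less.prems
        by (simp add: D1_def right_diff_distrib rhom_diff[OF h] rhom_diff[OF rhom_ev1[OF rhom_const2]]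
            rhom_mult[OF rhom_ev1[OF rhom_const2]])
      ultimately obtain a where "map_poly2 e (s - ev1 const2 P q) = map_poly2 e (ev1 const2 P a)"
        using less.hyps by blast
      then have "map_poly2 e s = map_poly2 e (ev1 const2 P (a + q))"
        by (simp add: rhom_diff[OF h] rhom_add[OF h] rhom_add[OF rhom_ev1] algebra_simps)
      then show ?thesis by blast
    qed
  qed
qed

context expmap
begin

lemma inv_pcompose:
  assumes "\<And>i. coeff F i \<in> invariants \<delta>" "\<And>i. coeff G i \<in> invariants \<delta>"
  shows "coeff (pcompose F G) i \<in> invariants \<delta>"
  using assms(1)
proof (induction F arbitrary: i)
  case 0
  then show ?case by (simp add: inv_0)
next
  case (pCons a F)
  have F: "coeff F i \<in> invariants \<delta>" for i using pCons.prems[of "Suc i"] by simp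
  have a: "a \<in> invariants \<delta>" using pCons.prems[of 0] by simp
  have "coeff (G * pcompose F G) i \<in> invariants \<delta>"
    using assms(2) pCons.IH[OF F] by (intro inv_poly_mult)
  then show ?case using a by (cases i) (simp_all add: pcompose_pCons inv_add inv_0)
qed

end

text \<open>
  A prime \<open>r\<close> of the base ring is removed from the denominators of the slice \<open>s\<close> by comparing with a second
  slice \<open>s'\<close> whose denominators \<open>D\<close> are prime to \<open>r\<close>: modulo \<open>r\<close> the element \<open>s\<close> is algebraic over the
  invariants, while \<open>s'\<close> remains transcendental.
\<close>

lemma slice_congruent_invariant:
  fixes \<delta> :: "'k::field_gcd poly poly poly \<Rightarrow> 'k poly poly poly poly"
  assumes \<delta>: "\<delta> \<in> EXP const2"
    and P: "tdeg P > 0" "invariants \<delta> = range (ev1 const2 P)"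
    and s': "s' \<notin> invariants \<delta>"
    and D: "D \<subseteq> invariants \<delta>" "\<And>b. \<exists>c\<in>D. \<exists>F. (\<forall>i. coeff F i \<in> invariants \<delta>) \<and> c * b = poly F s'"
    and r: "prime_elem r" "\<And>c. c \<in> D \<Longrightarrow> \<not> const2 r dvd c"
    and F: "\<And>i. coeff F i \<in> invariants \<delta>" "\<not> const2 r dvd coeff F i0" "const2 r dvd poly F s"
  shows "\<exists>a\<in>invariants \<delta>. const2 r dvd s - a"
proof -
  interpret expmap \<delta> using \<delta> by (simp add: EXP_iff)
  have c2: "const2 a \<in> invariants \<delta>" for a using \<delta> by (simp add: EXP_iff invariants_def)
  obtain e :: "'k poly \<Rightarrow> 'k alg_closure" where e: "rhom e" "\<And>p. e p = 0 \<longleftrightarrow> r dvd p"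
    "\<And>p. e p \<noteq> 0 \<Longrightarrow> \<exists>u. e u * e p = 1"
    using residue_map[OF r(1)] by blast
  define \<pi> where "\<pi> = map_poly2 e"
  have \<pi>: "rhom \<pi>" unfolding \<pi>_def by (intro rhom_map_poly e)
  note \<pi>0 = rhom_0[OF \<pi>]
  have \<pi>dvd: "\<pi> b = 0 \<longleftrightarrow> const2 r dvd b" for b
    unfolding \<pi>_def by (rule map_poly2_eq_0_iff_dvd[OF e(1,2)])
  have r0: "r \<noteq> 0" "\<not> is_unit r" using r(1) by (auto simp: prime_elem_def)
  obtain b' where b': "poly F s = const2 r * b'" using F(3) by (rule dvdE)
  obtain c H where c: "c \<in> D" and H: "\<And>i. coeff H i \<in> invariants \<delta>" "c * s = poly H s'"
    using D(2)[of s] by blast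
  obtain c2' H2 where c2': "c2' \<in> D" and H2: "\<And>i. coeff H2 i \<in> invariants \<delta>" "c2' * b' = poly H2 s'"
    using D(2)[of b'] by blast
  have cinv: "c \<in> invariants \<delta>" "c2' \<in> invariants \<delta>" using c c2' D(1) by auto
  define N where "N = degree F"
  \<comment> \<open>Homogenising by \<open>c\<close> gives \<open>F1(c s) = c^N F(s)\<close>, so
    \<open>H(s')\<close> can be substituted for \<open>c s\<close> without division.\<close>
  define F1 where "F1 = (\<Sum>i\<le>N. monom (coeff F i * c ^ (N - i)) i)"
  have F1c: "coeff F1 i = (if i \<le> N then coeff F i * c ^ (N - i) else 0)" for i
    by (simp add: F1_def coeff_sum)
  have F1inv: "coeff F1 i \<in> invariants \<delta>" for i
    using F(1) cinv by (simp add: F1c inv_mult inv_power inv_0)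
  define G where "G = pcompose F1 H"
  have Ginv: "coeff G i \<in> invariants \<delta>" for i
    unfolding G_def using F1inv H(1) by (rule inv_pcompose)
  have "poly G s' = poly F1 (c * s)" by (simp add: G_def poly_pcompose H(2))
  also have "\<dots> = (\<Sum>i\<le>N. c ^ N * (coeff F i * s ^ i))"
    unfolding F1_def poly_sum poly_monom
  proof (rule sum.cong[OF refl])
    fix i assume "i \<in> {..N}"
    then have "c ^ (N - i) * c ^ i = c ^ N" by (simp flip: power_add)
    then show "coeff F i * c ^ (N - i) * (c * s) ^ i = c ^ N * (coeff F i * s ^ i)"
      by (simp add: power_mult_distrib mult_ac)
  qed
  also have "\<dots> = c ^ N * poly F s"
    by (simp add: poly_altdef N_def sum_distrib_left)
  finally have G: "poly G s' = c ^ N * (const2 r * b')" by (simp add: b')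
  \<comment> \<open>Both polynomials take the same value at \<open>s'\<close>, which is
    transcendental over the invariants. Their equality modulo \<open>r\<close> gives that
    \<open>r\<close> divides \<open>G\<close>, since it does not divide \<open>c2'\<close>.\<close>
  have "smult c2' G - smult (c ^ N * const2 r) H2 = 0"
  proof (rule invariant_poly_root[OF s'])
    show "coeff (smult c2' G - smult (c ^ N * const2 r) H2) i \<in> invariants \<delta>" for i
      using Ginv H2(1) cinv c2 by (simp add: inv_diff inv_mult inv_power)
    show "poly (smult c2' G - smult (c ^ N * const2 r) H2) s' = 0"
      by (simp add: G H2(2)[symmetric] mult_ac)
  qed
  then have "map_poly \<pi> (smult c2' G) = map_poly \<pi> (smult (c ^ N * const2 r) H2)" by simp
  moreover have "\<pi> (const2 r) = 0" using \<pi>dvd by simp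
  moreover have "\<pi> c2' \<noteq> 0" "\<pi> c \<noteq> 0" using r(2) c c2' \<pi>dvd by auto
  ultimately have "map_poly \<pi> G = 0"
    by (simp add: map_poly_smult \<pi>0 rhom_mult[OF \<pi>])
  moreover have "map_poly \<pi> G = pcompose (map_poly \<pi> F1) (map_poly \<pi> H)"
    unfolding G_def by (induction F1)
      (simp_all add: pcompose_pCons map_poly_pCons \<pi>0 rhom_add[OF rhom_map_poly[OF \<pi>]] rhom_mult[OF rhom_map_poly[OF \<pi>]])
  ultimately have pc: "pcompose (map_poly \<pi> F1) (map_poly \<pi> H) = 0" by simp
  have "coeff F i0 \<noteq> 0" using F(2) by auto
  then have "i0 \<le> N" unfolding N_def by (rule le_degree)
  then have "coeff (map_poly \<pi> F1) i0 \<noteq> 0"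
    using F(2) \<open>\<pi> c \<noteq> 0\<close> by (simp add: coeff_map_poly \<pi>0 F1c rhom_mult[OF \<pi>] rhom_power[OF \<pi>] \<pi>dvd)
  then have "map_poly \<pi> F1 \<noteq> 0" by auto
  \<comment> \<open>Modulo \<open>r\<close> the polynomial \<open>F1\<close> is nonzero while its
    composite with \<open>H\<close> vanishes, so \<open>H\<close> is constant there:
    \<open>c s\<close> is congruent to the invariant \<open>a\<close>.\<close>
  then have dH: "degree (map_poly \<pi> H) = 0" using pcompose_eq_0[OF pc] by blast
  obtain a H' where aH: "H = pCons a H'" by (cases H)
  have "const2 r dvd coeff H' i" for i
  proof -
    have "coeff (map_poly \<pi> H) (Suc i) = 0" using dH by (simp add: coeff_eq_0)
    then show ?thesis by (simp add: coeff_map_poly \<pi>0 aH \<pi>dvd)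
  qed
  then have "[:const2 r:] dvd H'" by (simp add: const_poly_dvd_iff)
  then obtain H'' where "H' = [:const2 r:] * H''" by (rule dvdE)
  then have cs: "c * s = a + const2 r * (s' * poly H'' s')" using H(2) by (simp add: aH algebra_simps)
  have "a \<in> invariants \<delta>" using H(1)[of 0] by (simp add: aH)
  then obtain A C where AC: "a = ev1 const2 P A" "c = ev1 const2 P C" using cinv P(2) by blast
  have "\<pi> (ev1 const2 P C * s) = \<pi> (ev1 const2 P A)"
    using arg_cong[OF cs, of \<pi>] \<open>\<pi> (const2 r) = 0\<close>
    by (simp only: AC rhom_add[OF \<pi>] rhom_mult[OF \<pi>] mult_zero_left add_0_right)
  then have "map_poly2 e (ev1 const2 P C * s) = map_poly2 e (ev1 const2 P A)"
    unfolding \<pi>_def .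
  moreover have "map_poly e C \<noteq> 0"
    using \<open>\<pi> c \<noteq> 0\<close> by (auto simp: AC \<pi>_def ev1_map_hom2[OF e(1)] rhom_0[OF rhom_ev1])
  \<comment> \<open>Otherwise \<open>P\<close> minus a constant is divisible by \<open>r\<close>.
    The quotient is invariant, hence a polynomial \<open>V(P)\<close>, and comparing the
    coefficients of \<open>P\<close> makes \<open>r\<close> a unit.\<close>
  moreover have "tdeg (\<pi> P) > 0"
  proof (rule ccontr)
    assume "\<not> tdeg (\<pi> P) > 0"
    then have "\<pi> P = const2 (at0 (\<pi> P))" using tdeg_eq_0D by blast
    also have "at0 (\<pi> P) = e (at0 P)"
      using map_poly_hom_eval[of "map_poly e" P 0] map_poly_hom_eval[of e "poly P 0" 0] e(1)
        rhom_map_poly[OF e(1)] by (simp add: at0_def \<pi>_def rhom_simps)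
    finally have "\<pi> P = const2 (e (at0 P))" .
    moreover have "\<pi> (const2 (at0 P)) = const2 (e (at0 P))"
      using rhom_0[OF e(1)] by (simp add: \<pi>_def)
    ultimately have "\<pi> (P - const2 (at0 P)) = 0" by (simp add: rhom_diff[OF \<pi>])
    then obtain v where v: "P - const2 (at0 P) = const2 r * v" unfolding \<pi>dvd by (rule dvdE)
    have Pinv: "P \<in> invariants \<delta>" using P(2) ev1_X[OF rhom_const2, of P] by (metis rangeI)
    have "tdeg (const2 r * v) > 0"
      using v tdeg_diff_const2[of P "at0 P"] P(1) by simp
    then have "const2 r * v \<noteq> 0" by (metis less_irrefl tdeg_0)
    then have "v \<in> invariants \<delta>"
      using inv_factor[of v "const2 r"] inv_diff[OF Pinv c2[of "at0 P"]] by (simp add: v mult.commute)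
    then obtain V where V: "v = ev1 const2 P V" using P(2) by blast
    have "ev1 const2 P ([:- at0 P, 1:] - smult r V) = 0"
    proof -
      have "ev1 const2 P (smult r V) = const2 r * v"
        using rhom_mult[OF rhom_ev1[OF rhom_const2], of P "[:r:]" V] by (simp add: V)
      then show ?thesis
        using v by (simp add: rhom_diff[OF rhom_ev1] ev1_pCons rhom_simps[OF rhom_const2] rhom_0[OF rhom_ev1])
    qed
    then have "[:- at0 P, 1:] - smult r V = 0" by (rule ev1_const2_eq_0[OF P(1)])
    then have "[:- at0 P, 1:] = smult r V" by (simp only: right_minus_eq)
    from arg_cong[OF this, of "\<lambda>p. coeff p 1"] have "r * coeff V 1 = 1" by simp
    then have "r dvd 1" by (metis dvd_triv_left)
    then show False using r0 by simp
  qed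
  ultimately obtain a' where "map_poly2 e s = map_poly2 e (ev1 const2 P a')"
    using residue_division[OF r(1) e, of P C s A] by (auto simp: \<pi>_def)
  then have "\<pi> s = \<pi> (ev1 const2 P a')" unfolding \<pi>_def .
  then have "\<pi> (s - ev1 const2 P a') = 0" by (simp add: rhom_diff[OF \<pi>])
  then have "const2 r dvd s - ev1 const2 P a'" by (simp only: \<pi>dvd)
  then show ?thesis using P(2) by blast
qed

text \<open>Among the slices with denominators in the base, one is taken whose leading coefficient
  has the fewest prime factors. It is not congruent to an invariant modulo any prime
  \<open>r\<close> of the base, since dividing the difference by \<open>r\<close> would remove a
  factor. Hence a prime in the denominator of \<open>b\<close> divides all coefficients of
  \<open>F\<close> and cancels.\<close>

lemma ex_global_slice:
  fixes \<delta> :: "'k::field_gcd poly poly poly \<Rightarrow> 'k poly poly poly poly"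
  assumes \<delta>: "\<delta> \<in> EXP const2"
    and P: "tdeg P > 0" "invariants \<delta> = range (ev1 const2 P)"
    and s0: "s0 \<notin> invariants \<delta>"
      "\<And>b. \<exists>c F. c \<noteq> 0 \<and> (\<forall>i. coeff F i \<in> invariants \<delta>) \<and> const2 c * b = poly F s0"
    and s': "s' \<notin> invariants \<delta>"
    and D: "D \<subseteq> invariants \<delta>" "\<And>b. \<exists>c\<in>D. \<exists>F. (\<forall>i. coeff F i \<in> invariants \<delta>) \<and> c * b = poly F s'"
    and r: "\<And>r c. prime_elem r \<Longrightarrow> c \<in> D \<Longrightarrow> \<not> const2 r dvd c"
  shows "\<exists>s. \<forall>b. \<exists>F. (\<forall>i. coeff F i \<in> invariants \<delta>) \<and> b = poly F s"
proof -
  interpret expmap \<delta> using \<delta> by (simp add: EXP_iff)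
  have c2: "const2 a \<in> invariants \<delta>" for a using \<delta> by (simp add: EXP_iff invariants_def)
  define good where "good s \<longleftrightarrow> s \<notin> invariants \<delta> \<and>
    (\<forall>b. \<exists>c F. c \<noteq> 0 \<and> (\<forall>i. coeff F i \<in> invariants \<delta>) \<and> const2 c * b = poly F s)" for s
  have "good s0" using s0 by (simp add: good_def)
  then obtain s where s: "good s" and s_min: "\<And>t. good t \<Longrightarrow>
      size (prime_factorization (lead_coeff (\<delta> s))) \<le> size (prime_factorization (lead_coeff (\<delta> t)))"
    using ex_has_least_nat[of good s0 "\<lambda>s. size (prime_factorization (lead_coeff (\<delta> s)))"] by blast
  have irred: "\<not> const2 r dvd s - a" if r: "prime_elem r" and a: "a \<in> invariants \<delta>" for r a
  proof
    assume "const2 r dvd s - a"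
    then obtain t where t: "s - a = const2 r * t" by (rule dvdE)
    have s_eq: "s = a + const2 r * t" using t by (simp add: algebra_simps)
    have rp: "prime_elem (const2 r)" using r by (simp add: const2_def prime_elem_const_poly_iff)
    have t_inv: "t \<notin> invariants \<delta>"
      using s a c2 by (auto simp: good_def s_eq inv_add inv_mult)
    have "good t"
      unfolding good_def
    proof (intro conjI allI t_inv)
      fix b
      obtain c F where F: "c \<noteq> 0" "\<forall>i. coeff F i \<in> invariants \<delta>" "const2 c * b = poly F s"
        using s unfolding good_def by blast
      have "coeff (pcompose F [:a, const2 r:]) i \<in> invariants \<delta>" for i
        using F(2) a c2 by (intro inv_pcompose) (auto simp: coeff_pCons inv_0 split: nat.split)
      moreover have "const2 c * b = poly (pcompose F [:a, const2 r:]) t"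
        using F(3) by (simp add: poly_pcompose s_eq mult.commute)
      ultimately show "\<exists>c F. c \<noteq> 0 \<and> (\<forall>i. coeff F i \<in> invariants \<delta>) \<and> const2 c * b = poly F t"
        using F(1) by blast
    qed
    have \<delta>s: "\<delta> s = [:a:] + smult (const2 r) (\<delta> t)"
      by (simp add: s_eq rhom_add[OF hom] rhom_mult[OF hom] invD[OF a] invD[OF c2])
    have r0: "const2 r \<noteq> 0" using rp by (rule prime_elem_not_zeroI)
    have dt: "degree (\<delta> t) > 0" using t_inv by (simp add: inv_iff)
    have "lead_coeff (\<delta> s) = const2 r * lead_coeff (\<delta> t)"
      unfolding \<delta>s using dt r0 by (simp add: lead_coeff_add_le degree_add_eq_right coeff_pCons split: nat.split)
    moreover have "lead_coeff (\<delta> t) \<noteq> 0" using dt by (metis degree_0 leading_coeff_0_iff less_irrefl)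
    ultimately have "prime_factorization (lead_coeff (\<delta> s)) =
        prime_factorization (const2 r) + prime_factorization (lead_coeff (\<delta> t))"
      using r0 by (simp add: prime_factorization_mult)
    moreover have "prime_factorization (const2 r) \<noteq> {#}"
      using rp r0 prime_elem_not_unit by (auto simp: prime_factorization_empty_iff)
    ultimately have "size (prime_factorization (lead_coeff (\<delta> t))) < size (prime_factorization (lead_coeff (\<delta> s)))"
      by (simp add: nonempty_has_size)
    then show False using s_min[OF \<open>good t\<close>] by simp
  qed
  have "\<exists>F. (\<forall>i. coeff F i \<in> invariants \<delta>) \<and> b = poly F s" for b
  proof -
    define den where "den c \<longleftrightarrow> c \<noteq> 0 \<and> (\<exists>F. (\<forall>i. coeff F i \<in> invariants \<delta>) \<and> const2 c * b = poly F s)" for c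
    obtain c0 where "den c0" using s unfolding good_def den_def by blast
    then obtain c where c: "den c" and c_min: "\<And>c'. den c' \<Longrightarrow> degree c \<le> degree c'"
      using ex_has_least_nat[of den c0 degree] by blast
    have c0': "c \<noteq> 0" using c by (simp add: den_def)
    obtain F where F: "\<forall>i. coeff F i \<in> invariants \<delta>" "const2 c * b = poly F s" using c by (auto simp: den_def)
    have "degree c = 0"
    proof (rule ccontr)
      assume "degree c \<noteq> 0"
      then have "\<not> is_unit c" using c0' by (simp add: is_unit_iff_degree)
      then obtain r where "r dvd c" "prime r" using prime_divisor_exists c0' by blast
      then have rp: "prime_elem r" "r dvd c" by auto
      obtain c1 where c1: "c = r * c1" using rp(2) by (rule dvdE)
      have "const2 r dvd coeff F i" for i
      proof (rule ccontr)
        assume "\<not> const2 r dvd coeff F i"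
        moreover have "const2 r dvd poly F s"
          unfolding F(2)[symmetric] c1 by (simp add: rhom_mult[OF rhom_const2])
        ultimately show False
          using slice_congruent_invariant[OF \<delta> P s' D rp(1) r[OF rp(1)], of F i s] F(1) irred[OF rp(1)] by blast
      qed
      then have "[:const2 r:] dvd F" by (simp add: const_poly_dvd_iff)
      then obtain F1 where F1: "F = [:const2 r:] * F1" by (rule dvdE)
      have r0: "r \<noteq> 0" "c1 \<noteq> 0" using c0' c1 by auto
      have "coeff F1 i \<in> invariants \<delta>" for i
      proof (cases "coeff F1 i = 0")
        case False
        have "coeff F i = coeff F1 i * const2 r" by (simp add: F1 mult.commute)
        then show ?thesis using inv_factor[of "coeff F1 i" "const2 r"] F(1) False r0 by (metis const2_eq_0_iff mult_eq_0_iff)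
      qed (simp add: inv_0)
      moreover have "const2 c1 * b = poly F1 s"
      proof -
        have "const2 r * (const2 c1 * b) = const2 r * poly F1 s"
          using F(2) by (simp add: c1 F1 rhom_mult[OF rhom_const2] mult.assoc)
        then show ?thesis using r0 by (metis const2_eq_0_iff mult_left_cancel)
      qed
      ultimately have "den c1" using r0 by (auto simp: den_def)
      from c_min[OF this] have "degree c \<le> degree c1" .
      moreover have "degree c = degree r + degree c1" using r0 by (simp add: c1 degree_mult_eq)
      moreover have "degree r > 0" using r0 prime_elem_not_unit[OF rp(1)] is_unit_iff_degree[of r] by simp
      ultimately show False by simp
    qed
    then obtain k where k: "c = [:k:]" by (rule degree_eq_zeroE)
    then have k1: "[:inverse k:] * c = 1" using c0' by (simp add: one_pCons)
    have "const2 [:inverse k:] * (const2 c * b) = const2 ([:inverse k:] * c) * b"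
      by (simp only: rhom_mult[OF rhom_const2] mult.assoc)
    then have "const2 [:inverse k:] * (const2 c * b) = b"
      by (simp only: k1 rhom_1[OF rhom_const2] mult_1)
    then have "b = poly (smult (const2 [:inverse k:]) F) s" using F(2) by simp
    moreover have "coeff (smult (const2 [:inverse k:]) F) i \<in> invariants \<delta>" for i
      using F(1) c2 by (simp add: inv_mult)
    ultimately show ?thesis by blast
  qed
  then show ?thesis by blast
qed

text \<open>Transport along an automorphism, which moves an arbitrary invariant first coordinate to
  \<open>varX\<close>, where the view over \<open>K[x]\<close> applies.\<close>

definition exp_conj :: "('b::idom \<Rightarrow> 'b) \<Rightarrow> ('b \<Rightarrow> 'b poly) \<Rightarrow> 'b \<Rightarrow> 'b poly" where
  "exp_conj \<phi> \<delta> b = map_poly (inv_into UNIV \<phi>) (\<delta> (\<phi> b))"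

lemma exp_conj_invariants:
  assumes "rhom \<phi>" "bij \<phi>"
  shows "b \<in> invariants (exp_conj \<phi> \<delta>) \<longleftrightarrow> \<phi> b \<in> invariants \<delta>"
proof -
  let ?\<psi> = "inv_into UNIV \<phi>"
  have \<psi>: "rhom ?\<psi>" using assms by (rule rhom_inv)
  have inj: "inj (map_poly ?\<psi>)"
    using rhom_0[OF \<psi>] assms(2) by (intro map_poly_hom_inj) (auto simp: bij_imp_bij_inv bij_is_inj)
  have "exp_conj \<phi> \<delta> b = [:b:] \<longleftrightarrow> map_poly ?\<psi> (\<delta> (\<phi> b)) = map_poly ?\<psi> [:\<phi> b:]"
    using assms(2) rhom_0[OF \<psi>] by (simp add: exp_conj_def map_poly_pCons bij_is_inj)
  also have "\<dots> \<longleftrightarrow> \<delta> (\<phi> b) = [:\<phi> b:]" using inj by (rule inj_eq)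
  finally show ?thesis unfolding invariants_def mem_Collect_eq .
qed

lemma exp_conj_EXP:
  assumes \<delta>: "\<delta> \<in> EXP const3" and \<phi>: "rhom \<phi>" "bij \<phi>" "\<And>a. \<phi> (const3 a) = const3 a"
  shows "exp_conj \<phi> \<delta> \<in> EXP const3"
proof -
  let ?\<psi> = "inv_into UNIV \<phi>"
  interpret expmap \<delta> using \<delta> by (simp add: EXP_iff)
  have \<psi>: "rhom ?\<psi>" using \<phi>(1,2) by (rule rhom_inv)
  note \<psi>0 = rhom_0[OF \<psi>]
  note m1 = rhom_map_poly[OF \<psi>]
  note m2 = rhom_map_poly[OF m1]
  have \<psi>\<phi>: "?\<psi> (\<phi> b) = b" for b using \<phi>(2) by (simp add: bij_is_inj)
  have \<phi>\<psi>: "\<phi> (?\<psi> b) = b" for b using \<phi>(2) by (simp add: bij_is_surj surj_f_inv_f)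
  have h: "rhom (exp_conj \<phi> \<delta>)"
    unfolding exp_conj_def[abs_def] by (rule rhom_comp[OF m1 rhom_comp[OF hom \<phi>(1)]])
  have "expmap (exp_conj \<phi> \<delta>)"
  proof
    show "rhom (exp_conj \<phi> \<delta>)" by (rule h)
    fix b
    show "poly (exp_conj \<phi> \<delta> b) 0 = b"
      by (simp add: exp_conj_def poly_0_coeff_0 coeff_map_poly[of ?\<psi>, OF \<psi>0] coeff_0 \<psi>\<phi>)
    let ?q = "\<delta> (\<phi> b)"
    have "map_poly (exp_conj \<phi> \<delta>) (exp_conj \<phi> \<delta> b) = map_poly (map_poly ?\<psi>) (map_poly \<delta> ?q)"
    proof (rule poly_eqI)
      fix n
      have "coeff (exp_conj \<phi> \<delta> b) n = ?\<psi> (coeff ?q n)"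
        by (simp only: exp_conj_def coeff_map_poly[of ?\<psi>, OF \<psi>0])
      then have "exp_conj \<phi> \<delta> (coeff (exp_conj \<phi> \<delta> b) n) = map_poly ?\<psi> (\<delta> (coeff ?q n))"
        by (simp only: exp_conj_def[of \<phi> \<delta> "?\<psi> _"] \<phi>\<psi>)
      then show "coeff (map_poly (exp_conj \<phi> \<delta>) (exp_conj \<phi> \<delta> b)) n =
          coeff (map_poly (map_poly ?\<psi>) (map_poly \<delta> ?q)) n"
        by (simp only: coeff_map_poly[of "exp_conj \<phi> \<delta>", OF rhom_0[OF h]]
            coeff_map_poly[of "map_poly ?\<psi>", OF rhom_0[OF m1]] coeff_map_poly[of \<delta>, OF rhom_0[OF hom]])
    qed
    also have "\<dots> = map_poly (map_poly ?\<psi>) (poly (map_poly (\<lambda>c. [:[:c:]:]) ?q) (var_s + var_t))"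
      by (simp only: comp)
    also have "\<dots> = poly (map_poly (map_poly (map_poly ?\<psi>)) (map_poly (\<lambda>c. [:[:c:]:]) ?q))
        (map_poly (map_poly ?\<psi>) (var_s + var_t))"
      using rhom_0[OF m2] rhom_add[OF m2] rhom_mult[OF m2] by (rule map_poly_hom_eval)
    also have "map_poly (map_poly ?\<psi>) (var_s + var_t) = var_s + var_t"
      using rhom_1[OF \<psi>] \<psi>0 by (simp add: rhom_add[OF m2] var_s_def var_t_def map_poly_pCons)
    also have "map_poly (map_poly (map_poly ?\<psi>)) (map_poly (\<lambda>c. [:[:c:]:]) ?q) =
        map_poly (\<lambda>c. [:[:c:]:]) (exp_conj \<phi> \<delta> b)"
      by (rule poly_eqI) (simp add: exp_conj_def coeff_map_poly map_poly_pCons \<psi>0)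
    finally show "map_poly (exp_conj \<phi> \<delta>) (exp_conj \<phi> \<delta> b) =
        poly (map_poly (\<lambda>c. [:[:c:]:]) (exp_conj \<phi> \<delta> b)) (var_s + var_t)" .
  qed
  moreover have "exp_conj \<phi> \<delta> (const3 a) = [:const3 a:]" for a
  proof -
    have "const3 a \<in> invariants \<delta>" using \<delta> by (simp add: EXP_iff invariants_def)
    then show ?thesis using exp_conj_invariants[OF \<phi>(1,2), of "const3 a" \<delta>] \<phi>(3)
      by (simp add: invariants_def)
  qed
  ultimately show ?thesis by (simp add: EXP_iff)
qed

lemma EXP_const2I:
  assumes \<delta>: "\<delta> \<in> EXP const3" and x: "varX \<in> invariants \<delta>"
  shows "\<delta> \<in> EXP const2"
proof -
  interpret expmap \<delta> using \<delta> by (simp add: EXP_iff)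
  have c: "const3 a \<in> invariants \<delta>" for a using \<delta> by (simp add: EXP_iff invariants_def)
  have "ev1 const3 u r \<in> invariants \<delta>" if "u \<in> invariants \<delta>" for u r
    by (induction r) (simp_all add: ev1_pCons inv_add inv_mult c that rhom_0[OF rhom_ev1] inv_0)
  from this[OF x] have "\<delta> (const2 r) = [:const2 r:]" for r
    unfolding ev1_const3_varX by (simp add: invariants_def)
  then show ?thesis using expmap_axioms by (simp add: EXP_iff)
qed

lemma ev1_const3_eq: "ev1 const3 u E = ev1 const2 u (map_poly (\<lambda>a. [:a:]) E)"
  using ev1_map_poly[OF rhom_const2 rhom_const_poly, of u E]
  by (simp add: const3_def[abs_def] const2_def[abs_def])

text \<open>The two sides have total degree 0 and \<open>deg E * tdeg u\<close> in \<open>Y\<close>,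
  \<open>Z\<close>, and \<open>E\<close> cannot be constant because \<open>r\<close> is not.\<close>

lemma tdeg_eq_0_of_relation:
  assumes eq: "const2 r = ev1 const3 u E" and r: "degree r > 0"
  shows "tdeg u = 0" "degree E > 0"
proof -
  show E: "degree E > 0"
  proof (rule ccontr)
    assume "\<not> degree E > 0"
    then obtain a where "E = [:a:]" by (auto elim: degree_eq_zeroE)
    then have "const2 r = const2 [:a:]" using eq by (simp add: const3_def const2_def)
    then show False using r by simp
  qed
  have E': "map_poly (\<lambda>a. [:a:]) E \<noteq> 0"
    using E map_poly_eq_0D[of "\<lambda>a. [:a:]" E] by auto
  have "degree (map_poly (\<lambda>a. [:a:]) E) = degree E" by (rule degree_map_poly) simp
  moreover have "degree (map_poly (\<lambda>a. [:a:]) E) * tdeg u = tdeg (const2 r)"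
    using tdeg_ev1[OF E', of u] eq by (simp only: ev1_const3_eq)
  ultimately show "tdeg u = 0" using E by simp
qed

lemma invariants_and_slice:
  fixes \<delta> :: "'k::field_gcd poly3 \<Rightarrow> 'k poly3 poly"
  assumes "\<delta> \<in> EXP const2" "invariants \<delta> \<noteq> UNIV" "\<exists>f\<in>invariants \<delta>. tdeg f > 0"
  shows "\<exists>P s. P \<in> invariants \<delta> \<and> tdeg P > 0 \<and> invariants \<delta> = range (ev1 const2 P) \<and> s \<notin> invariants \<delta> \<and>
    (\<forall>b. \<exists>c F. c \<noteq> 0 \<and> (\<forall>i. coeff F i \<in> invariants \<delta>) \<and> const2 c * b = poly F s)"
proof -
  obtain P where P: "P \<in> invariants \<delta>" "tdeg P > 0"
    "\<And>f. f \<in> invariants \<delta> \<Longrightarrow> tdeg f > 0 \<Longrightarrow> tdeg P \<le> tdeg f" "invariants \<delta> = range (ev1 const2 P)"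
    using invariants_two_variables[OF assms] by blast
  from ex_base_multiple[OF assms(1) P(1-3) assms(2) P(4)] P show ?thesis by blast
qed

text \<open>
  The two projections \<open>x\<close> and \<open>\<phi> x\<close> provide slices whose denominators lie in \<open>K[x]\<close> and \<open>K[\<phi> x]\<close>; these rings
  share no non-constant element.
\<close>

lemma two_invariant_variables:
  fixes \<delta> :: "'k::field_gcd poly3 \<Rightarrow> 'k poly3 poly"
  assumes \<delta>: "\<delta> \<in> EXP const3" and nt: "invariants \<delta> \<noteq> UNIV"
    and \<phi>: "rhom \<phi>" "bij \<phi>" "\<And>a. \<phi> (const3 a) = const3 a"
    and x: "varX \<in> invariants \<delta>" "\<phi> varX \<in> invariants \<delta>"
    and neq: "adjoin const3 {varX} \<noteq> adjoin const3 {\<phi> varX}"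
  shows "\<exists>P s. P \<in> invariants \<delta> \<and> adjoin const3 {varX, P, s} = UNIV"
proof -
  let ?\<psi> = "inv_into UNIV \<phi>"
  let ?X = "\<phi> varX"
  have \<psi>: "rhom ?\<psi>" using \<phi>(1,2) by (rule rhom_inv)
  have \<psi>\<phi>: "?\<psi> (\<phi> b) = b" for b using \<phi>(2) by (simp add: bij_is_inj)
  have \<phi>\<psi>: "\<phi> (?\<psi> b) = b" for b using \<phi>(2) by (simp add: bij_is_surj surj_f_inv_f)
  have \<phi>2: "\<phi> (const2 p) = ev1 const3 ?X p" for p
    using rhom_ev1_comp[OF \<phi>(1) rhom_const3, of varX p] \<phi>(3) by (simp add: ev1_const3_varX)
  \<comment> \<open>A common nonconstant element forces \<open>\<phi> x\<close> into
    \<open>K[x]\<close> and, read through the inverse of \<open>\<phi>\<close>, also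
    \<open>x\<close> into \<open>K[\<phi> x]\<close>.\<close>
  have sep: False if r: "degree r > 0" "const2 r = ev1 const3 ?X E" for r E
  proof -
    note X0 = tdeg_eq_0_of_relation[OF r(2,1)]
    have "?\<psi> (const2 r) = const2 E" using r(2) \<psi>\<phi>[of "const2 E"] \<phi>2[of E] by simp
    moreover have "?\<psi> (const2 r) = ev1 const3 (?\<psi> varX) r"
    proof -
      have "?\<psi> (const3 a) = const3 a" for a using \<psi>\<phi>[of "const3 a"] \<phi>(3) by simp
      then show ?thesis
        using rhom_ev1_comp[OF \<psi> rhom_const3, of varX r] by (simp add: ev1_const3_varX)
    qed
    ultimately have "tdeg (?\<psi> varX) = 0"
      using tdeg_eq_0_of_relation(1)[of E "?\<psi> varX" r] X0(2) by simp
    then have "varX = \<phi> (const2 (at0 (?\<psi> varX)))"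
      using tdeg_eq_0D[of "?\<psi> varX"] \<phi>\<psi>[of varX] by simp
    then have "varX \<in> range (ev1 const3 ?X)" unfolding \<phi>2 by blast
    moreover have "?X \<in> range (ev1 const3 varX)"
      using tdeg_eq_0D[OF X0(1)] unfolding ev1_const3_varX by blast
    ultimately have "adjoin const3 {varX} \<subseteq> adjoin const3 {?X}" "adjoin const3 {?X} \<subseteq> adjoin const3 {varX}"
      by (intro adjoin_mono; simp add: adjoin1)+
    then show False using neq by blast
  qed
  have deg: "tdeg u > 0" if "\<And>r. u \<noteq> const2 r" for u :: "'k poly3"
    using tdeg_eq_0D[of u] that by blast
  have nc: "\<exists>f\<in>invariants \<delta>. tdeg f > 0"
  proof (intro bexI[OF _ x(2)] deg notI)
    fix r assume "?X = const2 r"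
    moreover have "?X \<noteq> const3 a" for a
    proof
      assume "?X = const3 a"
      then have "\<phi> varX = \<phi> (const3 a)" using \<phi>(3) by simp
      then have "varX = (const3 a :: 'k poly3)" using \<phi>(2) by (auto simp: bij_def dest: injD)
      then show False by (simp add: const3_def)
    qed
    ultimately have "degree r > 0"
      by (metis const2_def const3_def degree_eq_zeroE gr0I)
    moreover have "const2 r = ev1 const3 ?X [:0, 1:]" using \<open>?X = const2 r\<close> by simp
    ultimately show False by (rule sep)
  qed
  let ?\<delta>' = "exp_conj \<phi> \<delta>"
  have inv': "b \<in> invariants ?\<delta>' \<longleftrightarrow> \<phi> b \<in> invariants \<delta>" for b
    using \<phi>(1,2) by (rule exp_conj_invariants)
  have \<delta>': "?\<delta>' \<in> EXP const2"
    using exp_conj_EXP[OF \<delta> \<phi>] x(2) by (intro EXP_const2I) (simp_all add: inv')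
  have nt': "invariants ?\<delta>' \<noteq> UNIV"
  proof
    assume "invariants ?\<delta>' = UNIV"
    then have "\<phi> (?\<psi> b) \<in> invariants \<delta>" for b using inv' by blast
    then show False using nt \<phi>\<psi> by auto
  qed
  have nc': "\<exists>f\<in>invariants ?\<delta>'. tdeg f > 0"
  proof (intro bexI[of _ "?\<psi> varX"] deg notI)
    show "?\<psi> varX \<in> invariants ?\<delta>'" using x(1) by (simp add: inv' \<phi>\<psi>)
    fix r assume "?\<psi> varX = const2 r"
    then have "const2 [:0, 1:] = ev1 const3 ?X r" using \<phi>2[of r] \<phi>\<psi>[of varX] by (simp add: const2_def)
    then show False using sep[of "[:0, 1:]" r] by simp
  qed
  have \<delta>2: "\<delta> \<in> EXP const2" using \<delta> x(1) by (rule EXP_const2I)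
  interpret expmap \<delta> using \<delta> by (simp add: EXP_iff)
  obtain P s0 where P: "P \<in> invariants \<delta>" "tdeg P > 0" "invariants \<delta> = range (ev1 const2 P)" "s0 \<notin> invariants \<delta>"
    and s0: "\<And>b. \<exists>c F. c \<noteq> 0 \<and> (\<forall>i. coeff F i \<in> invariants \<delta>) \<and> const2 c * b = poly F s0"
    using invariants_and_slice[OF \<delta>2 nt nc] by blast
  obtain s' where s': "s' \<notin> invariants ?\<delta>'"
    "\<And>b. \<exists>c F. c \<noteq> 0 \<and> (\<forall>i. coeff F i \<in> invariants ?\<delta>') \<and> const2 c * b = poly F s'"
    using invariants_and_slice[OF \<delta>' nt' nc'] by blast
  \<comment> \<open>The second slice is found for the conjugated map; \<open>\<phi>\<close> carries
    its denominators to nonzero polynomials in \<open>\<phi> x\<close>.\<close>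
  define D where "D = (\<lambda>c. \<phi> (const2 c)) ` {c. c \<noteq> 0}"
  have "const2 c \<in> invariants ?\<delta>'" for c
    using \<delta>' by (simp add: EXP_iff invariants_def[of ?\<delta>'])
  then have "D \<subseteq> invariants \<delta>" by (auto simp: D_def inv')
  moreover have "\<exists>c\<in>D. \<exists>F. (\<forall>i. coeff F i \<in> invariants \<delta>) \<and> c * b = poly F (\<phi> s')" for b
  proof -
    obtain c F where F: "c \<noteq> 0" "\<forall>i. coeff F i \<in> invariants ?\<delta>'" "const2 c * ?\<psi> b = poly F s'"
      using s'(2)[of "?\<psi> b"] by blast
    have "coeff (map_poly \<phi> F) i \<in> invariants \<delta>" for i
      using F(2) by (simp add: coeff_map_poly rhom_0[OF \<phi>(1)] inv')
    moreover have "\<phi> (const2 c) * b = poly (map_poly \<phi> F) (\<phi> s')"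
      using arg_cong[OF F(3), of \<phi>] map_poly_hom_eval[of \<phi> F s'] \<phi>(1)
      by (simp add: rhom_simps \<phi>\<psi>)
    ultimately show ?thesis using F(1) by (auto simp: D_def)
  qed
  moreover have "\<not> const2 r dvd c" if r: "prime_elem r" and c: "c \<in> D" for r c
  proof
    assume "const2 r dvd c"
    obtain c0 where c0: "c0 \<noteq> 0" "c = \<phi> (const2 c0)" using c by (auto simp: D_def)
    \<comment> \<open>A divisor of an element of total degree 0 has total degree 0, so
      \<open>r\<close> would lie in \<open>K[\<phi> x]\<close> as well as in
      \<open>K[x]\<close>.\<close>
    have "?\<psi> (const2 r) dvd const2 c0"
      using rhom_dvd[OF \<psi> \<open>const2 r dvd c\<close>] by (simp add: c0 \<psi>\<phi>)
    then obtain v where v: "const2 c0 = ?\<psi> (const2 r) * v" by (rule dvdE)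
    moreover have "const2 c0 \<noteq> 0" using c0 by simp
    ultimately have "?\<psi> (const2 r) \<noteq> 0" "v \<noteq> 0" by auto
    then have "tdeg (?\<psi> (const2 r)) = 0" using tdeg_mult[of "?\<psi> (const2 r)" v] v tdeg_const2[of c0] by simp
    then have "const2 r = \<phi> (const2 (at0 (?\<psi> (const2 r))))"
      using tdeg_eq_0D \<phi>\<psi> by metis
    moreover have "degree r > 0"
      using prime_elem_not_unit[OF r] prime_elem_not_zeroI[OF r] is_unit_iff_degree[of r] by simp
    ultimately show False using sep unfolding \<phi>2 by blast
  qed
  moreover have "\<phi> s' \<notin> invariants \<delta>" using s'(1) by (simp add: inv')
  ultimately obtain s where s: "\<And>b. \<exists>F. (\<forall>i. coeff F i \<in> invariants \<delta>) \<and> b = poly F s"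
    using ex_global_slice[OF \<delta>2 P(2-4) s0, of "\<phi> s'" D] by blast
  have "b \<in> range (ev3 const3 varX P s)" for b
  proof -
    obtain F where F: "\<forall>i. coeff F i \<in> invariants \<delta>" "b = poly F s" using s by blast
    then obtain G where "map_poly (ev1 const2 P) G = F"
      using ex_map_poly_preimage[of "ev1 const2 P" F] P(3) by (auto simp: rhom_0[OF rhom_ev1])
    then have "b = ev3 const3 varX P s G" using F(2) by (simp add: ev1_const3_varX ev1_def[of "ev1 const2 P"])
    then show ?thesis by blast
  qed
  then have "adjoin const3 {varX, P, s} = UNIV" unfolding adjoin3[OF rhom_const3] by blast
  then show ?thesis using P(1) by blast
qed

section \<open>Coordinate systems over a field\<close>

text \<open>The columns of \<open>M\<close> together with \<open>-e_k\<close> are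
  \<open>n + 1\<close> vectors in dimension \<open>n\<close>. A relation between them reads
  \<open>M c = c_n e_k\<close>; applying \<open>N\<close> identifies \<open>c\<close> with
  \<open>c_n\<close> times column \<open>k\<close> of \<open>N\<close>, so \<open>c_n\<close> is
  nonzero and can be cancelled.\<close>

lemma left_inverse_imp_right_inverse:
  fixes M N :: "nat \<Rightarrow> nat \<Rightarrow> 'a::field"
  assumes NM: "\<And>i k. i < n \<Longrightarrow> k < n \<Longrightarrow> (\<Sum>j<n. N i j * M j k) = (if i = k then 1 else 0)"
    and ik: "i < n" "k < n"
  shows "(\<Sum>j<n. M i j * N j k) = (if i = k then 1 else 0)"
proof -
  define v where "v l j = (if l < n then M j l else if j = k then -1 else 0)" for l j
  obtain c where c: "\<exists>l<Suc n. c l \<noteq> 0" "\<And>j. j < n \<Longrightarrow> (\<Sum>l<Suc n. c l * v l j) = 0"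
    using linear_dependence[of "{..<n}" "{..<Suc n}" v] by auto
  have Mc: "(\<Sum>l<n. M j l * c l) = (if j = k then c n else 0)" if "j < n" for j
  proof -
    have "(\<Sum>l<n. c l * v l j) + c n * v n j = 0" using c(2)[OF that] by simp
    moreover have "(\<Sum>l<n. c l * v l j) = (\<Sum>l<n. M j l * c l)" by (simp add: v_def mult.commute)
    ultimately show ?thesis by (simp add: v_def split: if_splits)
  qed
  have cN: "c l = N l k * c n" if l: "l < n" for l
  proof -
    have "(\<Sum>j<n. N l j * (\<Sum>m<n. M j m * c m)) = (\<Sum>m<n. (\<Sum>j<n. N l j * M j m) * c m)"
      by (simp add: sum_distrib_left sum_distrib_right mult.assoc) (rule sum.swap)
    also have "\<dots> = (\<Sum>m<n. if l = m then c m else 0)"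
      by (rule sum.cong) (auto simp: NM l)
    also have "\<dots> = c l" using l by simp
    finally have "c l = (\<Sum>j<n. N l j * (if j = k then c n else 0))" by (simp add: Mc)
    also have "\<dots> = N l k * c n" using ik by (simp add: if_distrib cong: if_cong)
    finally show ?thesis .
  qed
  have "c n \<noteq> 0"
  proof
    assume "c n = 0"
    then have "c l = 0" if "l < Suc n" for l using that cN[of l] by (cases "l = n") auto
    then show False using c(1) by blast
  qed
  moreover have "(\<Sum>j<n. M i j * N j k) * c n = (if i = k then 1 else 0) * c n"
    using Mc[OF ik(1)] by (simp add: cN sum_distrib_right mult.assoc)
  ultimately show ?thesis by simp
qed

section \<open>Homogeneous components and linear parts in three variables\<close>

definition hgr3 :: "'a::idom poly3 \<Rightarrow> 'a poly3 poly" where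
  "hgr3 = ev3 (\<lambda>a. [:const3 a:]) [:0, varX:] [:0, varY:] [:0, varZ:]"

lemma rhom_Cconst3 [simp]: "rhom (\<lambda>a. [:const3 a:])"
  by (rule rhom_comp[OF rhom_const_poly rhom_const3])

lemma rhom_hgr3: "rhom hgr3"
  unfolding hgr3_def by (simp add: rhom_ev1)

lemma ev3_simps:
  assumes "rhom c"
  shows "ev3 c u v w (const3 a) = c a" "ev3 c u v w varX = u" "ev3 c u v w varY = v" "ev3 c u v w varZ = w"
  using assms by (simp_all add: const3_def rhom_ev1)

lemmas hgr3_simps = ev3_simps[OF rhom_Cconst3, of "[:0, varX:]" "[:0, varY:]" "[:0, varZ:]", folded hgr3_def]

definition at03 :: "'a::comm_ring_1 poly3 \<Rightarrow> 'a" where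
  "at03 f = poly (poly (poly f 0) 0) 0"

lemma rhom_at03: "rhom at03"
  unfolding at03_def by (intro rhom_comp[OF rhom_poly] rhom_poly)

lemma at03_simps [simp]: "at03 (const3 a) = a" "at03 varX = 0" "at03 varY = 0" "at03 varZ = 0"
  by (simp_all add: at03_def const3_def)

lemma poly_hgr3_0: "coeff (hgr3 f) 0 = const3 (at03 f)"
proof -
  have "(\<lambda>f. poly (hgr3 f) 0) = (\<lambda>f. const3 (at03 f))"
    by (rule rhom_ext_poly3[OF rhom_comp[OF rhom_poly rhom_hgr3] rhom_comp[OF rhom_const3 rhom_at03]])
       (simp_all add: hgr3_simps)
  then have "poly (hgr3 f) 0 = const3 (at03 f)" by (rule fun_cong)
  then show ?thesis by (simp add: poly_0_coeff_0)
qed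

lemma poly_hgr3_1: "poly (hgr3 f) 1 = f"
proof -
  have "(\<lambda>f. poly (hgr3 f) 1) = (\<lambda>f. f)"
    by (rule rhom_ext_poly3[OF rhom_comp[OF rhom_poly rhom_hgr3] rhom_id])
       (simp_all add: hgr3_simps)
  then show ?thesis by (rule fun_cong)
qed

lemma ev3_std: "ev3 const3 varX varY varZ f = f"
proof -
  have "ev3 const3 varX varY varZ = (\<lambda>f. f)"
    by (rule rhom_ext_poly3[OF rhom_ev1[OF rhom_ev1[OF rhom_ev1[OF rhom_const3]]] rhom_id])
       (simp_all only: ev3_simps[OF rhom_const3])
  then show ?thesis by (rule fun_cong)
qed

lemma adjoin_std: "adjoin const3 {varX, varY, varZ} = UNIV"
  unfolding adjoin3[OF rhom_const3] using ev3_std by (metis UNIV_I UNIV_eq_I rangeI)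

text \<open>The coefficient of \<open>T\<close> in \<open>f(TX, TY, TZ)\<close>, that is, the linear
  part of \<open>f\<close> at the origin.\<close>

definition linpart :: "'a::idom poly3 \<Rightarrow> 'a poly3" where
  "linpart f = coeff (hgr3 f) 1"

lemma linpart_simps [simp]:
  "linpart (const3 a) = 0" "linpart varX = varX" "linpart varY = varY" "linpart varZ = varZ"
  by (simp_all add: linpart_def hgr3_simps)

lemma linpart_add: "linpart (f + g) = linpart f + linpart g"
  by (simp add: linpart_def rhom_add[OF rhom_hgr3])

lemma linpart_mult: "linpart (f * g) = const3 (at03 f) * linpart g + const3 (at03 g) * linpart f"
  by (simp add: linpart_def rhom_mult[OF rhom_hgr3] coeff_mult poly_hgr3_0 mult.commute)

text \<open>Taking linear parts is a derivation at the origin, so the linear part of any expression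
  in the generators is a combination of theirs with scalar coefficients.\<close>

lemma linpart_span:
  fixes L :: "nat \<Rightarrow> 'a::idom poly3" and n :: nat
  assumes "adjoin const3 (L ` {..<n}) = UNIV"
  shows "\<exists>c. linpart f = (\<Sum>k<n. const3 (c k) * linpart (L k))"
proof -
  have "f \<in> adjoin const3 (L ` {..<n})" using assms by simp
  then show ?thesis
  proof induction
    case (const a)
    show ?case by (rule exI[of _ "\<lambda>_. 0"]) simp
  next
    case (gen x)
    then obtain l where l: "l < n" "x = L l" by blast
    have "(\<Sum>k<n. const3 (if k = l then 1 else 0) * linpart (L k)) = (\<Sum>k<n. if k = l then linpart (L k) else 0)"
      by (rule sum.cong) auto
    then have "linpart x = (\<Sum>k<n. const3 (if k = l then 1 else 0) * linpart (L k))"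
      using l by simp
    then show ?case by (rule exI[of _ "\<lambda>k. if k = l then 1 else 0"])
  next
    case (add x y)
    then obtain c d where "linpart x = (\<Sum>k<n. const3 (c k) * linpart (L k))"
      "linpart y = (\<Sum>k<n. const3 (d k) * linpart (L k))" by blast
    then have "linpart (x + y) = (\<Sum>k<n. const3 (c k + d k) * linpart (L k))"
      by (simp add: linpart_add rhom_add[OF rhom_const3] distrib_right sum.distrib)
    then show ?case by (rule exI[of _ "\<lambda>k. c k + d k"])
  next
    case (mult x y)
    then obtain c d where "linpart x = (\<Sum>k<n. const3 (c k) * linpart (L k))"
      "linpart y = (\<Sum>k<n. const3 (d k) * linpart (L k))" by blast
    then have "linpart (x * y) = (\<Sum>k<n. const3 (at03 x * d k + at03 y * c k) * linpart (L k))"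
      by (simp add: linpart_mult rhom_add[OF rhom_const3] rhom_mult[OF rhom_const3] distrib_right sum.distrib
          sum_distrib_left mult.assoc)
    then show ?case by (rule exI[of _ "\<lambda>k. at03 x * d k + at03 y * c k"])
  qed
qed

text \<open>The linear parts of generators span \<open>X\<close>, \<open>Y\<close>,
  \<open>Z\<close>, which yields \<open>N M = 1\<close>. The substitution in the required order
  needs \<open>M N = 1\<close>.\<close>

lemma ex_linear_inverse:
  fixes x y z :: "'k::field poly3"
  assumes "adjoin const3 {x, y, z} = UNIV"
  shows "\<exists>u v w. \<forall>f. ev3 const3 u v w (ev3 const3 (linpart x) (linpart y) (linpart z) f) = f"
proof -
  define L where "L k = (if k = 0 then x else if k = 1 then y else z)" for k :: nat
  define V :: "nat \<Rightarrow> 'k poly3" where "V k = (if k = 0 then varX else if k = 1 then varY else varZ)" for k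
  have three: "{..<3::nat} = {0, 1, 2}" by auto
  have L: "adjoin const3 (L ` {..<3}) = UNIV" using assms by (simp add: three L_def insert_commute)
  have V: "adjoin const3 (V ` {..<3}) = UNIV" using adjoin_std by (simp add: three V_def insert_commute)
  have linV: "linpart (V k) = V k" for k by (simp add: V_def)
  obtain N where N: "\<And>j. V j = (\<Sum>k<3. const3 (N j k) * linpart (L k))"
    using linpart_span[OF L, of "V j" for j] unfolding linV by metis
  obtain M where M: "\<And>j. linpart (L j) = (\<Sum>k<3. const3 (M j k) * V k)"
    using linpart_span[OF V, of "L j" for j] unfolding linV by metis
  have indep: "c k = d k" if "(\<Sum>k<3. const3 (c k) * V k) = (\<Sum>k<3. const3 (d k) * V k)" "k < 3" for c d :: "nat \<Rightarrow> 'k" and k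
  proof -
    have e: "(\<Sum>k<3. const3 (c k) * V k) = [:[:[:0, c 0:], [:c 1:]:], [:[:c 2:]:]:]" for c
      by (simp add: eval_nat_numeral lessThan_Suc V_def const3_def)
    show ?thesis using that unfolding e by (auto simp: less_Suc_eq eval_nat_numeral)
  qed
  have NM: "(\<Sum>k<3. N i k * M k j) = (if i = j then 1 else 0)" if "i < 3" "j < 3" for i j
  proof (rule indep[where k = j])
    have "(\<Sum>j<3. const3 (\<Sum>k<3. N i k * M k j) * V j) = (\<Sum>j<3. \<Sum>k<3. const3 (N i k) * (const3 (M k j) * V j))"
      by (simp add: rhom_sum[OF rhom_const3] rhom_mult[OF rhom_const3] sum_distrib_right mult.assoc)
    also have "\<dots> = (\<Sum>k<3. const3 (N i k) * linpart (L k))"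
      unfolding M sum_distrib_left by (rule sum.swap)
    also have "\<dots> = V i" using N by simp
    also have "\<dots> = (\<Sum>j<3. if j = i then V j else 0)" using \<open>i < 3\<close> by simp
    also have "\<dots> = (\<Sum>j<3. const3 (if i = j then 1 else 0) * V j)"
      by (rule sum.cong) auto
    finally show "(\<Sum>j<3. const3 (\<Sum>k<3. N i k * M k j) * V j) = (\<Sum>j<3. const3 (if i = j then 1 else 0) * V j)" .
  qed (use that in auto)
  define n where "n j = (\<Sum>k<3. const3 (N j k) * V k)" for j
  let ?g = "ev3 const3 (n 0) (n 1) (n 2)"
  have hg: "rhom ?g" by (simp add: rhom_ev1)
  have gV: "?g (V k) = n k" if "k < 3" for k
    using that by (auto simp: V_def less_Suc_eq eval_nat_numeral rhom_ev1)
  have gL: "?g (linpart (L i)) = V i" if i: "i < 3" for i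
  proof -
    have "?g (linpart (L i)) = (\<Sum>j<3. const3 (M i j) * n j)"
      unfolding M rhom_sum[OF hg] rhom_mult[OF hg] ev3_simps[OF rhom_const3]
      by (rule sum.cong) (simp_all only: gV lessThan_iff)
    also have "\<dots> = (\<Sum>k<3. const3 (\<Sum>j<3. M i j * N j k) * V k)"
      unfolding n_def
      by (simp add: rhom_sum[OF rhom_const3] rhom_mult[OF rhom_const3] sum_distrib_right sum_distrib_left mult.assoc)
         (rule sum.swap)
    also have "\<dots> = (\<Sum>k<3. if k = i then V k else 0)"
      by (rule sum.cong) (auto simp: left_inverse_imp_right_inverse[OF NM i])
    also have "\<dots> = V i" using i by simp
    finally show ?thesis .
  qed
  have "?g (ev3 const3 (linpart x) (linpart y) (linpart z) f) = f" for f
  proof -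
    have "?g (ev3 const3 (linpart x) (linpart y) (linpart z) f) =
        ev3 (\<lambda>a. ?g (const3 a)) (?g (linpart x)) (?g (linpart y)) (?g (linpart z)) f"
      using hg rhom_const3 by (rule rhom_ev3_comp)
    also have "\<dots> = ev3 const3 varX varY varZ f"
      using gL[of 0] gL[of 1] gL[of 2] by (simp add: L_def V_def ev3_simps[OF rhom_const3])
    finally show ?thesis by (simp only: ev3_std)
  qed
  then show ?thesis by blast
qed

text \<open>The lowest homogeneous form of \<open>f\<close>, evaluated at the linear parts of
  \<open>x\<close>, \<open>y\<close>, \<open>z\<close>, is the lowest possible term of
  \<open>f(x, y, z)\<close>. It vanishes, and the linear substitution is invertible, so that form
  would be zero.\<close>

lemma coordinates_at0_independent:
  fixes x y z :: "'k::field poly3"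
  assumes gen: "adjoin const3 {x, y, z} = UNIV" and 0: "at03 x = 0" "at03 y = 0" "at03 z = 0"
    and f: "ev3 const3 x y z f = 0"
  shows "f = 0"
proof (rule ccontr)
  assume "f \<noteq> 0"
  then have "hgr3 f \<noteq> 0" using poly_hgr3_1[of f] by auto
  then obtain h where h: "hgr3 f = monom 1 (order 0 (hgr3 f)) * h" "poly h 0 \<noteq> 0"
    using order_decomp[of "hgr3 f" 0] by (auto simp: monom_altdef poly_eq_0_iff_dvd)
  have split: "\<exists>u. hgr3 A = [:0, 1:] * u \<and> coeff u 0 = linpart A" if "at03 A = 0" for A :: "'k poly3"
  proof -
    obtain a u where "hgr3 A = pCons a u" by (cases "hgr3 A")
    then show ?thesis using that poly_hgr3_0[of A] by (intro exI[of _ u]) (simp add: linpart_def)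
  qed
  obtain u where u: "hgr3 x = [:0, 1:] * u" "coeff u 0 = linpart x" using split[OF 0(1)] by blast
  obtain v where v: "hgr3 y = [:0, 1:] * v" "coeff v 0 = linpart y" using split[OF 0(2)] by blast
  obtain w where w: "hgr3 z = [:0, 1:] * w" "coeff w 0 = linpart z" using split[OF 0(3)] by blast
  let ?c = "\<lambda>a. [:const3 a:]"
  define \<psi> where "\<psi> = ev3 ?c u v w"
  have \<psi>: "rhom \<psi>" unfolding \<psi>_def by (simp add: rhom_ev1)
  note m = rhom_map_poly[OF \<psi>]
  \<comment> \<open>This keeps \<open>T\<close> and sends \<open>X\<close>, \<open>Y\<close>,
    \<open>Z\<close> to \<open>u\<close>, \<open>v\<close>, \<open>w\<close>; since
    \<open>T u\<close>, \<open>T v\<close>, \<open>T w\<close> are the homogenised coordinates, it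
    turns \<open>hgr3 f\<close> into the homogenisation of \<open>f(x, y, z)\<close>.\<close>
  let ?e = "\<lambda>g. poly (map_poly \<psi> g) [:0, 1:]"
  have e: "rhom ?e" by (rule rhom_comp[OF rhom_poly m])
  have "ev3 ?c (hgr3 x) (hgr3 y) (hgr3 z) = (\<lambda>f. ?e (hgr3 f))"
    by (rule rhom_ext_poly3[OF rhom_ev1[OF rhom_ev1[OF rhom_ev1[OF rhom_Cconst3]]] rhom_comp[OF e rhom_hgr3]])
       (simp_all add: ev3_simps[OF rhom_Cconst3] hgr3_simps map_poly_pCons rhom_0[OF \<psi>] u v w, simp_all add: \<psi>_def ev3_simps[OF rhom_Cconst3])
  then have "?e (hgr3 f) = ev3 ?c (hgr3 x) (hgr3 y) (hgr3 z) f" by simp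
  also have "\<dots> = hgr3 (ev3 const3 x y z f)"
    unfolding rhom_ev3_comp[OF rhom_hgr3 rhom_const3] hgr3_simps ..
  also have "\<dots> = 0" using f by (simp add: rhom_0[OF rhom_hgr3])
  finally have "?e (monom 1 (order 0 (hgr3 f))) * ?e h = 0"
    using h(1) rhom_mult[OF e] by metis
  moreover have "?e (monom 1 (order 0 (hgr3 f))) \<noteq> 0"
    using rhom_0[OF \<psi>] rhom_1[OF \<psi>] by (simp add: map_poly_monom poly_monom)
  ultimately have "?e h = 0" by simp
  then have "coeff (?e h) 0 = 0" by simp
  moreover have "coeff (?e h) 0 = coeff (\<psi> (poly h 0)) 0"
    by (cases h) (simp add: map_poly_pCons rhom_0[OF \<psi>])
  moreover have "coeff (\<psi> g) 0 = ev3 const3 (linpart x) (linpart y) (linpart z) g" for g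
    using rhom_ev3_comp[OF rhom_poly[of 0] rhom_Cconst3, of u v w g] u(2) v(2) w(2)
    by (simp add: \<psi>_def poly_0_coeff_0)
  ultimately have "ev3 const3 (linpart x) (linpart y) (linpart z) (poly h 0) = 0" by simp
  moreover obtain a b d where "\<And>f. ev3 const3 a b d (ev3 const3 (linpart x) (linpart y) (linpart z) f) = f"
    using ex_linear_inverse[OF gen] by blast
  ultimately have "poly h 0 = 0"
    using rhom_0[OF rhom_ev1[OF rhom_ev1[OF rhom_ev1[OF rhom_const3]]], of a b d] by metis
  then show False using h(2) by simp
qed

text \<open>A translation moves the coordinates to the origin, and its inverse recovers
  \<open>f\<close>.\<close>

lemma coordinates_independent:
  fixes x y z :: "'k::field poly3"
  assumes gen: "adjoin const3 {x, y, z} = UNIV" and f: "ev3 const3 x y z f = 0"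
  shows "f = 0"
proof -
  define X' Y' Z' where "X' = x - const3 (at03 x)" and "Y' = y - const3 (at03 y)" and "Z' = z - const3 (at03 z)"
  have in': "A \<in> adjoin const3 {X', Y', Z'}" if "A - const3 (at03 A) \<in> {X', Y', Z'}" for A
    using adjoin.add[OF adjoin.gen[OF that] adjoin.const[of const3 "at03 A"]] by simp
  have "adjoin const3 {x, y, z} \<subseteq> adjoin const3 {X', Y', Z'}"
    using in'[of x] in'[of y] in'[of z] by (intro adjoin_mono) (simp add: X'_def Y'_def Z'_def)
  then have gen': "adjoin const3 {X', Y', Z'} = UNIV" using gen by auto
  let ?t = "ev3 const3 (varX + const3 (at03 x)) (varY + const3 (at03 y)) (varZ + const3 (at03 z))"
  let ?t' = "ev3 const3 (varX - const3 (at03 x)) (varY - const3 (at03 y)) (varZ - const3 (at03 z))"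
  have rh: "rhom (ev3 const3 u v w)" for u v w :: "'k poly3" by (simp add: rhom_ev1)
  have "ev3 const3 X' Y' Z' (?t f) = ev3 const3 x y z f"
    unfolding rhom_ev3_comp[OF rh rhom_const3] rhom_add[OF rh] ev3_simps[OF rhom_const3]
    by (simp add: X'_def Y'_def Z'_def)
  moreover have "at03 X' = 0" "at03 Y' = 0" "at03 Z' = 0"
    by (simp_all add: X'_def Y'_def Z'_def rhom_diff[OF rhom_at03])
  ultimately have "?t f = 0" using coordinates_at0_independent[OF gen'] f by simp
  moreover have "?t' (?t f) = f"
    unfolding rhom_ev3_comp[OF rh rhom_const3] rhom_add[OF rh] ev3_simps[OF rhom_const3]
    by (simp add: ev3_std)
  ultimately show ?thesis using rhom_0[OF rh] by metis
qed

lemma coordinates_bij: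
  fixes x y z :: "'k::field poly3"
  assumes "adjoin const3 {x, y, z} = UNIV"
  shows "bij (ev3 const3 x y z)"
proof (rule bijI)
  have rh: "rhom (ev3 const3 x y z)" by (simp add: rhom_ev1)
  show "inj (ev3 const3 x y z)"
    using coordinates_independent[OF assms] rhom_diff[OF rh] by (intro injI) (metis eq_iff_diff_eq_0)
  show "surj (ev3 const3 x y z)" using assms by (simp only: adjoin3[OF rhom_const3])
qed

section \<open>Rigidity\<close>

lemma adjoin_hom:
  assumes \<phi>: "rhom \<phi>" "\<And>a. \<phi> (\<iota> a) \<in> adjoin \<iota>' (\<phi> ` S)" and x: "x \<in> adjoin \<iota> S"
  shows "\<phi> x \<in> adjoin \<iota>' (\<phi> ` S)"
  using x
proof induction
  case (gen x)
  then show ?case by (intro adjoin.gen) simp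
next
  case (add x y)
  then show ?case by (simp add: rhom_add[OF \<phi>(1)] adjoin.add)
next
  case (mult x y)
  then show ?case by (simp add: rhom_mult[OF \<phi>(1)] adjoin.mult)
qed (use \<phi> in auto)

lemma adjoin_singleton_eqI:
  assumes "x \<in> adjoin \<iota> {y}" "y \<in> adjoin \<iota> {x}"
  shows "adjoin \<iota> {x} = adjoin \<iota> {y}"
  using assms by (intro subset_antisym adjoin_mono) auto

text \<open>Conjugation by \<open>\<phi>\<close> makes \<open>x1\<close> the variable
  \<open>varX\<close>. The second coordinate is then the image of \<open>varX\<close> under the
  automorphism \<open>?\<theta>\<close>, the second coordinate map followed by the inverse of the
  first.\<close>

lemma ex_coordinates_two_invariant:
  fixes \<delta> :: "'k::field_gcd poly3 \<Rightarrow> 'k poly3 poly"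
  assumes \<delta>: "\<delta> \<in> EXP const3" and nt: "invariants \<delta> \<noteq> UNIV"
    and x: "adjoin const3 {x1, x2, x3} = UNIV" "x1 \<in> invariants \<delta>"
    and y: "adjoin const3 {y1, y2, y3} = UNIV" "y1 \<in> invariants \<delta>"
    and neq: "adjoin const3 {x1} \<noteq> adjoin const3 {y1}"
  shows "\<exists>u v w. adjoin const3 {u, v, w} = UNIV \<and> u \<in> invariants \<delta> \<and> v \<in> invariants \<delta>"
proof -
  define \<phi> where "\<phi> = ev3 const3 x1 x2 x3"
  define \<phi>' where "\<phi>' = ev3 const3 y1 y2 y3"
  have \<phi>: "rhom \<phi>" "bij \<phi>" and \<phi>': "rhom \<phi>'" "bij \<phi>'"
    using coordinates_bij[OF x(1)] coordinates_bij[OF y(1)] by (simp_all add: \<phi>_def \<phi>'_def rhom_ev1)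
  have c: "\<phi> (const3 a) = const3 a" "\<phi>' (const3 a) = const3 a" for a
    unfolding \<phi>_def \<phi>'_def by (simp_all only: ev3_simps[OF rhom_const3])
  have v: "\<phi> varX = x1" "\<phi>' varX = y1"
    unfolding \<phi>_def \<phi>'_def by (simp_all only: ev3_simps[OF rhom_const3])
  let ?\<psi> = "inv_into UNIV \<phi>"
  have \<psi>: "rhom ?\<psi>" using \<phi> by (rule rhom_inv)
  have \<psi>\<phi>: "?\<psi> (\<phi> b) = b" for b using \<phi>(2) by (simp add: bij_is_inj)
  have \<phi>\<psi>: "\<phi> (?\<psi> b) = b" for b using \<phi>(2) by (simp add: bij_is_surj surj_f_inv_f)
  have \<psi>c: "?\<psi> (const3 a) = const3 a" for a using \<psi>\<phi>[of "const3 a"] c by simp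
  have h: "\<phi> f \<in> adjoin const3 (\<phi> ` S)" if f: "f \<in> adjoin const3 S" for f S
  proof (rule adjoin_hom[OF \<phi>(1) _ f])
    show "\<phi> (const3 a) \<in> adjoin const3 (\<phi> ` S)" for a unfolding c by (rule adjoin.const)
  qed
  let ?\<theta> = "\<lambda>b. ?\<psi> (\<phi>' b)"
  let ?\<delta>' = "exp_conj \<phi> \<delta>"
  have inv': "b \<in> invariants ?\<delta>' \<longleftrightarrow> \<phi> b \<in> invariants \<delta>" for b
    using \<phi> by (rule exp_conj_invariants)
  have "\<exists>P s. P \<in> invariants ?\<delta>' \<and> adjoin const3 {varX, P, s} = UNIV"
  proof (rule two_invariant_variables[of ?\<delta>' ?\<theta>])
    show "?\<delta>' \<in> EXP const3" using exp_conj_EXP[OF \<delta> \<phi> c(1)] .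
    show "invariants ?\<delta>' \<noteq> UNIV"
    proof
      assume "invariants ?\<delta>' = UNIV"
      then have "\<phi> (?\<psi> b) \<in> invariants \<delta>" for b using inv' by blast
      then show False using nt \<phi>\<psi> by auto
    qed
    show "rhom ?\<theta>" using \<psi> \<phi>'(1) by (rule rhom_comp)
    show "bij ?\<theta>"
      using bij_comp[OF \<phi>'(2) bij_imp_bij_inv[OF \<phi>(2)]] by (simp add: o_def)
    show "?\<theta> (const3 a) = const3 a" for a by (simp only: c \<psi>c)
    show "varX \<in> invariants ?\<delta>'" using x(2) by (simp only: inv' v)
    show "?\<theta> varX \<in> invariants ?\<delta>'" using y(2) by (simp only: inv' v \<phi>\<psi>)
    show "adjoin const3 {varX} \<noteq> adjoin const3 {?\<theta> varX}"
    proof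
      assume eq: "adjoin const3 {varX} = adjoin const3 {?\<theta> varX}"
      have "varX \<in> adjoin const3 {?\<theta> varX}" unfolding eq[symmetric] by (rule adjoin.gen) simp
      from h[OF this] have 1: "x1 \<in> adjoin const3 {y1}" by (simp only: image_insert image_empty v \<phi>\<psi>)
      have "?\<theta> varX \<in> adjoin const3 {varX}" unfolding eq by (rule adjoin.gen) simp
      from h[OF this] have "y1 \<in> adjoin const3 {x1}" by (simp only: image_insert image_empty v \<phi>\<psi>)
      then show False using neq adjoin_singleton_eqI[OF 1] by simp
    qed
  qed
  then obtain P s where P: "P \<in> invariants ?\<delta>'" "adjoin const3 {varX, P, s} = UNIV" by blast
  have "b \<in> adjoin const3 {x1, \<phi> P, \<phi> s}" for b
  proof -
    have "\<phi> (?\<psi> b) \<in> adjoin const3 (\<phi> ` {varX, P, s})"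
      by (rule h) (simp only: P(2) UNIV_I)
    then show ?thesis by (simp only: \<phi>\<psi> image_insert image_empty v)
  qed
  then have "adjoin const3 {x1, \<phi> P, \<phi> s} = UNIV" by blast
  then show ?thesis using x(2) P(1) inv' by blast
qed

section \<open>Rank bounds and the case of rank one\<close>

lemma exp_rank_le:
  assumes "r \<le> n" "Xs \<in> coord_systems \<iota> n" "adjoin \<iota> (set (take (n - r) Xs)) \<subseteq> invariants \<delta>"
  shows "exp_rank \<iota> n \<delta> \<le> r"
  unfolding exp_rank_def using assms by (intro Least_le) blast

lemma exp_rank_le_n:
  assumes "\<delta> \<in> EXP \<iota>" "rhom \<iota>" "Xs \<in> coord_systems \<iota> n"
  shows "exp_rank \<iota> n \<delta> \<le> n"
proof (rule exp_rank_le[OF _ assms(3)])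
  have "x \<in> invariants \<delta>" if "x \<in> adjoin \<iota> {}" for x
    using that assms(1) by induction (auto simp: EXP_def invariants_def)
  then show "adjoin \<iota> (set (take (n - n) Xs)) \<subseteq> invariants \<delta>" by auto
qed simp

text \<open>An invariant \<open>f = F(x3)\<close> with coefficients in \<open>A[x1,x2]\<close> makes
  \<open>x3\<close> a root of \<open>F - f\<close>. As \<open>x3\<close> is transcendental over the
  invariants, \<open>F\<close> is the constant \<open>f\<close>.\<close>

lemma (in expmap) invariants_eq_adjoin_two:
  assumes \<iota>: "rhom \<iota>" and x: "adjoin \<iota> {x1, x2, x3} = UNIV" and inv: "adjoin \<iota> {x1, x2} \<subseteq> invariants \<delta>"
    and nt: "invariants \<delta> \<noteq> UNIV"
  shows "invariants \<delta> = adjoin \<iota> {x1, x2}"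
proof
  have eF: "\<exists>F. (\<forall>i. coeff F i \<in> adjoin \<iota> {x1, x2}) \<and> f = poly F x3" for f
  proof -
    have "f \<in> range (ev3 \<iota> x1 x2 x3)" using x by (simp only: adjoin3[OF \<iota>, symmetric] UNIV_I)
    then obtain G where G: "f = poly (map_poly (ev2 \<iota> x1 x2) G) x3" unfolding ev1_def[of "ev2 \<iota> x1 x2"] by blast
    have "ev2 \<iota> x1 x2 0 = 0" using \<iota> by (simp add: rhom_0 rhom_ev1)
    then have "coeff (map_poly (ev2 \<iota> x1 x2) G) i \<in> adjoin \<iota> {x1, x2}" for i
      using coeff_map_poly[of "ev2 \<iota> x1 x2" G i] unfolding adjoin2[OF \<iota>] by simp
    then show ?thesis using G by blast
  qed
  have "x3 \<notin> invariants \<delta>"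
  proof
    assume x3: "x3 \<in> invariants \<delta>"
    have "f \<in> invariants \<delta>" for f
    proof -
      obtain F where F: "\<forall>i. coeff F i \<in> adjoin \<iota> {x1, x2}" "f = poly F x3" using eF by blast
      show ?thesis
        unfolding F(2) poly_altdef using F(1) inv x3 by (intro inv_sum inv_mult inv_power) auto
    qed
    then show False using nt by blast
  qed
  show "invariants \<delta> \<subseteq> adjoin \<iota> {x1, x2}"
  proof
    fix f assume f: "f \<in> invariants \<delta>"
    obtain F where F: "\<forall>i. coeff F i \<in> adjoin \<iota> {x1, x2}" "f = poly F x3" using eF by blast
    have "F - [:f:] = 0"
    proof (rule invariant_poly_root[OF \<open>x3 \<notin> invariants \<delta>\<close>])
      have "coeff F i \<in> invariants \<delta>" for i using F(1) inv by blast
      then show "coeff (F - [:f:]) i \<in> invariants \<delta>" for i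
        using f by (simp add: coeff_pCons inv_diff split: nat.split)
      show "poly (F - [:f:]) x3 = 0" using F(2) by simp
    qed
    then have "coeff F 0 = f" by (metis coeff_pCons_0 eq_iff_diff_eq_0)
    then show "f \<in> adjoin \<iota> {x1, x2}" using F(1) by metis
  qed
qed (rule inv)

section \<open>Passage between the base domain and its fraction field\<close>

lemma rhom_to_fract3 [simp]: "rhom to_fract3"
  unfolding to_fract3_def by (intro rhom_map_poly rhom_to_fract)

lemma exp_ext_invariant:
  assumes \<delta>: "\<delta> \<in> EXP const3" and b: "b \<in> invariants \<delta>"
  shows "to_fract3 b \<in> invariants (exp_ext \<delta>)"
proof -
  have 1: "frac3 c 1 = to_fract3 c" for c :: "'a poly3"
    using frac3_cancel[of 1 c] by simp
  have "exp_ext \<delta> (to_fract3 b) = frac3_poly (\<delta> b) 1"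
    using exp_ext_frac3[OF \<delta>, of 1 b] by (simp add: 1)
  then show ?thesis using b by (simp add: invariants_def frac3_poly_def map_poly_pCons 1)
qed

lemma coordinates_to_fract3:
  assumes "adjoin const3 {x1, x2, x3} = UNIV"
  shows "adjoin const3 {to_fract3 x1, to_fract3 x2, to_fract3 x3} = UNIV"
proof -
  have "f \<in> adjoin const3 {to_fract3 x1, to_fract3 x2, to_fract3 x3}" for f
  proof -
    obtain b s where f: "f = frac3 b s" using ex_frac3 by blast
    have "to_fract3 b \<in> adjoin const3 (to_fract3 ` {x1, x2, x3})"
    proof (rule adjoin_hom[OF rhom_to_fract3])
      show "to_fract3 (const3 a) \<in> adjoin const3 (to_fract3 ` {x1, x2, x3})" for a
        unfolding to_fract3_const3 by (rule adjoin.const)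
      show "b \<in> adjoin const3 {x1, x2, x3}" unfolding assms by (rule UNIV_I)
    qed
    then have "const3 (Fract 1 s) * to_fract3 b \<in> adjoin const3 (to_fract3 ` {x1, x2, x3})"
      by (intro adjoin.mult adjoin.const)
    then show ?thesis by (simp only: f frac3_def image_insert image_empty)
  qed
  then show ?thesis by blast
qed

lemma map_poly_eq_const:
  assumes f: "f 0 = 0" "\<And>x. f x = 0 \<Longrightarrow> x = 0" and eq: "map_poly f p = [:c:]"
  obtains a where "p = [:a:]" "f a = c"
proof -
  have "degree (map_poly f p) = degree p" using f(2) by (intro degree_map_poly) blast
  then obtain a where a: "p = [:a:]" using eq by (auto elim: degree_eq_zeroE)
  then have "f a = c" using eq f(1) by (simp add: map_poly_pCons)
  with a that show ?thesis by blast
qed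

text \<open>Over the domain \<open>y\<close> is a polynomial \<open>F\<close> in all three
  coordinates, over the fraction field a polynomial \<open>Q\<close> in the first. Independence over
  the field makes them equal, so \<open>F\<close> involves the first variable only and keeps its
  coefficients in the domain.\<close>

lemma adjoin_first_coordinate_descends:
  fixes x1 :: "'a::idom poly3"
  assumes x: "adjoin const3 {x1, x2, x3} = UNIV" and y: "to_fract3 y \<in> adjoin const3 {to_fract3 x1}"
  shows "y \<in> adjoin const3 {x1}"
proof -
  have "y \<in> range (ev3 const3 x1 x2 x3)" using x by (simp only: adjoin3[OF rhom_const3, symmetric] UNIV_I)
  then obtain F where F: "y = ev3 const3 x1 x2 x3 F" by blast
  obtain Q where Q: "to_fract3 y = ev1 const3 (to_fract3 x1) Q"
    using y unfolding adjoin1[OF rhom_const3] by blast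
  let ?K = "ev3 const3 (to_fract3 x1) (to_fract3 x2) (to_fract3 x3)"
  have K: "rhom ?K" by (simp add: rhom_ev1)
  have t1: "ev1 (\<lambda>a. to_fract3 (const3 a)) u p = ev1 const3 u (map_poly to_fract p)" for u and p :: "'a poly"
    by (simp add: ev1_map_poly)
  have "to_fract3 y = ?K (map_poly3 to_fract F)"
    unfolding F rhom_ev3_comp[OF rhom_to_fract3 rhom_const3]
    by (simp add: ev1_map_poly rhom_ev1 rhom_map_poly)
  moreover have "to_fract3 y = ?K [:[:Q:]:]" by (simp add: Q rhom_ev1)
  ultimately have "?K (map_poly3 to_fract F - [:[:Q:]:]) = 0" by (simp add: rhom_diff[OF K])
  then have "map_poly3 to_fract F - [:[:Q:]:] = 0"
    by (rule coordinates_independent[OF coordinates_to_fract3[OF x]])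
  then have eF: "map_poly3 to_fract F = [:[:Q:]:]" by simp
  have m1: "p = 0" if "map_poly to_fract p = 0" for p :: "'a poly"
    using map_poly_eq_0D[of to_fract p] that by simp
  have m2: "p = 0" if "map_poly2 to_fract p = 0" for p :: "'a poly poly"
    using map_poly_eq_0D[of "map_poly to_fract" p] m1 that by simp
  obtain G where G: "F = [:G:]" "map_poly2 to_fract G = [:Q:]"
    by (rule map_poly_eq_const[OF _ m2 eF]) simp_all
  obtain q where q: "G = [:q:]"
    by (rule map_poly_eq_const[OF _ m1 G(2)]) simp_all
  have "y = ev1 const3 x1 q" by (simp add: F G q rhom_ev1)
  then show ?thesis unfolding adjoin1[OF rhom_const3] by blast
qed

lemma length_3_cases:
  assumes "length xs = 3"
  obtains a b c where "xs = [a, b, c]"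
  using assms by (auto simp: numeral_3_eq_3 length_Suc_conv)

theorem theorem4p8:
  fixes \<delta> :: "'a::idom poly3 \<Rightarrow> 'a poly3 poly"
  assumes "\<delta> \<in> EXP const3"
    and "exp_rank const3 3 \<delta> = exp_rank const3 3 (exp_ext \<delta>)"
  shows "rigid const3 3 \<delta>"
  unfolding rigid_def
proof (intro ballI)
  fix Xs Ys
  assume Xs: "Xs \<in> adapted_coord_systems const3 3 \<delta>" and Ys: "Ys \<in> adapted_coord_systems const3 3 \<delta>"
  interpret expmap \<delta> using assms(1) by (simp add: EXP_iff)
  define r where "r = exp_rank const3 3 \<delta>"
  obtain x1 x2 x3 where x: "Xs = [x1, x2, x3]" "adjoin const3 {x1, x2, x3} = UNIV"
    using Xs by (auto simp: adapted_coord_systems_def coord_systems_def elim!: length_3_cases)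
  obtain y1 y2 y3 where y: "Ys = [y1, y2, y3]" "adjoin const3 {y1, y2, y3} = UNIV"
    using Ys by (auto simp: adapted_coord_systems_def coord_systems_def elim!: length_3_cases)
  have xinv: "adjoin const3 (set (take (3 - r) Xs)) \<subseteq> invariants \<delta>"
    and yinv: "adjoin const3 (set (take (3 - r) Ys)) \<subseteq> invariants \<delta>"
    using Xs Ys by (auto simp: adapted_coord_systems_def r_def)
  have Xc: "Xs \<in> coord_systems const3 3" using Xs by (simp add: adapted_coord_systems_def)
  have "r \<le> 3" unfolding r_def using exp_rank_le_n[OF assms(1) rhom_const3 Xc] .
  \<comment> \<open>The case numbers below exceed the rank by one.\<close>
  then consider "r = 0" | "r = 1" | "r = 2" | "r = 3" by linarith
  then have "adjoin const3 (set (take (3 - r) Xs)) = adjoin const3 (set (take (3 - r) Ys))"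
  proof cases
    case 1
    then show ?thesis using x y by simp
  next
    case 2
    have "invariants \<delta> \<noteq> UNIV"
      using exp_rank_le[of 0 3 Xs const3 \<delta>] Xc 2 by (auto simp: r_def)
    then have "invariants \<delta> = adjoin const3 {x1, x2}" "invariants \<delta> = adjoin const3 {y1, y2}"
      using invariants_eq_adjoin_two[OF rhom_const3 x(2)] invariants_eq_adjoin_two[OF rhom_const3 y(2)]
        xinv yinv x(1) y(1) 2 by simp_all
    then show ?thesis using x(1) y(1) 2 by simp
  next
    case 3
    let ?e = "exp_ext \<delta>"
    have e: "?e \<in> EXP const3" using assms(1) by (rule exp_ext_in_EXP)
    \<comment> \<open>The equality of the ranks enters here: no coordinate system over the fraction
      field can have two invariant members.\<close>
    have rank: "exp_rank const3 3 ?e = 2" using assms(2) 3 by (simp add: r_def)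
    note Kx = coordinates_to_fract3[OF x(2)] and Ky = coordinates_to_fract3[OF y(2)]
    have "x1 \<in> invariants \<delta>" "y1 \<in> invariants \<delta>"
      using xinv yinv 3 x(1) y(1) adjoin.gen[of x1 "{x1}" const3] adjoin.gen[of y1 "{y1}" const3] by auto
    then have inv: "to_fract3 x1 \<in> invariants ?e" "to_fract3 y1 \<in> invariants ?e"
      using exp_ext_invariant[OF assms(1)] by blast+
    have nt: "invariants ?e \<noteq> UNIV"
      using exp_rank_le[of 0 3 "[to_fract3 x1, to_fract3 x2, to_fract3 x3]" const3 ?e] Kx rank
      by (auto simp: coord_systems_def)
    have "\<not> (adjoin const3 {u, v, w} = UNIV \<and> u \<in> invariants ?e \<and> v \<in> invariants ?e)" for u v w
    proof
      assume uvw: "adjoin const3 {u, v, w} = UNIV \<and> u \<in> invariants ?e \<and> v \<in> invariants ?e"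
      interpret K: expmap ?e using e by (simp add: EXP_iff)
      have c: "const3 a \<in> invariants ?e" for a using e by (simp add: EXP_iff invariants_def)
      have "f \<in> invariants ?e" if "f \<in> adjoin const3 {u, v}" for f
        using that by induction (use uvw c in \<open>auto intro: K.inv_add K.inv_mult\<close>)
      then have "exp_rank const3 3 ?e \<le> 1"
        using uvw by (intro exp_rank_le[of 1 3 "[u, v, w]"]) (auto simp: coord_systems_def numeral_eq_Suc)
      then show False using rank by simp
    qed
    then have "adjoin const3 {to_fract3 x1} = adjoin const3 {to_fract3 y1}"
      using ex_coordinates_two_invariant[OF e nt Kx inv(1) Ky inv(2)] by blast
    then have "to_fract3 y1 \<in> adjoin const3 {to_fract3 x1}" "to_fract3 x1 \<in> adjoin const3 {to_fract3 y1}"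
      using adjoin.gen[of "to_fract3 y1" "{to_fract3 y1}" const3] adjoin.gen[of "to_fract3 x1" "{to_fract3 x1}" const3]
      by simp_all
    then have "adjoin const3 {x1} = adjoin const3 {y1}"
      using adjoin_first_coordinate_descends[OF x(2)] adjoin_first_coordinate_descends[OF y(2)]
      by (intro adjoin_singleton_eqI)
    then show ?thesis using 3 x(1) y(1) by simp
  next
    case 4
    then show ?thesis by simp
  qed
  then show "adjoin const3 (set (take (3 - exp_rank const3 3 \<delta>) Xs)) =
    adjoin const3 (set (take (3 - exp_rank const3 3 \<delta>) Ys))" by (simp only: r_def)
qed

end
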